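(* Let $\alpha_{\mathrm{AOSC}}>0$ be such that the open-loop policy design problem $$\min_\pi\ \max_{1\le m\le M} I_{m,\pi}^{-1}\quad\text{s.t.}\quad \mathrm{AOSC}(\pi)\le\alpha_{\mathrm{AOSC}},\quad \operatorname{supp}(\overline q)\subseteq\text{one recurrence class of }T$$ (over open-loop policies $\pi=(q,T)$ of window size $2$) is feasible with a strictly positive optimal value and an optimal solution $\pi^\dagger$. For any $\theta>0$ there exists $\kappa>0$ such that for all $\gamma>\kappa$ and all $b>1$, the observation-dependent sampling policy $\widehat\pi$ of the $2$-threshold stopping time $\tau_{\widehat\pi}$ (built from $\pi^\dagger$, thresholds $\kappa,\gamma$ and base $b$) satisfies $$\mathrm{AOSC}(\widehat\pi)\le\alpha_{\mathrm{AOSC}}+\theta.$$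
   Context: Signal model. $p_0,p_1,\dots,p_M$ are distinct pdfs on $\mathbb{R}^N$. The signal $X_1,X_2,\dots$ is a sequence of independent random vectors with $X_t\sim p_0$ for $t<\nu$ and $X_t\sim p_m$ for $t\ge\nu$, where the change point $\nu\ge 0$ and $m\in\{1,\dots,M\}$ are unknown deterministic constants. There is a finite set of actions $\mathcal{A}=\{1,\dots,|\mathcal{A}|\}$. At each time $t$ an action $A_t\in\mathcal{A}$ is chosen and the pair $(A_t,Y_t)$ is observed, where $Y_t=A_t(X_t)$ is a function of $X_t$ determined by the action. $p_m(\cdot\mid a)$ denotes the conditional pdf of $Y_t$ given $A_t=a$ when $X_t\sim p_m$; given $A_t$, $Y_t$ is conditionally independent of $Y_1,\dots,Y_{t-1},A_1,\dots,A_{t-1}$. For each $m\in\{1,\dots,M\}$ there is an action $a$ under which $p_0$ and $p_m$ are distinguishable, i.e. $p_m(\cdot\mid a)\ne p_0(\cdot\mid a)$. $\mathbb{E}_\infty$ denotes expectation when there is no change (all $X_t\sim p_0$). $D(\cdot\,\|\,\cdot)$ is the Kullback-Leibler divergence and $a^{k:t}=(a_k,\dots,a_t)$. Policies and AOSC. A policy is a sequence of randomized functions determining $A_{t+1}$ from $(A_1,Y_1),\dots,(A_t,Y_t)$. An open-loop policy of window size $2$ is a Markov chain of order $2$ on $\mathcal{A}$, written $\pi=(q,T)$, where $q$ is the distribution of $(A_1,A_2)$ on $\mathcal{A}^2$ and $T$ is the transition matrix of the $\mathcal{A}^2$-valued chain $(A_{t-1},A_t)$. $\overline q(\alpha)=\lim_{t\to\infty}\mathbb{E}[\frac1t\sum_{j=1}^t\mathbf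 1\{\text{the }j\text{-th state of this chain equals }\alpha\}]$ for $\alpha\in\mathcal{A}^2$, and $I_{m,\pi}=\sum_{\alpha\in\mathcal{A}^2}\overline q(\alpha)D(p_m(\cdot\mid\alpha[2])\,\|\,p_0(\cdot\mid\alpha[2]))$, where $\alpha[2]$ is the second entry of $\alpha$. Given a cost matrix $\mathcal{C}\in\mathbb{R}^{|\mathcal{A}|\times|\mathcal{A}|}$ ($\mathcal{C}[i,j]$ is the cost of switching from action $i$ to $j$), $\mathrm{AOSC}(\pi)=\limsup_{n\to\infty}\frac1n\mathbb{E}_\infty[\sum_{t=2}^{n+1}\mathcal{C}[A_{t-1},A_t]]$ for any policy $\pi$. CuSum statistics. For a policy $\pi$: $S_m(0,\pi)=0$, $S_m(t,\pi)=\big(S_m(t-1,\pi)+\log\frac{p_m(Y_t\mid A_t)}{p_0(Y_t\mid A_t)}\big)^+$, $S(t,\pi)=\max_{1\le m\le M}S_m(t,\pi)$. $2$-threshold stopping time and policy $\widehat\pi$. Inputs: $\pi^\dagger=(q,T)$ of window size $2$, thresholds $0<\kappa<\gamma$, base $b>1$. For each $m$ let $A^*_m\in\arg\max_{a\in\mathcal{A}}D(p_m(\cdot\mid a)\,\|\,p_0(\cdot\mid a))$. Initialize $t=2$, $l=0$, $t_\kappa=0$, draw the first two actions $(a_1,a_2)$ from $q$, and compute $S(t,\widehat\pi)$. While $S(t,\widehat\pi)\le\gamma$, choose the next action $a_{t+1}$ as follows. (i) If $S(t,\widehat\pi)\le\kappa$ and $S(t-1,\widehat\pi)\le\kappa$: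 take $a_{t+1}$ according to $\pi^\dagger$. If $S(t,\widehat\pi)\le\kappa$ and $S(t-1,\widehat\pi)>\kappa$: restart $\pi^\dagger$ by drawing its first two actions $(a_{t+1},a_{t+2})$ from $q$. (ii) If $S(t,\widehat\pi)>\kappa$: first, if $S(t-1,\widehat\pi)\le\kappa$, set $t_\kappa:=t$ and $l:=0$. Then, if $t=t_\kappa+\lceil b^l\rceil$, draw $a_{t+1}$ uniformly at random from $\mathcal{A}$ and set $l:=l+1$; otherwise set $a_{t+1}:=A^*_m$ with $m=\arg\max_{1\le m\le M}S_m(t-1,\widehat\pi)$. Then set $t:=t+1$ and update $S(t,\widehat\pi)$. When $S(t,\widehat\pi)>\gamma$, stop and set $\tau_{\widehat\pi}=t$. $\widehat\pi$ is the resulting sampling policy; for computing $\mathrm{AOSC}(\widehat\pi)$ (a limit over an infinite horizon) the action-selection rule (i)-(ii) is applied at all times. *)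

theory Defs
  imports "HOL-Probability.Probability"
begin

section \<open>Signal model\<close>

definition is_pdf :: "'x measure \<Rightarrow> ('x \<Rightarrow> real) \<Rightarrow> bool" where
  "is_pdf N g \<longleftrightarrow> g \<in> borel_measurable N \<and> (\<forall>x. 0 \<le> g x) \<and> prob_space (density N g)"

text \<open>
  \<open>p m\<close> is the density of the signal on the Euclidean space (\<open>m = 0\<close>: before the change), and
  \<open>Y\<^sub>t = obs a X\<^sub>t\<close> is what is observed under the action \<open>a\<close>. The type \<open>'y\<close> need not be Euclidean
  (different actions may yield observations of different kinds), so that the conditional density
  \<open>f m a\<close> of the observation given the action \<open>a\<close> is taken with respect to a
  \<open>\<sigma>\<close>-finite reference measure \<open>\<nu> a\<close> (e.g. Lebesgue measure on the range of \<open>obs a\<close>).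
  As usual, densities are compared up to null sets.
\<close>

definition signal_model ::
  "nat \<Rightarrow> (nat \<Rightarrow> real^'n \<Rightarrow> real) \<Rightarrow> ('a::finite \<Rightarrow> real^'n \<Rightarrow> 'y) \<Rightarrow> ('a \<Rightarrow> 'y measure) \<Rightarrow>
    (nat \<Rightarrow> 'a \<Rightarrow> 'y \<Rightarrow> real) \<Rightarrow> bool" where
  "signal_model M p obs \<nu> f \<longleftrightarrow>
     1 \<le> M \<and>
     (\<forall>m\<le>M. is_pdf lborel (p m)) \<and>
     inj_on (\<lambda>m. density lborel (p m)) {0..M} \<and>
     (\<forall>a. sigma_finite_measure (\<nu> a) \<and> obs a \<in> borel \<rightarrow>\<^sub>M \<nu> a) \<and>
     (\<forall>m\<le>M. \<forall>a. is_pdf (\<nu> a) (f m a) \<and>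
        distr (density lborel (p m)) (\<nu> a) (obs a) = density (\<nu> a) (f m a)) \<and>
     (\<forall>m\<in>{1..M}. \<exists>a. density (\<nu> a) (f m a) \<noteq> density (\<nu> a) (f 0 a))"

text \<open>
  Kullback-Leibler divergence \<open>D(P \<parallel> Q)\<close> with values in the extended reals. The library's
  \<^const>\<open>KL_divergence\<close> takes its arguments in the opposite order and is a Bochner integral, hence
  \<open>0\<close> instead of \<open>\<infinity>\<close> if the integrand is not integrable. The negative part of the integrand is always
  integrable, so that the divergence is \<open>\<infinity>\<close> in this case.
\<close>

definition KL :: "'y measure \<Rightarrow> 'y measure \<Rightarrow> ereal" where
  "KL P Q =
     (if absolutely_continuous Q P \<and> integrable P (entropy_density (exp 1) Q P)
      then ereal (KL_divergence (exp 1) Q P) else \<infinity>)"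

definition KL_action ::
  "('a \<Rightarrow> 'y measure) \<Rightarrow> (nat \<Rightarrow> 'a \<Rightarrow> 'y \<Rightarrow> real) \<Rightarrow> nat \<Rightarrow> 'a \<Rightarrow> ereal" where
  "KL_action \<nu> f m a = KL (density (\<nu> a) (f m a)) (density (\<nu> a) (f 0 a))"


section \<open>Policies and their law when there is no change\<close>

text \<open>
  A history \<open>(A\<^sub>t, Y\<^sub>t), \<dots>, (A\<^sub>1, Y\<^sub>1)\<close> lists the most recent pair first, so that its length is
  the time \<open>t\<close> and \<^const>\<open>tl\<close> goes back one step. A policy maps it to the conditional
  distribution of \<open>A\<^sub>t\<^sub>+\<^sub>1\<close>.
\<close>

type_synonym ('a, 'y) history = "('a \<times> 'y) list"
type_synonym ('a, 'y) policy = "('a, 'y) history \<Rightarrow> 'a pmf"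

text \<open>
  A sample path is \<open>\<omega> :: nat \<Rightarrow> 'a \<times> (real^'n)\<close>, where \<open>\<omega> i\<close> is the pair \<open>(A\<^sub>t, X\<^sub>t)\<close> for \<open>t = i + 1\<close>.
\<close>

primrec hist ::
  "('a \<Rightarrow> real^'n \<Rightarrow> 'y) \<Rightarrow> (nat \<Rightarrow> 'a \<times> (real^'n)) \<Rightarrow> nat \<Rightarrow> ('a, 'y) history" where
  "hist obs \<omega> 0 = []"
| "hist obs \<omega> (Suc i) = (fst (\<omega> i), obs (fst (\<omega> i)) (snd (\<omega> i))) # hist obs \<omega> i"

definition act :: "(nat \<Rightarrow> 'a \<times> 'x) \<Rightarrow> nat \<Rightarrow> 'a" where
  "act \<omega> t = fst (\<omega> (t - 1))"

definition step_space :: "nat \<Rightarrow> ('a \<times> (real^'n)) measure" where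
  "step_space i = count_space UNIV \<Otimes>\<^sub>M borel"

definition step_kernel ::
  "(real^'n \<Rightarrow> real) \<Rightarrow> ('a \<Rightarrow> real^'n \<Rightarrow> 'y) \<Rightarrow> ('a, 'y) policy \<Rightarrow>
    nat \<Rightarrow> (nat \<Rightarrow> 'a \<times> (real^'n)) \<Rightarrow> ('a \<times> (real^'n)) measure" where
  "step_kernel p0 obs \<pi> i \<omega> = measure_pmf (\<pi> (hist obs \<omega> i)) \<Otimes>\<^sub>M density lborel p0"

text \<open>
  The Ionescu-Tulcea measure of the process in which all \<open>X\<^sub>t\<close> are independent with density \<open>p0\<close> and
  \<open>A\<^sub>t\<^sub>+\<^sub>1\<close> is drawn by the policy; \<open>\<bbbE>\<^sub>\<infinity>\<close> is integration with respect to it.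
\<close>

definition no_change_law ::
  "(real^'n \<Rightarrow> real) \<Rightarrow> ('a \<Rightarrow> real^'n \<Rightarrow> 'y) \<Rightarrow> ('a, 'y) policy \<Rightarrow> (nat \<Rightarrow> 'a \<times> (real^'n)) measure" where
  "no_change_law p0 obs \<pi> =
     projective_family.lim UNIV (Ionescu_Tulcea.CI (step_kernel p0 obs \<pi>) step_space) step_space"

definition AOSC ::
  "(real^'n \<Rightarrow> real) \<Rightarrow> ('a \<Rightarrow> real^'n \<Rightarrow> 'y) \<Rightarrow> ('a \<Rightarrow> 'a \<Rightarrow> real) \<Rightarrow> ('a, 'y) policy \<Rightarrow> ereal" where
  "AOSC p0 obs C \<pi> =
     limsup (\<lambda>n. ereal (1 / real n *
       (\<integral>\<omega>. (\<Sum>t = 2..n + 1. C (act \<omega> (t - 1)) (act \<omega> t)) \<partial>no_change_law p0 obs \<pi>)))"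


section \<open>Open-loop policies of window size 2\<close>

text \<open>
  The pair \<open>(q, T)\<close>: initial distribution and transition matrix of the chain
  \<open>(A\<^sub>t\<^sub>-\<^sub>1, A\<^sub>t)\<close>, which forces consecutive states to overlap.
\<close>

type_synonym 'a open_loop = "('a \<times> 'a) pmf \<times> ('a \<times> 'a \<Rightarrow> ('a \<times> 'a) pmf)"

definition is_open_loop :: "'a open_loop \<Rightarrow> bool" where
  "is_open_loop \<pi> \<longleftrightarrow> (\<forall>\<alpha>. \<forall>\<beta>\<in>set_pmf (snd \<pi> \<alpha>). fst \<beta> = snd \<alpha>)"

text \<open>
  Drawing \<open>(a\<^sub>1, a\<^sub>2)\<close> from \<open>q\<close> is done in two steps, since a policy chooses one action at a time:
  \<open>a\<^sub>1\<close> from the first marginal, then \<open>a\<^sub>2\<close> from the conditional distribution given \<open>a\<^sub>1\<close>.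
\<close>

definition draw_first :: "'a open_loop \<Rightarrow> 'a pmf" where
  "draw_first \<pi> = map_pmf fst (fst \<pi>)"

definition draw_second :: "'a open_loop \<Rightarrow> 'a \<Rightarrow> 'a pmf" where
  "draw_second \<pi> a = map_pmf snd (cond_pmf (fst \<pi>) {\<alpha>. fst \<alpha> = a})"

definition draw_next :: "'a open_loop \<Rightarrow> 'a \<times> 'a \<Rightarrow> 'a pmf" where
  "draw_next \<pi> \<alpha> = map_pmf snd (snd \<pi> \<alpha>)"

fun open_loop_policy :: "'a open_loop \<Rightarrow> ('a, 'y) policy" where
  "open_loop_policy \<pi> [] = draw_first \<pi>"
| "open_loop_policy \<pi> [(a, _)] = draw_second \<pi> a"
| "open_loop_policy \<pi> ((a, _) # (a', _) # _) = draw_next \<pi> (a', a)"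

definition qbar ::
  "(real^'n \<Rightarrow> real) \<Rightarrow> ('a \<Rightarrow> real^'n \<Rightarrow> 'y) \<Rightarrow> 'a open_loop \<Rightarrow> 'a \<times> 'a \<Rightarrow> real" where
  "qbar p0 obs \<pi> \<alpha> =
     lim (\<lambda>t. \<integral>\<omega>. 1 / real t * (\<Sum>j = 1..t. indicator {\<alpha>} (act \<omega> j, act \<omega> (j + 1)))
       \<partial>no_change_law p0 obs (open_loop_policy \<pi>))"

definition info ::
  "(real^'n \<Rightarrow> real) \<Rightarrow> ('a::finite \<Rightarrow> real^'n \<Rightarrow> 'y) \<Rightarrow> ('a \<Rightarrow> 'y measure) \<Rightarrow>
    (nat \<Rightarrow> 'a \<Rightarrow> 'y \<Rightarrow> real) \<Rightarrow> nat \<Rightarrow> 'a open_loop \<Rightarrow> ereal" where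
  "info p0 obs \<nu> f m \<pi> = (\<Sum>\<alpha>\<in>UNIV. ereal (qbar p0 obs \<pi> \<alpha>) * KL_action \<nu> f m (snd \<alpha>))"

definition reachable :: "('s \<Rightarrow> 's pmf) \<Rightarrow> 's \<Rightarrow> 's \<Rightarrow> bool" where
  "reachable T = (\<lambda>\<alpha> \<beta>. \<beta> \<in> set_pmf (T \<alpha>))\<^sup>*\<^sup>*"

text \<open>
  A state of a finite chain is recurrent iff it is reachable from every state that it can reach; its
  recurrence class then consists of all the states that it can reach.
\<close>

definition recurrence_class :: "('s \<Rightarrow> 's pmf) \<Rightarrow> 's set \<Rightarrow> bool" where
  "recurrence_class T R \<longleftrightarrow>
     (\<exists>\<alpha>. (\<forall>\<beta>. reachable T \<alpha> \<beta> \<longrightarrow> reachable T \<beta> \<alpha>) \<and> R = {\<beta>. reachable T \<alpha> \<beta>})"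

text \<open>Here \<open>inverse 0 = \<infinity>\<close> and \<open>inverse \<infinity> = 0\<close>.\<close>

definition objective ::
  "nat \<Rightarrow> (real^'n \<Rightarrow> real) \<Rightarrow> ('a::finite \<Rightarrow> real^'n \<Rightarrow> 'y) \<Rightarrow> ('a \<Rightarrow> 'y measure) \<Rightarrow>
    (nat \<Rightarrow> 'a \<Rightarrow> 'y \<Rightarrow> real) \<Rightarrow> 'a open_loop \<Rightarrow> ereal" where
  "objective M p0 obs \<nu> f \<pi> = (MAX m\<in>{1..M}. inverse (info p0 obs \<nu> f m \<pi>))"

definition feasible ::
  "(real^'n \<Rightarrow> real) \<Rightarrow> ('a::finite \<Rightarrow> real^'n \<Rightarrow> 'y) \<Rightarrow> ('a \<Rightarrow> 'a \<Rightarrow> real) \<Rightarrow> real \<Rightarrow>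
    'a open_loop \<Rightarrow> bool" where
  "feasible p0 obs C \<alpha> \<pi> \<longleftrightarrow>
     is_open_loop \<pi> \<and>
     AOSC p0 obs C (open_loop_policy \<pi>) \<le> ereal \<alpha> \<and>
     (\<exists>R. recurrence_class (snd \<pi>) R \<and> {\<beta>. qbar p0 obs \<pi> \<beta> \<noteq> 0} \<subseteq> R)"


section \<open>CuSum statistics and the 2-threshold stopping time\<close>

text \<open>
  The likelihood ratio may vanish, in which case its logarithm is \<open>-\<infinity>\<close> and resets the statistic;
  the real \<^const>\<open>ln\<close> would give \<open>ln 0 = 0\<close>. The value \<open>\<infinity>\<close> only occurs on a null set if there is
  no change.
\<close>

definition llr :: "(nat \<Rightarrow> 'a \<Rightarrow> 'y \<Rightarrow> real) \<Rightarrow> nat \<Rightarrow> 'a \<Rightarrow> 'y \<Rightarrow> ereal" where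
  "llr f m a y =
     (if f m a y = 0 then -\<infinity> else if f 0 a y = 0 then \<infinity> else ereal (ln (f m a y / f 0 a y)))"

fun cusum :: "(nat \<Rightarrow> 'a \<Rightarrow> 'y \<Rightarrow> real) \<Rightarrow> nat \<Rightarrow> ('a, 'y) history \<Rightarrow> ereal" where
  "cusum f m [] = 0"
| "cusum f m ((a, y) # h) = max 0 (cusum f m h + llr f m a y)"

definition max_cusum :: "nat \<Rightarrow> (nat \<Rightarrow> 'a \<Rightarrow> 'y \<Rightarrow> real) \<Rightarrow> ('a, 'y) history \<Rightarrow> ereal" where
  "max_cusum M f h = (MAX m\<in>{1..M}. cusum f m h)"

text \<open>
  The variables \<open>(t\<^sub>\<kappa>, l)\<close> are functions of the statistics \<open>S\<close> observed so far. With \<open>t = length h\<close>,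
  \<open>counters S \<kappa> b h\<close> is their value at the beginning of the choice of \<open>a\<^sub>t\<^sub>+\<^sub>1\<close>, and \<open>reset\<close>
  performs the assignment made upon crossing \<open>\<kappa>\<close> from below. The loop starts at \<open>t = 2\<close>.
\<close>

definition reset ::
  "(('a, 'y) history \<Rightarrow> ereal) \<Rightarrow> real \<Rightarrow> ('a, 'y) history \<Rightarrow> nat \<times> nat \<Rightarrow> nat \<times> nat" where
  "reset S \<kappa> h c = (if S (tl h) \<le> ereal \<kappa> then (length h, 0) else c)"

definition explore :: "real \<Rightarrow> ('a, 'y) history \<Rightarrow> nat \<times> nat \<Rightarrow> bool" where
  "explore b h c \<longleftrightarrow> length h = fst c + nat \<lceil>b ^ snd c\<rceil>"

primrec counters ::
  "(('a, 'y) history \<Rightarrow> ereal) \<Rightarrow> real \<Rightarrow> real \<Rightarrow> ('a, 'y) history \<Rightarrow> nat \<times> nat" where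
  "counters S \<kappa> b [] = (0, 0)"
| "counters S \<kappa> b (z # h) =
     (if 2 \<le> length h \<and> S h > ereal \<kappa>
      then (let c = reset S \<kappa> h (counters S \<kappa> b h)
            in if explore b h c then (fst c, Suc (snd c)) else c)
      else counters S \<kappa> b h)"

text \<open>
  \<open>Astar m\<close> is the preferred action against \<open>m\<close>, and \<open>tie\<close> selects one of the maximizers of the
  CuSum statistics. If \<open>S h \<le> \<kappa>\<close>, the open-loop policy was restarted for the choice of the current
  action (case \<open>S (tl h) > \<kappa>\<close>), for that of the previous action (case \<open>S (tl (tl h)) > \<kappa>\<close>, and
  the second action of the pair drawn from \<open>q\<close> is due), or earlier.
\<close>

fun two_threshold_policy ::
  "nat \<Rightarrow> (nat \<Rightarrow> 'a::finite \<Rightarrow> 'y \<Rightarrow> real) \<Rightarrow> (nat \<Rightarrow> 'a) \<Rightarrow> (nat set \<Rightarrow> nat) \<Rightarrow> 'a open_loop \<Rightarrow>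
    real \<Rightarrow> real \<Rightarrow> ('a, 'y) policy" where
  "two_threshold_policy M f Astar tie \<pi> \<kappa> b [] = draw_first \<pi>"
| "two_threshold_policy M f Astar tie \<pi> \<kappa> b [(a, _)] = draw_second \<pi> a"
| "two_threshold_policy M f Astar tie \<pi> \<kappa> b ((a, y) # (a', y') # h') =
     (let h = (a, y) # (a', y') # h'; S = max_cusum M f in
      if S h \<le> ereal \<kappa> then
        (if S (tl h) > ereal \<kappa> then draw_first \<pi>
         else if S (tl (tl h)) > ereal \<kappa> then draw_second \<pi> a
         else draw_next \<pi> (a', a))
      else
        (if explore b h (reset S \<kappa> h (counters S \<kappa> b h)) then pmf_of_set UNIV
         else return_pmf (Astar (tie
           {m. is_arg_max (\<lambda>m. cusum f m (tl h)) (\<lambda>m. m \<in> {1..M}) m}))))"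

text \<open>
  The test consists of its sampling policy and of its stopping rule: it stops at the
  first time at which the latter holds. Only the stopping rule involves \<open>\<gamma>\<close>; the policy is
  defined on all histories, so that its long-run cost makes sense.
\<close>

definition two_threshold_test ::
  "nat \<Rightarrow> (nat \<Rightarrow> 'a::finite \<Rightarrow> 'y \<Rightarrow> real) \<Rightarrow> (nat \<Rightarrow> 'a) \<Rightarrow> (nat set \<Rightarrow> nat) \<Rightarrow> 'a open_loop \<Rightarrow>
    real \<Rightarrow> real \<Rightarrow> real \<Rightarrow> ('a, 'y) policy \<times> (('a, 'y) history \<Rightarrow> bool)" where
  "two_threshold_test M f Astar tie \<pi> \<kappa> \<gamma> b =
     (two_threshold_policy M f Astar tie \<pi> \<kappa> b,
      \<lambda>h. 2 \<le> length h \<and> max_cusum M f h > ereal \<gamma>)"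


section \<open>Well-definedness of the laws\<close>

text \<open>
  \<^const>\<open>no_change_law\<close> has the intended meaning only for measurable policies. Those considered
  here are measurable.
\<close>

lemma Ionescu_Tulcea_step_kernel:
  fixes \<pi> :: "('a::finite, 'y) policy"
  assumes "is_pdf lborel (p0 :: real^'n \<Rightarrow> real)"
    and meas: "\<And>i a. (\<lambda>\<omega>. pmf (\<pi> (hist obs \<omega> i)) a) \<in> borel_measurable (PiM {0..<i} step_space)"
  shows "Ionescu_Tulcea (step_kernel p0 obs \<pi>) step_space"
proof -
  have X: "density lborel p0 \<in> space (prob_algebra borel)"
    using assms(1) by (auto simp: is_pdf_def space_prob_algebra)
  have A: "(\<lambda>\<omega>. measure_pmf (\<pi> (hist obs \<omega> i))) \<in> PiM {0..<i} step_space \<rightarrow>\<^sub>M prob_algebra (count_space UNIV)" for i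
  proof (intro measurable_prob_algebraI measurable_subprob_algebra)
    fix A :: "'a set"
    have "emeasure (measure_pmf (\<pi> (hist obs \<omega> i))) A = ennreal (\<Sum>a\<in>A. pmf (\<pi> (hist obs \<omega> i)) a)" for \<omega>
      by (simp add: measure_pmf.emeasure_eq_measure measure_measure_pmf_finite)
    then show "(\<lambda>\<omega>. emeasure (measure_pmf (\<pi> (hist obs \<omega> i))) A) \<in> borel_measurable (PiM {0..<i} step_space)"
      using meas by simp
  qed (auto intro: measure_pmf.prob_space_axioms measure_pmf.subprob_space_axioms)
  have K: "step_kernel p0 obs \<pi> i \<in> PiM {0..<i} step_space \<rightarrow>\<^sub>M prob_algebra (step_space i)" for i
    unfolding step_kernel_def[abs_def] step_space_def[of i]
    by (intro measurable_pair_prob A measurable_const X)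
  show ?thesis
  proof (rule Ionescu_Tulcea.intro)
    show "step_kernel p0 obs \<pi> i \<in> PiM {0..<i} step_space \<rightarrow>\<^sub>M subprob_algebra (step_space i)" for i
      by (rule measurable_prob_algebraD[OF K])
    show "prob_space (step_kernel p0 obs \<pi> i \<omega>)" if "\<omega> \<in> space (PiM {0..<i} step_space)" for i and \<omega> :: "nat \<Rightarrow> 'a \<times> (real^'n)"
      using measurable_space[OF K that] by (simp add: space_prob_algebra)
  qed
qed

lemma measurable_coordinate:
  "k < i \<Longrightarrow> (\<lambda>\<omega>. \<omega> k) \<in> PiM {0..<i} step_space \<rightarrow>\<^sub>M count_space UNIV \<Otimes>\<^sub>M borel"
  using measurable_component_singleton[of k "{0..<i}" step_space] by (simp add: step_space_def)

lemma measurable_action: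
  "k < i \<Longrightarrow> (\<lambda>\<omega>. fst (\<omega> k)) \<in> PiM {0..<i} step_space \<rightarrow>\<^sub>M count_space UNIV"
  by (rule measurable_compose[OF measurable_coordinate measurable_fst])

lemma measurable_signal:
  "k < i \<Longrightarrow> (\<lambda>\<omega>. snd (\<omega> k)) \<in> PiM {0..<i} step_space \<rightarrow>\<^sub>M borel"
  by (rule measurable_compose[OF measurable_coordinate measurable_snd])

lemma pmf_measurable_action:
  "k < i \<Longrightarrow> (\<lambda>\<omega>. pmf (g (fst (\<omega> k))) a) \<in> borel_measurable (PiM {0..<i} step_space)"
  by (rule measurable_compose[OF measurable_action, where g="\<lambda>x. pmf (g x) a"]) auto

lemma pmf_measurable_action2:
  fixes g :: "'a::finite \<Rightarrow> 'a \<Rightarrow> 'b pmf"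
  assumes "j < i" "k < i" 
  shows "(\<lambda>\<omega>. pmf (g (fst (\<omega> j)) (fst (\<omega> k))) a) \<in> borel_measurable (PiM {0..<i} step_space)"
  by (rule measurable_compose_countable[OF pmf_measurable_action[OF assms(2)] measurable_action[OF assms(1)]])

lemma Ionescu_Tulcea_open_loop:
  fixes \<pi> :: "'a::finite open_loop"
  assumes "is_pdf lborel p0"
  shows "Ionescu_Tulcea (step_kernel p0 obs (open_loop_policy \<pi>)) step_space"
proof (rule Ionescu_Tulcea_step_kernel[OF assms])
  fix i and a :: 'a
  consider "i = 0" | "i = 1" | k where "i = Suc (Suc k)" by (metis One_nat_def not0_implies_Suc)
  then show "(\<lambda>\<omega>. pmf (open_loop_policy \<pi> (hist obs \<omega> i)) a) \<in> borel_measurable (PiM {0..<i} step_space)"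
  proof cases
    case 2
    show ?thesis
      using pmf_measurable_action[of 0 i "draw_second \<pi>" a] by (simp add: 2)
  next
    case 3
    show ?thesis
      using pmf_measurable_action2[of k i "Suc k" "\<lambda>x y. draw_next \<pi> (x, y)" a] by (simp add: 3)
  qed simp
qed

lemma length_hist: "length (hist obs \<omega> i) = i" by (induction i) auto

lemma measurable_cusum:
  fixes f :: "nat \<Rightarrow> 'a::finite \<Rightarrow> 'y \<Rightarrow> real"
  assumes "signal_model M p obs \<nu> f" "m \<le> M" "i \<le> n"
  shows "(\<lambda>\<omega>. cusum f m (hist obs \<omega> i)) \<in> borel_measurable (PiM {0..<n} step_space)"
  using assms(3)
proof (induction i)
  case (Suc i)
  have fm: "(\<lambda>x. f m' a (obs a x)) \<in> borel_measurable borel" if "m' \<le> M" for m' a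
    by (rule measurable_compose[of "obs a" borel "\<nu> a"])
      (use assms(1) that in \<open>simp_all add: signal_model_def is_pdf_def\<close>)
  note [measurable] = fm[OF assms(2)] fm[of 0, simplified]
  have l: "(\<lambda>x. llr f m a (obs a x)) \<in> borel_measurable borel" for a
    unfolding llr_def by measurable
  have i: "i < n" using Suc by simp
  have "(\<lambda>\<omega>. llr f m (fst (\<omega> i)) (obs (fst (\<omega> i)) (snd (\<omega> i)))) \<in> borel_measurable (PiM {0..<n} step_space)"
    by (rule measurable_compose_countable[where f="\<lambda>a \<omega>. llr f m a (obs a (snd (\<omega> i)))",
          OF measurable_compose[OF measurable_signal[OF i] l] measurable_action[OF i]])
  with Suc show ?case by simp
qed simp

lemma measurable_max_cusum:
  fixes f :: "nat \<Rightarrow> 'a::finite \<Rightarrow> 'y \<Rightarrow> real"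
  assumes "signal_model M p obs \<nu> f" "i \<le> n"
  shows "(\<lambda>\<omega>. max_cusum M f (hist obs \<omega> i)) \<in> borel_measurable (PiM {0..<n} step_space)"
proof -
  have "M \<ge> 1" using assms by (auto simp: signal_model_def)
  then have "max_cusum M f h = (SUP m\<in>{1..M}. cusum f m h)" for h
    unfolding max_cusum_def by (intro Max_Sup) auto
  moreover have "(\<lambda>\<omega>. SUP m\<in>{1..M}. cusum f m (hist obs \<omega> i)) \<in> borel_measurable (PiM {0..<n} step_space)"
    by (intro borel_measurable_SUP) (auto intro: measurable_cusum[OF assms(1) _ assms(2)])
  ultimately show ?thesis by simp
qed

lemma measurable_counters:
  fixes f :: "nat \<Rightarrow> 'a::finite \<Rightarrow> 'y \<Rightarrow> real"
  assumes "signal_model M p obs \<nu> f" "i \<le> n"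
  shows "(\<lambda>\<omega>. counters (max_cusum M f) \<kappa> b (hist obs \<omega> i)) \<in> PiM {0..<n} step_space \<rightarrow>\<^sub>M count_space UNIV"
  using assms(2)
proof (induction i)
  case (Suc i)
  let ?P = "PiM {0..<n} step_space" and ?S = "max_cusum M f"
  define c where "c \<omega> = reset ?S \<kappa> (hist obs \<omega> i) (counters ?S \<kappa> b (hist obs \<omega> i))" for \<omega>
  define G where "G = (\<lambda>x. if i = fst x + nat \<lceil>b ^ snd x\<rceil> then (fst x, Suc (snd x)) else x)"
  have S: "(\<lambda>\<omega>. ?S (hist obs \<omega> j)) \<in> borel_measurable ?P" if "j \<le> i" for j
    by (rule measurable_max_cusum[OF assms(1)]) (use that Suc.prems in simp)
  have C: "(\<lambda>\<omega>. counters ?S \<kappa> b (hist obs \<omega> i)) \<in> ?P \<rightarrow>\<^sub>M count_space UNIV"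
    by (rule Suc.IH) (use Suc.prems in simp)
  have tl: "tl (hist obs \<omega> i) = hist obs \<omega> (i - 1)" for \<omega> by (cases i) auto
  have c: "c \<in> ?P \<rightarrow>\<^sub>M count_space UNIV"
    unfolding c_def reset_def tl length_hist
    by (rule measurable_If[OF _ C borel_measurable_le[OF S borel_measurable_const]]) simp_all
  have "(\<lambda>\<omega>. if 2 \<le> i \<and> ?S (hist obs \<omega> i) > ereal \<kappa> then G (c \<omega>) else counters ?S \<kappa> b (hist obs \<omega> i))
      \<in> ?P \<rightarrow>\<^sub>M count_space UNIV"
  proof (cases "2 \<le> i")
    case True
    show ?thesis
      by (simp only: True simp_thms)
        (rule measurable_If[OF measurable_compose[OF c] C borel_measurable_less[OF borel_measurable_const S]], simp_all)
  qed (simp add: C)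
  then show ?case
    by (simp only: hist.simps counters.simps Let_def explore_def length_hist c_def G_def)
qed simp

lemma Ionescu_Tulcea_two_threshold:
  fixes f :: "nat \<Rightarrow> 'a::finite \<Rightarrow> 'y \<Rightarrow> real"
  assumes "signal_model M p obs \<nu> f"
  shows "Ionescu_Tulcea (step_kernel (p 0) obs (two_threshold_policy M f Astar tie \<pi> \<kappa> b)) step_space"
proof (rule Ionescu_Tulcea_step_kernel)
  show "is_pdf lborel (p 0)" using assms by (auto simp: signal_model_def)
next
  fix i and a :: 'a
  consider "i = 0" | "i = 1" | k where "i = Suc (Suc k)" by (metis One_nat_def not0_implies_Suc)
  then show "(\<lambda>\<omega>. pmf (two_threshold_policy M f Astar tie \<pi> \<kappa> b (hist obs \<omega> i)) a) \<in> borel_measurable (PiM {0..<i} step_space)"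
  proof cases
    case 3
    let ?P = "PiM {0..<i} step_space" and ?S = "max_cusum M f"
    have tl1: "tl (hist obs \<omega> i) = hist obs \<omega> (Suc k)" for \<omega> using 3 by simp
    have tl2: "tl (hist obs \<omega> (Suc k)) = hist obs \<omega> k" for \<omega> by simp
    have S[measurable]: "(\<lambda>\<omega>. ?S (hist obs \<omega> i)) \<in> borel_measurable ?P"
      "(\<lambda>\<omega>. ?S (hist obs \<omega> (Suc k))) \<in> borel_measurable ?P"
      "(\<lambda>\<omega>. ?S (hist obs \<omega> k)) \<in> borel_measurable ?P"
      using 3 by (auto intro!: measurable_max_cusum[OF assms] simp del: hist.simps)
    have [measurable]: "(\<lambda>\<omega>. counters ?S \<kappa> b (hist obs \<omega> i)) \<in> ?P \<rightarrow>\<^sub>M count_space UNIV"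
      by (rule measurable_counters[OF assms order_refl])
    have E[measurable]: "Measurable.pred ?P
      (\<lambda>\<omega>. explore b (hist obs \<omega> i) (reset ?S \<kappa> (hist obs \<omega> i) (counters ?S \<kappa> b (hist obs \<omega> i))))"
      unfolding explore_def reset_def length_hist tl1 by measurable
    define B where "B \<omega> = {m. is_arg_max (\<lambda>m. cusum f m (hist obs \<omega> (Suc k))) (\<lambda>m. m \<in> {1..M}) m}" for \<omega>
    have c: "(\<lambda>\<omega>. cusum f m (hist obs \<omega> (Suc k))) \<in> borel_measurable ?P" if "m \<in> {1..M}" for m
      using 3 that by (auto intro!: measurable_cusum[OF assms] simp del: hist.simps)
    have "B \<omega> = D \<longleftrightarrow> D \<subseteq> {1..M} \<and>
       (\<forall>m\<in>{1..M}. m \<in> D \<longleftrightarrow> (\<forall>m'\<in>{1..M}. cusum f m' (hist obs \<omega> (Suc k)) \<le> cusum f m (hist obs \<omega> (Suc k))))"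
      for \<omega> D unfolding B_def is_arg_max_linorder by blast
    moreover have "Measurable.pred ?P (\<lambda>\<omega>. D \<subseteq> {1..M} \<and>
       (\<forall>m\<in>{1..M}. m \<in> D \<longleftrightarrow> (\<forall>m'\<in>{1..M}. cusum f m' (hist obs \<omega> (Suc k)) \<le> cusum f m (hist obs \<omega> (Suc k)))))" for D
    proof (intro pred_intros_logic pred_intros_finite finite_atLeastAtMost)
      fix m m' assume m: "m \<in> {1..M}" "m' \<in> {1..M}"
      show "Measurable.pred ?P (\<lambda>\<omega>. cusum f m' (hist obs \<omega> (Suc k)) \<le> cusum f m (hist obs \<omega> (Suc k)))"
        unfolding pred_def by (rule borel_measurable_le[OF c[OF m(2)] c[OF m(1)]])
    qed simp_all
    ultimately have "Measurable.pred ?P (\<lambda>\<omega>. B \<omega> = D)" for D by simp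
    then have "(\<lambda>\<omega>. \<Sum>D\<in>Pow {1..M}. if B \<omega> = D then pmf (return_pmf (Astar (tie D))) a else 0) \<in> borel_measurable ?P"
      by (intro borel_measurable_sum measurable_If measurable_const) auto
    moreover have "(\<Sum>D\<in>Pow {1..M}. if B \<omega> = D then pmf (return_pmf (Astar (tie D))) a else 0)
      = pmf (return_pmf (Astar (tie (B \<omega>)))) a" for \<omega>
    proof -
      have "B \<omega> \<in> Pow {1..M}" by (auto simp: B_def is_arg_max_def)
      then show ?thesis by (subst sum.delta') auto
    qed
    ultimately have mB: "(\<lambda>\<omega>. pmf (return_pmf (Astar (tie (B \<omega>)))) a) \<in> borel_measurable ?P" by simp
    have m1: "(\<lambda>\<omega>. pmf (draw_second \<pi> (fst (\<omega> (Suc k)))) a) \<in> borel_measurable ?P"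
      and m2: "(\<lambda>\<omega>. pmf (draw_next \<pi> (fst (\<omega> k), fst (\<omega> (Suc k)))) a) \<in> borel_measurable ?P"
      using 3 by (simp_all add: pmf_measurable_action
        pmf_measurable_action2[where g="\<lambda>x y. draw_next \<pi> (x, y)"])
    define g where "g \<omega> =
      (if ?S (hist obs \<omega> i) \<le> ereal \<kappa> then
        (if ?S (hist obs \<omega> (Suc k)) > ereal \<kappa> then pmf (draw_first \<pi>) a
         else if ?S (hist obs \<omega> k) > ereal \<kappa> then pmf (draw_second \<pi> (fst (\<omega> (Suc k)))) a
         else pmf (draw_next \<pi> (fst (\<omega> k), fst (\<omega> (Suc k)))) a)
      else
        (if explore b (hist obs \<omega> i) (reset ?S \<kappa> (hist obs \<omega> i) (counters ?S \<kappa> b (hist obs \<omega> i)))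
         then pmf (pmf_of_set UNIV) a else pmf (return_pmf (Astar (tie (B \<omega>)))) a))" for \<omega>
    have le: "Measurable.pred ?P (\<lambda>\<omega>. ?S (hist obs \<omega> i) \<le> ereal \<kappa>)"
      unfolding pred_def by (rule borel_measurable_le[OF S(1) borel_measurable_const])
    have less: "Measurable.pred ?P (\<lambda>\<omega>. ?S (hist obs \<omega> (Suc k)) > ereal \<kappa>)"
      "Measurable.pred ?P (\<lambda>\<omega>. ?S (hist obs \<omega> k) > ereal \<kappa>)"
      unfolding pred_def
      by (rule borel_measurable_less[OF borel_measurable_const S(2)],
          rule borel_measurable_less[OF borel_measurable_const S(3)])
    have "g \<in> borel_measurable ?P"
      unfolding g_def by (intro measurable_If le[unfolded pred_def] less[unfolded pred_def] E[unfolded pred_def] borel_measurable_const mB m1 m2)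
    moreover have "pmf (two_threshold_policy M f Astar tie \<pi> \<kappa> b (hist obs \<omega> i)) a = g \<omega>" for \<omega>
    proof -
      obtain y y' where h: "hist obs \<omega> i = (fst (\<omega> (Suc k)), y) # (fst (\<omega> k), y') # hist obs \<omega> k"
        and h': "hist obs \<omega> (Suc k) = (fst (\<omega> k), y') # hist obs \<omega> k"
        using 3 by simp
      show ?thesis
        unfolding g_def B_def h h' two_threshold_policy.simps Let_def list.sel
        by (simp only: if_distrib[of "\<lambda>r. pmf r a"] cong: if_cong)
    qed
    ultimately show ?thesis by presburger
  next
    case 2
    show ?thesis
      using pmf_measurable_action[of 0 i "draw_second \<pi>" a] by (simp add: 2)
  qed simp
qed

end

theory Submission
  imports Defs
begin

text \<open>
  Two facts are combined: above \<open>\<kappa>\<close> the policy spends a fraction of the time that is exponentially small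
  in \<open>\<kappa>\<close>, and below \<open>\<kappa>\<close> it costs about as much as \<open>\<pi>\<^sub>d\<close>.

  Time above \<open>\<kappa>\<close>. Without a change, the likelihood ratio of an observation has mean at most \<open>1\<close>, so that
  its square root has mean \<open>1 - d m a\<close>, where the squared Hellinger distance \<open>d m a \<ge> 0\<close> vanishes only if
  the action \<open>a\<close> cannot tell \<open>m\<close> from \<open>0\<close> (lemma \<open>sqrt_likelihood_ratio_facts\<close>). The variable
  \<open>W m = exp (S m / 2)\<close> is multiplied by this root and reflected at \<open>1\<close>: its mean grows by at most \<open>1\<close> per
  step, minus the mean of \<open>d m a * W m\<close> (lemma \<open>drift\<close>). As \<open>W m \<ge> 0\<close>, these decreases add up to at
  most \<open>n + 1\<close> over \<open>n\<close> steps. But the statistic cannot be above \<open>\<kappa>\<close> without a decrease of order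
  \<open>exp (\<kappa> / 2)\<close> at this step or a neighbouring one (lemma \<open>prob_high_le\<close>): either the last action was
  informative about a large statistic, or the leading statistic has not moved, and then the next action is
  preferred against precisely this statistic or uniform, hence informative about it. So the expected
  fraction of time above \<open>\<kappa>\<close> is \<open>O(exp (- \<kappa> / 2))\<close>, uniformly in \<open>b\<close>. Using \<open>exp (S m / 2)\<close> instead of
  \<open>exp (S m)\<close> matters: the latter has no strictly negative drift.

  Cost below \<open>\<kappa>\<close>. The Poisson equation \<open>C = g + h - T h\<close> with a harmonic \<open>g\<close> is solvable for every finite
  chain \<open>T\<close> (lemma \<open>poisson_equation\<close>). For a feasible \<open>\<pi>\<^sub>d\<close>, the function \<open>g\<close> equals the long-run cost of
  \<open>\<pi>\<^sub>d\<close> on all states that \<open>\<pi>\<^sub>d\<close> visits, hence \<open>g \<le> \<alpha>\<close> there (lemma \<open>feasible_poisson\<close>): harmonic functions are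
  constant on a recurrence class, and in the long run the chain is in a single class. While the statistic
  stays below \<open>\<kappa>\<close>, one step therefore costs at most \<open>\<alpha>\<close> in the mean, up to a telescoping difference of \<open>h\<close>.
  Each time above \<open>\<kappa>\<close>, including the restart that it causes, adds a bounded amount (lemma \<open>cost_step\<close>).
  Hence the long-run cost is at most \<open>\<alpha>\<close> plus a multiple of \<open>exp (- \<kappa> / 2)\<close>, which is below \<open>\<theta>\<close> for
  large \<open>\<kappa>\<close>.
\<close>

section \<open>The Poisson equation of a finite Markov chain\<close>

definition step_mean :: "('s::finite \<Rightarrow> 's pmf) \<Rightarrow> ('s \<Rightarrow> real) \<Rightarrow> 's \<Rightarrow> real" where
  "step_mean T f x = (\<Sum>y\<in>UNIV. pmf (T x) y * f y)"

definition harmonic :: "('s::finite \<Rightarrow> 's pmf) \<Rightarrow> ('s \<Rightarrow> real) \<Rightarrow> bool" where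
  "harmonic T g \<longleftrightarrow> (\<forall>x. step_mean T g x = g x)"

lemma sum_pmf_UNIV: "(\<Sum>y\<in>UNIV. pmf (p :: 's::finite pmf) y) = 1"
  by (rule sum_pmf_eq_1) auto

lemma step_mean_add: "step_mean T (\<lambda>x. f x + g x) x = step_mean T f x + step_mean T g x"
  by (simp add: step_mean_def distrib_left sum.distrib)

lemma step_mean_cmult: "step_mean T (\<lambda>x. c * f x) x = c * step_mean T f x"
  by (simp add: step_mean_def sum_distrib_left algebra_simps)

lemma step_mean_const: "step_mean T (\<lambda>x. c) x = c"
  by (simp add: step_mean_def sum_pmf_UNIV flip: sum_distrib_right)

lemma step_mean_diff: "step_mean T (\<lambda>x. f x - g x) x = step_mean T f x - step_mean T g x"
  by (simp add: step_mean_def right_diff_distrib sum_subtractf)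

lemma step_mean_uminus: "step_mean T (\<lambda>x. - f x) x = - step_mean T f x"
  by (simp add: step_mean_def sum_negf)

lemma step_mean_mono: "(\<And>y. f y \<le> g y) \<Longrightarrow> step_mean T f x \<le> step_mean T g x"
  by (auto simp: step_mean_def intro!: sum_mono mult_left_mono)

lemma finite_bound:
  fixes h :: "'s::finite \<Rightarrow> real"
  obtains H where "0 \<le> H" "\<And>x. \<bar>h x\<bar> \<le> H"
proof
  show "0 \<le> (\<Sum>x\<in>UNIV. \<bar>h x\<bar>)" by (simp add: sum_nonneg)
  show "\<bar>h x\<bar> \<le> (\<Sum>x\<in>UNIV. \<bar>h x\<bar>)" for x
    by (rule member_le_sum[where f="\<lambda>x. \<bar>h x\<bar>"]) auto
qed

text \<open>
  Iterating the equation \<open>n\<close> times shows that \<open>n * g + h\<close> is a sum of expected values of \<open>f\<close> plus an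
  expected value of \<open>h\<close>, hence bounded below uniformly in \<open>n\<close>.
\<close>

lemma poisson_nonneg:
  assumes "\<And>x. f x = g x + h x - step_mean T h x" "harmonic T g" "\<And>x. f x \<ge> 0"
  shows "g x \<ge> 0"
proof -
  obtain H where H: "\<And>x. \<bar>h x\<bar> \<le> H" using finite_bound by blast
  have low: "real n * g y + h y \<ge> - H" for n y
  proof (induction n arbitrary: y)
    case 0
    show ?case using H[of y] by simp
  next
    case (Suc n)
    have "- H = step_mean T (\<lambda>_. - H) y" by (simp add: step_mean_const)
    also have "\<dots> \<le> step_mean T (\<lambda>y. real n * g y + h y) y" by (rule step_mean_mono[OF Suc])
    also have "\<dots> = real n * g y + step_mean T h y"
      using assms(2) by (simp add: step_mean_add step_mean_cmult harmonic_def)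
    finally show ?case using assms(1)[of y] assms(3)[of y] by (simp add: algebra_simps)
  qed
  show ?thesis
  proof (rule ccontr)
    assume "\<not> ?thesis"
    then obtain n where "real n * (- g x) > 2 * H" using reals_Archimedean3[of "- g x"] by auto
    with low[of n x] H[of x] show False by auto
  qed
qed

text \<open>
  Both \<open>- g\<close> and \<open>g\<close> belong to solutions of the Poisson equation with right-hand side \<open>0\<close>.
\<close>

lemma harmonic_coboundary_zero:
  assumes "harmonic T g" "\<And>x. g x = h x - step_mean T h x"
  shows "g x = 0"
proof -
  have "- g x \<ge> 0"
  proof (rule poisson_nonneg[where f="\<lambda>_. 0" and g="\<lambda>x. - g x" and h=h and T=T])
    show "harmonic T (\<lambda>x. - g x)" using assms(1) by (simp add: harmonic_def step_mean_uminus)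
    show "0 = - g x + h x - step_mean T h x" for x using assms(2)[of x] by linarith
  qed simp
  moreover have "g x \<ge> 0"
  proof (rule poisson_nonneg[where f="\<lambda>_. 0" and g=g and h="\<lambda>x. - h x" and T=T])
    show "0 = g x + - h x - step_mean T (\<lambda>x. - h x) x" for x
      using assms(2)[of x] by (simp only: step_mean_uminus)
  qed (use assms(1) in simp_all)
  ultimately show ?thesis by simp
qed

text \<open>
  By the previous lemma, the linear map \<open>U = I - T\<close> is injective on its range, hence maps it onto itself by
  dimension. So \<open>U f = U (U v)\<close> for some \<open>v\<close>, and \<open>f - U v\<close> is harmonic.
\<close>

lemma poisson_equation:
  fixes T :: "'s::finite \<Rightarrow> 's pmf"
  obtains g h where "harmonic T g" "\<And>x. f x = g x + h x - step_mean T h x"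
proof -
  define U :: "real^'s \<Rightarrow> real^'s" where "U v = (\<chi> x. v $ x - step_mean T (($) v) x)" for v
  have lin: "linear U"
    by (rule linearI) (auto simp: U_def vec_eq_iff step_mean_def sum.distrib sum_distrib_left algebra_simps)
  have md: "step_mean T (($) (a - b)) x = step_mean T (($) a) x - step_mean T (($) b) x" for a b x
    by (simp add: step_mean_def right_diff_distrib sum_subtractf)
  have inj: "inj_on U (range U)"
  proof (rule inj_onI)
    fix a b assume "a \<in> range U" "b \<in> range U" and eq: "U a = U b"
    then obtain v w where vw: "a = U v" "b = U w" by auto
    have "(a - b) $ x = 0" for x
    proof (rule harmonic_coboundary_zero)
      show "harmonic T (($) (a - b))"
        using arg_cong[OF eq, of "\<lambda>v. v $ _"]
        by (auto simp: harmonic_def U_def md algebra_simps)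
      show "(a - b) $ x = (v - w) $ x - step_mean T (($) (v - w)) x" for x
        by (simp add: vw U_def md)
    qed
    then show "a = b" by (simp add: vec_eq_iff)
  qed
  have sub: "subspace (range U)" using lin by (simp add: linear_subspace_image)
  have "U ` range U = range U"
  proof (rule subspace_dim_equal)
    show "subspace (U ` range U)" by (rule linear_subspace_image[OF lin sub])
    have "dim (U ` range U) = dim (range U)"
      by (rule dim_image_eq[OF lin]) (use inj sub in \<open>simp add: span_eq_iff[THEN iffD2]\<close>)
    then show "dim (range U) \<le> dim (U ` range U)" by simp
  qed (use sub in auto)
  moreover have "U (\<chi> x. f x) \<in> range U" by blast
  ultimately obtain v where v: "U (\<chi> x. f x) = U (U v)" by (metis (no_types, lifting) image_iff)
  show thesis
  proof
    show "harmonic T (\<lambda>x. f x - U v $ x)"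
    proof -
      have vl: "($) (vec_lambda f) = f" for f :: "'s \<Rightarrow> real" by (simp add: fun_eq_iff)
      show ?thesis
        using arg_cong[OF v, of "\<lambda>v. v $ _"]
        by (simp add: harmonic_def step_mean_diff) (simp add: U_def vl step_mean_diff algebra_simps)
    qed
    show "f x = f x - U v $ x + v $ x - step_mean T (($) v) x" for x
      by (simp add: U_def)
  qed
qed

lemma harmonic_zero_reachable:
  assumes "harmonic T g" "\<And>x. g x \<ge> 0" "(\<lambda>x y. y \<in> set_pmf (T x))\<^sup>*\<^sup>* x y" "g x = 0"
  shows "g y = 0"
  using assms(3,4)
proof (induction rule: rtranclp_induct)
  case (step y z)
  have "(\<Sum>w\<in>UNIV. pmf (T y) w * g w) = 0"
    using assms(1) step by (auto simp: harmonic_def step_mean_def)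
  then have "pmf (T y) z * g z = 0"
    by (subst (asm) sum_nonneg_eq_0_iff) (use assms(2) in auto)
  with step show ?case by (auto simp: set_pmf_iff)
qed

text \<open>
  The maximum principle: where \<open>g\<close> attains its maximum over the class, all successors attain it too, and
  every state of the class can be reached from there.
\<close>

lemma harmonic_constant_on_class:
  assumes R: "recurrence_class T R" and g: "harmonic T g" and xy: "x \<in> R" "y \<in> R"
  shows "g x = g y"
proof -
  have trans: "reachable T a c" if "reachable T a b" "reachable T b c" for a b c
    using that unfolding reachable_def by (rule rtranclp_trans)
  obtain \<alpha> where \<alpha>: "\<And>\<beta>. reachable T \<alpha> \<beta> \<Longrightarrow> reachable T \<beta> \<alpha>" "R = {\<beta>. reachable T \<alpha> \<beta>}"
    using R unfolding recurrence_class_def by blast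
  have ne: "R \<noteq> {}" using xy by auto
  define m where "m = Max (g ` R)"
  have fin: "finite (g ` R)" by simp
  have "m \<in> g ` R" using Max_in[OF fin] ne unfolding m_def by simp
  then obtain z where z: "z \<in> R" "g z = m" by auto
  have le: "g w \<le> m" if "w \<in> R" for w using that fin by (auto simp: m_def)
  have step: "g w = m" if "reachable T z w" for w
    using that unfolding reachable_def
  proof (induction rule: rtranclp_induct)
    case (step y w)
    have yR: "y \<in> R" using step(1) z \<alpha> trans[of \<alpha> z y] by (auto simp: reachable_def)
    have suc: "v \<in> R" if "v \<in> set_pmf (T y)" for v
      using yR that trans[of \<alpha> y v] unfolding \<alpha> by (auto simp: reachable_def)
    have "(\<Sum>v\<in>UNIV. pmf (T y) v * (m - g v)) = 0"
    proof -
      have "(\<Sum>v\<in>UNIV. pmf (T y) v * (m - g v)) = step_mean T (\<lambda>v. m - g v) y" by (simp add: step_mean_def)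
      also have "\<dots> = m - step_mean T g y" by (simp add: step_mean_diff step_mean_const)
      finally show ?thesis using g[unfolded harmonic_def, rule_format, of y] step.IH by linarith
    qed
    moreover have "0 \<le> pmf (T y) v * (m - g v)" for v
      using suc[of v] le[of v] by (cases "v \<in> set_pmf (T y)") (auto simp: set_pmf_iff)
    ultimately have "\<forall>v\<in>UNIV. pmf (T y) v * (m - g v) = 0"
      by (intro iffD1[OF sum_nonneg_eq_0_iff]) auto
    then have "pmf (T y) w * (m - g w) = 0" by blast
    with step show ?case by (simp add: set_pmf_iff)
  qed (simp add: z)
  have "g w = m" if "w \<in> R" for w
    using that z \<alpha> trans by (intro step) blast
  with xy show ?thesis by simp
qed

section \<open>Divergence and square roots of likelihood ratios\<close>

lemma KL_self: "prob_space P \<Longrightarrow> KL P P = 0"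
proof -
  assume "prob_space P"
  then interpret prob_space P .
  have "AE x in P. RN_deriv P P x = 1"
    using RN_deriv_unique[of "\<lambda>_. 1" P] by (auto simp: density_1)
  then have ae: "AE x in P. entropy_density (exp 1) P P x = 0"
    by eventually_elim (simp add: entropy_density_def)
  have "integrable P (\<lambda>x. 0::real)" by simp
  then have "integrable P (entropy_density (exp 1) P P)"
    using integrable_cong_AE[of "entropy_density (exp 1) P P" P "\<lambda>_. 0"] ae by simp
  then show ?thesis by (simp add: KL_def absolutely_continuous_def KL_same_eq_0)
qed

text \<open>
  Together with the previous lemma, this shows that an action of maximal divergence distinguishes the two
  distributions as soon as some action does. If the divergence is not defined by an integral, it is
  \<open>\<infinity>\<close>; otherwise Gibbs' inequality applies to the Radon-Nikodym derivative.
\<close>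

lemma KL_pos:
  assumes "prob_space P" "prob_space Q" "sets P = sets Q" "P \<noteq> Q"
  shows "KL P Q > 0"
proof (cases "absolutely_continuous Q P \<and> integrable P (entropy_density (exp 1) Q P)")
  case True
  interpret P: prob_space P by fact
  interpret Q: prob_space Q by fact
  interpret Q: information_space Q "exp 1" by standard auto
  have ac: "absolutely_continuous Q P" and int: "integrable P (entropy_density (exp 1) Q P)"
    using True by auto
  have "finite_measure P" by unfold_locales
  from Q.real_RN_deriv[OF this ac assms(3)] obtain D
    where D: "D \<in> borel_measurable Q" "AE x in Q. RN_deriv Q P x = ennreal (D x)"
      "AE x in P. 0 < D x" "\<And>x. 0 \<le> D x" by auto
  have "P = density Q (RN_deriv Q P)"
    using Q.density_RN_deriv[OF ac assms(3)] by simp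
  also have "\<dots> = density Q D" using D by (auto intro!: density_cong)
  finally have P: "P = density Q D" .
  from absolutely_continuous_AE[OF assms(3) ac D(2)] D ac measurable_entropy_density
  have "integrable P (\<lambda>x. log (exp 1) (D x))"
    by (intro integrable_cong_AE[THEN iffD2, OF _ _ _ int]) (auto simp: P entropy_density_def)
  then have "integrable Q (\<lambda>x. D x * log (exp 1) (D x))"
    using D by (subst integrable_real_density[symmetric]) (auto simp: P[symmetric] comp_def)
  then have "KL_divergence (exp 1) Q (density Q D) > 0"
    using assms D by (intro Q.KL_gt_0) (auto simp: P[symmetric])
  with True show ?thesis by (simp add: KL_def P[symmetric])
qed (auto simp: KL_def)

text \<open>
  Integrate \<open>1 + r = 2 * sqrt r + (1 - sqrt r)\<^sup>2\<close>; in the case of equality the square has integral \<open>0\<close>.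
\<close>

lemma sqrt_moment:
  fixes r :: "'b \<Rightarrow> real"
  assumes "prob_space P" and [measurable]: "r \<in> borel_measurable P"
    and nn: "\<And>x. 0 \<le> r x" and le: "(\<integral>\<^sup>+x. r x \<partial>P) \<le> 1"
  shows "(\<integral>\<^sup>+x. sqrt (r x) \<partial>P) \<le> 1"
    and "(\<integral>\<^sup>+x. sqrt (r x) \<partial>P) = 1 \<Longrightarrow> AE x in P. r x = 1"
proof -
  interpret prob_space P by fact
  have pt: "1 + r x = 2 * sqrt (r x) + (1 - sqrt (r x))^2" for x
    using nn[of x] by (simp add: power2_eq_square algebra_simps)
  have "ennreal (1 + r x) = ennreal 2 * ennreal (sqrt (r x)) + ennreal ((1 - sqrt (r x))^2)" for x
    using nn[of x] by (subst pt) (simp add: ennreal_plus ennreal_mult)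
  then have "(\<integral>\<^sup>+x. ennreal (1 + r x) \<partial>P) = 2 * (\<integral>\<^sup>+x. sqrt (r x) \<partial>P) + (\<integral>\<^sup>+x. ennreal ((1 - sqrt (r x))^2) \<partial>P)"
    by (simp add: nn_integral_add nn_integral_cmult)
  moreover have "(\<integral>\<^sup>+x. ennreal (1 + r x) \<partial>P) = 1 + (\<integral>\<^sup>+x. r x \<partial>P)"
    using nn by (simp add: nn_integral_add emeasure_space_1)
  ultimately have eq: "2 * (\<integral>\<^sup>+x. sqrt (r x) \<partial>P) + (\<integral>\<^sup>+x. ennreal ((1 - sqrt (r x))^2) \<partial>P) \<le> 2"
    using add_left_mono[OF le, of 1] by simp
  then have "2 * (\<integral>\<^sup>+x. sqrt (r x) \<partial>P) \<le> 2 * 1"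
    using order_trans[OF _ eq, of "2 * (\<integral>\<^sup>+x. sqrt (r x) \<partial>P)"] by simp
  then show "(\<integral>\<^sup>+x. sqrt (r x) \<partial>P) \<le> 1"
    by (subst (asm) ennreal_mult_le_mult_iff) auto
  assume "(\<integral>\<^sup>+x. sqrt (r x) \<partial>P) = 1"
  with eq have "2 + (\<integral>\<^sup>+x. ennreal ((1 - sqrt (r x))^2) \<partial>P) \<le> 2 + 0" by simp
  then have "(\<integral>\<^sup>+x. ennreal ((1 - sqrt (r x))^2) \<partial>P) = 0"
    by (subst (asm) ennreal_add_left_cancel_le) auto
  then have "AE x in P. ennreal ((1 - sqrt (r x))^2) = 0"
    by (subst (asm) nn_integral_0_iff_AE) auto
  then show "AE x in P. r x = 1" by eventually_elim (simp add: ennreal_eq_0_iff)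
qed

text \<open>
  The ratio being \<open>1\<close> where \<open>g > 0\<close>, the first density dominates the second one; as both have mass \<open>1\<close>,
  they agree.
\<close>

lemma density_eq_of_AE_ratio:
  fixes f g :: "'b \<Rightarrow> real"
  assumes f: "is_pdf N f" and g: "is_pdf N g" and ae: "AE x in density N g. f x / g x = 1"
  shows "density N f = density N g"
proof -
  interpret F: prob_space "density N f" using f by (simp add: is_pdf_def)
  interpret G: prob_space "density N g" using g by (simp add: is_pdf_def)
  have [measurable]: "f \<in> borel_measurable N" "g \<in> borel_measurable N"
    using f g by (auto simp: is_pdf_def)
  have ae': "AE x in N. g x \<le> f x"
  proof -
    have "AE x in N. 0 < ennreal (g x) \<longrightarrow> f x / g x = 1"
      using ae by (subst (asm) AE_density) auto
    then show ?thesis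
    proof eventually_elim
      case (elim x)
      then show ?case using f by (cases "0 < g x") (auto simp: is_pdf_def not_less intro: order_trans)
    qed
  qed
  have le: "emeasure (density N g) A \<le> emeasure (density N f) A" if "A \<in> sets N" for A
    using that ae' by (auto simp: emeasure_density intro!: nn_integral_mono_AE mult_right_mono ennreal_leI elim!: eventually_mono)
  show ?thesis
  proof (rule measure_eqI)
    fix A assume A: "A \<in> sets (density N f)"
    have "G.prob A \<le> F.prob A" "G.prob (space N - A) \<le> F.prob (space N - A)"
      using le[of A] le[of "space N - A"] A
      by (auto simp: F.emeasure_eq_measure G.emeasure_eq_measure)
    moreover have "G.prob (space N - A) = 1 - G.prob A" "F.prob (space N - A) = 1 - F.prob A"
      using A F.prob_compl[of A] G.prob_compl[of A] by auto
    ultimately show "emeasure (density N f) A = emeasure (density N g) A"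
      by (simp add: F.emeasure_eq_measure G.emeasure_eq_measure)
  qed simp
qed

section \<open>Processes controlled by a policy\<close>

text \<open>
  Paths of \<open>(A\<^sub>t, X\<^sub>t)\<close> when there is no change and the actions are chosen by the policy \<open>\<pi>\<close>. The type of
  histories carries no \<open>\<sigma>\<close>-algebra, since the observation spaces differ from action to action; what depends
  on the first \<open>n\<close> observations is therefore made measurable on the space of paths (\<open>adapted\<close>).
\<close>

locale controlled_process =
  fixes p0 :: "real^'n \<Rightarrow> real" and obs :: "'a::finite \<Rightarrow> real^'n \<Rightarrow> 'y" and \<pi> :: "('a, 'y) policy"
  assumes pdf: "is_pdf lborel p0"
    and ionescu_tulcea: "Ionescu_Tulcea (step_kernel p0 obs \<pi>) step_space"
begin

sublocale IT: Ionescu_Tulcea "step_kernel p0 obs \<pi>" step_space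
  by (rule ionescu_tulcea)

abbreviation law :: "(nat \<Rightarrow> 'a \<times> (real^'n)) measure" where
  "law \<equiv> no_change_law p0 obs \<pi>"

abbreviation signal :: "(real^'n) measure" where
  "signal \<equiv> density lborel p0"

abbreviation H :: "nat \<Rightarrow> (nat \<Rightarrow> 'a \<times> (real^'n)) \<Rightarrow> ('a, 'y) history" where
  "H n \<omega> \<equiv> hist obs \<omega> n"

definition adapted :: "nat \<Rightarrow> 'b measure \<Rightarrow> (('a, 'y) history \<Rightarrow> 'b) \<Rightarrow> bool" where
  "adapted n N G \<longleftrightarrow> (\<lambda>\<omega>. G (H n \<omega>)) \<in> PiM {0..<n} step_space \<rightarrow>\<^sub>M N"

lemma prob_space_signal: "prob_space signal"
  using pdf by (simp add: is_pdf_def)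

lemma sets_law [measurable_cong]: "sets law = sets (PiM UNIV step_space)"
  by (simp add: no_change_law_def)

lemma hist_restrict: "k \<le> n \<Longrightarrow> hist obs (restrict \<omega> {0..<n}) k = hist obs \<omega> k"
  by (induction k) auto

lemma hist_upd: "k \<le> n \<Longrightarrow> hist obs (fun_upd \<omega> n x) k = hist obs \<omega> k"
  by (induction k) auto

lemma measurable_restrict_law: "(\<lambda>\<omega>. restrict \<omega> {0..<n}) \<in> law \<rightarrow>\<^sub>M PiM {0..<n} step_space"
  unfolding measurable_cong_sets[OF sets_law refl] by (rule measurable_restrict_subset) simp

text \<open>
  The finite-dimensional distributions of the law are the iterated kernels of the Ionescu-Tulcea
  construction, in which the last step can be integrated out.
\<close>

lemma distr_law: "distr law (PiM {0..<n} step_space) (\<lambda>\<omega>. restrict \<omega> {0..<n}) = IT.C 0 n (\<lambda>_. undefined)"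
proof (rule measure_eqI)
  fix X assume X: "X \<in> sets (distr law (PiM {0..<n} step_space) (\<lambda>\<omega>. restrict \<omega> {0..<n}))"
  then have X': "X \<in> sets (PiM {0..<n} step_space)" by simp
  have "emeasure (distr law (PiM {0..<n} step_space) (\<lambda>\<omega>. restrict \<omega> {0..<n})) X
      = emeasure law (IT.PF.emb UNIV {0..<n} X)"
    by (rule emeasure_distr_restrict[OF subset_UNIV sets_law X'])
  also have "\<dots> = emeasure (IT.CI {0..<n}) X"
    unfolding no_change_law_def by (rule IT.lim[OF _ X']) simp
  also have "\<dots> = IT.C 0 n (\<lambda>_. undefined) (IT.PF.emb {0..<n} {0..<n} X)"
    by (rule IT.emeasure_CI[OF subset_refl X'])
  also have "IT.PF.emb {0..<n} {0..<n} X = X"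
    using sets.sets_into_space[OF X'] by (auto simp: prod_emb_def space_PiM)
  finally show "emeasure (distr law (PiM {0..<n} step_space) (\<lambda>\<omega>. restrict \<omega> {0..<n})) X
      = emeasure (IT.C 0 n (\<lambda>_. undefined)) X" .
qed (simp add: IT.sets_C)

lemma prob_space_law: "prob_space law"
proof (rule prob_space_distrD[OF measurable_restrict_law[of 0]])
  show "prob_space (distr law (PiM {0..<0} step_space) (\<lambda>\<omega>. restrict \<omega> {0..<0}))"
    unfolding distr_law by (rule IT.prob_space_C) simp
qed

lemma nn_integral_law:
  assumes "F \<in> borel_measurable (PiM {0..<n} step_space)"
  shows "(\<integral>\<^sup>+\<omega>. F (restrict \<omega> {0..<n}) \<partial>law) = (\<integral>\<^sup>+\<omega>. F \<omega> \<partial>IT.C 0 n (\<lambda>_. undefined))"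
  unfolding distr_law[symmetric]
  by (rule nn_integral_distr[symmetric, OF measurable_restrict_law]) (use assms in simp)

lemma adapted_law: "adapted k N G \<Longrightarrow> (\<lambda>\<omega>. G (H k \<omega>)) \<in> law \<rightarrow>\<^sub>M N"
  using measurable_compose[OF measurable_restrict_law[of k], of "\<lambda>\<omega>. G (H k \<omega>)" N]
  by (simp add: adapted_def hist_restrict)

lemma adapted_pmf: "adapted n borel (\<lambda>h. pmf (\<pi> h) a)"
proof -
  have "{a} \<times> UNIV \<in> sets (count_space UNIV \<Otimes>\<^sub>M (borel :: (real^'n) measure))" by (intro pair_measureI) auto
  then have "(\<lambda>\<omega>. emeasure (step_kernel p0 obs \<pi> n \<omega>) ({a} \<times> UNIV)) \<in> borel_measurable (PiM {0..<n} step_space)"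
    by (intro measurable_emeasure_kernel[OF IT.P]) (simp add: step_space_def)
  moreover have "emeasure (step_kernel p0 obs \<pi> n \<omega>) ({a} \<times> UNIV) = ennreal (pmf (\<pi> (H n \<omega>)) a)" for \<omega>
  proof -
    interpret X: prob_space signal by (rule prob_space_signal)
    show ?thesis
      using X.emeasure_space_1
      unfolding step_kernel_def by (subst X.emeasure_pair_measure_Times) (auto simp: emeasure_pmf_single)
  qed
  ultimately have "(\<lambda>\<omega>. enn2real (ennreal (pmf (\<pi> (H n \<omega>)) a))) \<in> borel_measurable (PiM {0..<n} step_space)"
    by (intro borel_measurable_enn2real) simp
  then show ?thesis by (simp add: adapted_def)
qed

lemma measurable_action_obs:
  assumes "\<And>a. (\<lambda>x. \<phi> a (obs a x)) \<in> borel \<rightarrow>\<^sub>M N"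
  shows "(\<lambda>z. \<phi> (fst z) (obs (fst z) (snd z))) \<in> count_space UNIV \<Otimes>\<^sub>M borel \<rightarrow>\<^sub>M N"
  by (rule measurable_pair_measure_countable1) (use assms in auto)

lemma adapted_Suc:
  assumes "adapted n N G" shows "adapted (Suc n) N (\<lambda>h. G (tl h))"
proof -
  have "(\<lambda>\<omega>. restrict \<omega> {0..<n}) \<in> PiM {0..<Suc n} step_space \<rightarrow>\<^sub>M PiM {0..<n} step_space"
    by (rule measurable_restrict_subset) auto
  from measurable_compose[OF this assms[unfolded adapted_def]]
  show ?thesis by (simp add: adapted_def hist_restrict)
qed

lemma adapted_obs:
  assumes "\<And>a. (\<lambda>x. \<phi> a (obs a x)) \<in> borel \<rightarrow>\<^sub>M N"
  shows "adapted (Suc n) N (\<lambda>h. \<phi> (fst (hd h)) (snd (hd h)))"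
  unfolding adapted_def hist.simps list.sel fst_conv snd_conv
  by (rule measurable_compose[OF measurable_coordinate measurable_action_obs[OF assms]]) simp

text \<open>
  The Markov property: given the first \<open>n\<close> observations, the next action is drawn by the policy and the next
  signal is independent of everything before.
\<close>

lemma one_step:
  assumes G: "adapted n borel G" and \<phi>: "\<And>a. (\<lambda>x. \<phi> a (obs a x)) \<in> borel_measurable borel"
  shows "(\<integral>\<^sup>+\<omega>. G (H n \<omega>) * \<phi> (fst (\<omega> n)) (obs (fst (\<omega> n)) (snd (\<omega> n))) \<partial>law)
    = (\<integral>\<^sup>+\<omega>. G (H n \<omega>) * (\<Sum>a\<in>UNIV. ennreal (pmf (\<pi> (H n \<omega>)) a) * (\<integral>\<^sup>+x. \<phi> a (obs a x) \<partial>signal)) \<partial>law)"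
proof -
  interpret X: prob_space signal by (rule prob_space_signal)
  define \<psi> where "\<psi> z = \<phi> (fst z) (obs (fst z) (snd z))" for z
  have \<psi>[measurable]: "\<psi> \<in> borel_measurable (count_space UNIV \<Otimes>\<^sub>M borel)"
    unfolding \<psi>_def by (rule measurable_action_obs[OF \<phi>])
  have Gn: "(\<lambda>\<omega>. G (H n \<omega>)) \<in> borel_measurable (PiM {0..<n} step_space)"
    using G by (simp add: adapted_def)
  define F where "F \<omega> = G (H n \<omega>) * \<psi> (\<omega> n)" for \<omega>
  have F: "F \<in> borel_measurable (PiM {0..<Suc n} step_space)"
    using borel_measurable_times_ennreal[OF adapted_Suc[OF G, unfolded adapted_def]
        adapted_obs[OF \<phi>, of n, unfolded adapted_def]]
    by (simp add: F_def[abs_def] \<psi>_def)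
  define R where "R \<omega> = G (H n \<omega>) * (\<Sum>a\<in>UNIV. ennreal (pmf (\<pi> (H n \<omega>)) a) * (\<integral>\<^sup>+x. \<phi> a (obs a x) \<partial>signal))" for \<omega>
  have R: "R \<in> borel_measurable (PiM {0..<n} step_space)"
    unfolding R_def
    by (rule borel_measurable_times_ennreal[OF Gn], rule borel_measurable_sum,
        rule borel_measurable_times_ennreal[OF _ borel_measurable_const],
        rule measurable_compose[OF adapted_pmf[of n, unfolded adapted_def] measurable_ennreal])
  have k: "(\<integral>\<^sup>+z. \<psi> z \<partial>step_kernel p0 obs \<pi> n \<omega>)
     = (\<Sum>a\<in>UNIV. ennreal (pmf (\<pi> (H n \<omega>)) a) * (\<integral>\<^sup>+x. \<phi> a (obs a x) \<partial>signal))" for \<omega>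
  proof -
    have "\<psi> \<in> borel_measurable (measure_pmf (\<pi> (H n \<omega>)) \<Otimes>\<^sub>M signal)"
    proof -
      have "sets (measure_pmf (\<pi> (H n \<omega>)) \<Otimes>\<^sub>M signal) = sets (count_space UNIV \<Otimes>\<^sub>M borel)"
        by (intro sets_pair_measure_cong) auto
      from measurable_cong_sets[OF this refl] \<psi> show ?thesis by blast
    qed
    then have "(\<integral>\<^sup>+z. \<psi> z \<partial>step_kernel p0 obs \<pi> n \<omega>)
       = (\<integral>\<^sup>+a. (\<integral>\<^sup>+x. \<psi> (a, x) \<partial>signal) \<partial>measure_pmf (\<pi> (H n \<omega>)))"
      unfolding step_kernel_def by (rule X.nn_integral_fst[symmetric])
    then show ?thesis
      by (simp add: \<psi>_def nn_integral_measure_pmf nn_integral_count_space_finite)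
  qed
  have "(\<integral>\<^sup>+\<omega>. G (H n \<omega>) * \<psi> (\<omega> n) \<partial>law) = (\<integral>\<^sup>+\<omega>. F (restrict \<omega> {0..<Suc n}) \<partial>law)"
    by (intro nn_integral_cong) (simp add: F_def hist_restrict)
  also have "\<dots> = (\<integral>\<^sup>+\<omega>. F \<omega> \<partial>IT.C 0 (Suc n) (\<lambda>_. undefined))" by (rule nn_integral_law[OF F])
  also have "\<dots> = (\<integral>\<^sup>+\<omega>. (\<integral>\<^sup>+\<omega>'. F \<omega>' \<partial>IT.eP n \<omega>) \<partial>IT.C 0 n (\<lambda>_. undefined))"
  proof -
    have "IT.eP n \<in> IT.C 0 n (\<lambda>_. undefined) \<rightarrow>\<^sub>M subprob_algebra (PiM {0..<Suc n} step_space)"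
      unfolding measurable_cong_sets[OF IT.sets_C[of "\<lambda>_. undefined" 0 n, simplified] refl]
      by (rule IT.measurable_eP)
    then show ?thesis by (simp add: nn_integral_bind[OF F])
  qed
  also have "\<dots> = (\<integral>\<^sup>+\<omega>. R \<omega> \<partial>IT.C 0 n (\<lambda>_. undefined))"
  proof (rule nn_integral_cong)
    fix \<omega> assume "\<omega> \<in> space (IT.C 0 n (\<lambda>_. undefined))"
    then have \<omega>: "\<omega> \<in> space (PiM {0..<n} step_space)" by (simp add: IT.space_C)
    have s: "sets (step_kernel p0 obs \<pi> n \<omega>) = sets (count_space UNIV \<Otimes>\<^sub>M borel)"
      unfolding step_kernel_def by (intro sets_pair_measure_cong) auto
    have "(\<integral>\<^sup>+\<omega>'. F \<omega>' \<partial>IT.eP n \<omega>) = (\<integral>\<^sup>+x. G (H n \<omega>) * \<psi> x \<partial>step_kernel p0 obs \<pi> n \<omega>)"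
      by (subst IT.nn_integral_eP[OF \<omega> F]) (simp add: F_def hist_upd)
    also have "\<dots> = R \<omega>"
      using \<psi> unfolding R_def k[symmetric]
      by (intro nn_integral_cmult) (simp add: measurable_cong_sets[OF s refl])
    finally show "(\<integral>\<^sup>+\<omega>'. F \<omega>' \<partial>IT.eP n \<omega>) = R \<omega>" .
  qed
  also have "\<dots> = (\<integral>\<^sup>+\<omega>. R (restrict \<omega> {0..<n}) \<partial>law)" by (rule nn_integral_law[OF R, symmetric])
  also have "\<dots> = (\<integral>\<^sup>+\<omega>. R \<omega> \<partial>law)"
    by (intro nn_integral_cong) (simp add: R_def hist_restrict)
  finally show ?thesis by (simp add: \<psi>_def R_def)
qed

lemma adapted_hd: "adapted (Suc n) (count_space UNIV) (\<lambda>h. fst (hd h))"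
  by (rule adapted_obs[where \<phi>="\<lambda>a y. a"]) simp

lemma measurable_act: "(\<lambda>\<omega>. fst (\<omega> n)) \<in> law \<rightarrow>\<^sub>M count_space UNIV"
  using adapted_law[OF adapted_hd[of n]] by simp

lemma measurable_act_real: "(\<lambda>\<omega>. u (fst (\<omega> n))) \<in> borel_measurable law" for u :: "'a \<Rightarrow> real"
  by (rule measurable_compose[OF measurable_act]) simp

lemma nn_one_step_action:
  assumes G: "adapted n borel G"
  shows "(\<integral>\<^sup>+\<omega>. G (H n \<omega>) * of_bool (fst (\<omega> n) = a) \<partial>law) = (\<integral>\<^sup>+\<omega>. G (H n \<omega>) * ennreal (pmf (\<pi> (H n \<omega>)) a) \<partial>law)"
proof -
  interpret X: prob_space signal by (rule prob_space_signal)
  have "(\<Sum>a'\<in>UNIV. ennreal (pmf (\<pi> h) a') * (\<integral>\<^sup>+x. of_bool (a' = a) \<partial>signal)) = ennreal (pmf (\<pi> h) a)" for h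
  proof -
    have "(\<integral>\<^sup>+x. of_bool (a' = a) \<partial>signal) = (if a' = a then 1 else 0)" for a'
      using X.emeasure_space_1 by simp
    then have "(\<Sum>a'\<in>UNIV. ennreal (pmf (\<pi> h) a') * (\<integral>\<^sup>+x. of_bool (a' = a) \<partial>signal))
        = (\<Sum>a'\<in>UNIV. if a' = a then ennreal (pmf (\<pi> h) a) else 0)"
      by (intro sum.cong) auto
    then show ?thesis by simp
  qed
  then show ?thesis
    using one_step[OF G, of "\<lambda>a' y. of_bool (a' = a)"] by simp
qed

lemma AE_action_in_support: "AE \<omega> in law. \<forall>n. fst (\<omega> n) \<in> set_pmf (\<pi> (H n \<omega>))"
proof -
  have "AE \<omega> in law. fst (\<omega> n) = a \<longrightarrow> pmf (\<pi> (H n \<omega>)) a \<noteq> 0" for n a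
  proof -
    define G where "G h = (if pmf (\<pi> h) a = 0 then 1 else 0 :: ennreal)" for h
    have G: "adapted n borel G"
      unfolding adapted_def G_def
      by (rule measurable_compose[OF adapted_pmf[unfolded adapted_def], of "\<lambda>x. if x = 0 then 1 else 0"]) simp
    have "(\<integral>\<^sup>+\<omega>. G (H n \<omega>) * of_bool (fst (\<omega> n) = a) \<partial>law) = (\<integral>\<^sup>+\<omega>. 0 \<partial>law)"
      unfolding nn_one_step_action[OF G] by (intro nn_integral_cong) (simp add: G_def)
    then have z: "(\<integral>\<^sup>+\<omega>. G (H n \<omega>) * of_bool (fst (\<omega> n) = a) \<partial>law) = 0" by simp
    have "(\<lambda>\<omega>. G (H n \<omega>) * of_bool (fst (\<omega> n) = a)) \<in> borel_measurable law"
      by (intro borel_measurable_times_ennreal adapted_law[OF G] measurable_compose[OF measurable_act]) simp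
    from nn_integral_0_iff_AE[OF this] z
    have "AE \<omega> in law. G (H n \<omega>) * of_bool (fst (\<omega> n) = a) = 0" by simp
    then show ?thesis by eventually_elim (auto simp: G_def)
  qed
  then have "AE \<omega> in law. \<forall>n. \<forall>a. fst (\<omega> n) = a \<longrightarrow> pmf (\<pi> (H n \<omega>)) a \<noteq> 0"
    by (intro AE_all_countable[THEN iffD2] allI)
  then show ?thesis by eventually_elim (auto simp: set_pmf_iff)
qed

lemma integrable_bounded_law:
  fixes F :: "(nat \<Rightarrow> 'a \<times> (real^'n)) \<Rightarrow> real"
  assumes "F \<in> borel_measurable law" "\<And>\<omega>. \<bar>F \<omega>\<bar> \<le> K"
  shows "integrable law F"
proof -
  interpret prob_space law by (rule prob_space_law)
  show ?thesis by (rule integrable_const_bound[of _ K]) (use assms in auto)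
qed

lemma abs_mult_pmf_le: "\<bar>x\<bar> \<le> K \<Longrightarrow> \<bar>x * pmf p a\<bar> \<le> K"
  using mult_left_le[of "pmf p a" "\<bar>x\<bar>"] pmf_le_1[of p a] by (simp add: abs_mult)

text \<open>
  The bounded case follows from the nonnegative one by adding a constant.
\<close>

lemma expectation_one_step_aux:
  fixes g :: "('a, 'y) history \<Rightarrow> real"
  assumes g: "adapted n borel g" and K: "\<And>h. \<bar>g h\<bar> \<le> K"
  shows "(\<integral>\<omega>. g (H n \<omega>) * of_bool (fst (\<omega> n) = a) \<partial>law) = (\<integral>\<omega>. g (H n \<omega>) * pmf (\<pi> (H n \<omega>)) a \<partial>law)"
proof -
  have m: "(\<lambda>\<omega>. of_bool (fst (\<omega> n) = a) :: real) \<in> borel_measurable law"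
    by (rule measurable_act_real)
  have p: "(\<lambda>\<omega>. pmf (\<pi> (H n \<omega>)) a) \<in> borel_measurable law"
    by (rule adapted_law[OF adapted_pmf])
  have nonneg: "(\<integral>\<omega>. g (H n \<omega>) * of_bool (fst (\<omega> n) = a) \<partial>law) = (\<integral>\<omega>. g (H n \<omega>) * pmf (\<pi> (H n \<omega>)) a \<partial>law)"
    if g: "adapted n borel g" and nn: "\<And>h. g h \<ge> 0" for g :: "('a, 'y) history \<Rightarrow> real"
  proof -
    have G: "adapted n borel (\<lambda>h. ennreal (g h))"
      using g unfolding adapted_def by (rule measurable_compose) simp
    have "(\<integral>\<omega>. g (H n \<omega>) * of_bool (fst (\<omega> n) = a) \<partial>law)
        = enn2real (\<integral>\<^sup>+\<omega>. ennreal (g (H n \<omega>) * of_bool (fst (\<omega> n) = a)) \<partial>law)"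
      by (intro integral_eq_nn_integral borel_measurable_times m adapted_law[OF g]) (simp add: nn)
    also have "(\<integral>\<^sup>+\<omega>. ennreal (g (H n \<omega>) * of_bool (fst (\<omega> n) = a)) \<partial>law)
        = (\<integral>\<^sup>+\<omega>. ennreal (g (H n \<omega>)) * of_bool (fst (\<omega> n) = a) \<partial>law)"
      by (intro nn_integral_cong) (simp add: ennreal_mult nn)
    also have "\<dots> = (\<integral>\<^sup>+\<omega>. ennreal (g (H n \<omega>)) * ennreal (pmf (\<pi> (H n \<omega>)) a) \<partial>law)"
      by (rule nn_one_step_action[OF G])
    also have "\<dots> = (\<integral>\<^sup>+\<omega>. ennreal (g (H n \<omega>) * pmf (\<pi> (H n \<omega>)) a) \<partial>law)"
      by (intro nn_integral_cong) (simp add: ennreal_mult nn)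
    also have "enn2real \<dots> = (\<integral>\<omega>. g (H n \<omega>) * pmf (\<pi> (H n \<omega>)) a \<partial>law)"
      by (intro integral_eq_nn_integral[symmetric] borel_measurable_times p adapted_law[OF g]) (simp add: nn)
    finally show ?thesis .
  qed
  have K0: "K \<ge> 0" using K[of undefined] by linarith
  have g': "adapted n borel (\<lambda>h. g h + K)"
    using g unfolding adapted_def by (intro borel_measurable_add) auto
  have c': "adapted n borel (\<lambda>h. K)" unfolding adapted_def by simp
  have i1: "integrable law (\<lambda>\<omega>. g (H n \<omega>) * of_bool (fst (\<omega> n) = a))"
  proof (rule integrable_bounded_law[of _ K])
    show "(\<lambda>\<omega>. g (H n \<omega>) * of_bool (fst (\<omega> n) = a)) \<in> borel_measurable law"
      by (intro borel_measurable_times adapted_law[OF g] m)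
    show "\<bar>g (H n \<omega>) * of_bool (fst (\<omega> n) = a)\<bar> \<le> K" for \<omega>
      using K[of "H n \<omega>"] K0 by auto
  qed
  have i2: "integrable law (\<lambda>\<omega>. K * of_bool (fst (\<omega> n) = a))"
    by (rule integrable_bounded_law[of _ K]) (use m K0 in \<open>auto\<close>)
  have j1: "integrable law (\<lambda>\<omega>. g (H n \<omega>) * pmf (\<pi> (H n \<omega>)) a)"
    by (intro integrable_bounded_law[of _ K] abs_mult_pmf_le K borel_measurable_times p adapted_law[OF g])
  have j2: "integrable law (\<lambda>\<omega>. K * pmf (\<pi> (H n \<omega>)) a)"
    by (intro integrable_bounded_law[of _ K] abs_mult_pmf_le borel_measurable_times p) (use K0 in auto)
  have "(\<integral>\<omega>. (g (H n \<omega>) + K) * of_bool (fst (\<omega> n) = a) \<partial>law) = (\<integral>\<omega>. (g (H n \<omega>) + K) * pmf (\<pi> (H n \<omega>)) a \<partial>law)"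
  proof (rule nonneg[OF g'])
    show "0 \<le> g h + K" for h using K[of h] by linarith
  qed
  moreover have "(\<integral>\<omega>. K * of_bool (fst (\<omega> n) = a) \<partial>law) = (\<integral>\<omega>. K * pmf (\<pi> (H n \<omega>)) a \<partial>law)"
    by (rule nonneg[OF c' K0])
  ultimately show ?thesis
    unfolding distrib_right Bochner_Integration.integral_add[OF i1 i2] Bochner_Integration.integral_add[OF j1 j2]
    by linarith
qed

lemma expectation_one_step:
  fixes u :: "('a, 'y) history \<Rightarrow> 'a \<Rightarrow> real"
  assumes u: "\<And>a. adapted n borel (\<lambda>h. u h a)" and K: "\<And>h a. \<bar>u h a\<bar> \<le> K"
  shows "(\<integral>\<omega>. u (H n \<omega>) (fst (\<omega> n)) \<partial>law) = (\<integral>\<omega>. (\<Sum>a\<in>UNIV. pmf (\<pi> (H n \<omega>)) a * u (H n \<omega>) a) \<partial>law)"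
proof -
  have K0: "K \<ge> 0" using K[of undefined undefined] by linarith
  have i: "integrable law (\<lambda>\<omega>. u (H n \<omega>) a * of_bool (fst (\<omega> n) = a))" for a
  proof (rule integrable_bounded_law[of _ K])
    show "(\<lambda>\<omega>. u (H n \<omega>) a * of_bool (fst (\<omega> n) = a)) \<in> borel_measurable law"
      by (intro borel_measurable_times adapted_law[OF u] measurable_act_real[of "\<lambda>b. of_bool (b = a)"])
    show "\<bar>u (H n \<omega>) a * of_bool (fst (\<omega> n) = a)\<bar> \<le> K" for \<omega>
      using K[of "H n \<omega>" a] K0 by auto
  qed
  have j: "integrable law (\<lambda>\<omega>. u (H n \<omega>) a * pmf (\<pi> (H n \<omega>)) a)" for a
    by (intro integrable_bounded_law[of _ K] abs_mult_pmf_le K borel_measurable_times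
        adapted_law[OF adapted_pmf] adapted_law[OF u])
  have "(\<integral>\<omega>. u (H n \<omega>) (fst (\<omega> n)) \<partial>law) = (\<integral>\<omega>. (\<Sum>a\<in>UNIV. u (H n \<omega>) a * of_bool (fst (\<omega> n) = a)) \<partial>law)"
  proof -
    have "(\<Sum>a\<in>UNIV. u h a * of_bool (b = a)) = (\<Sum>a\<in>UNIV. if b = a then u h a else 0)" for h b
      by (intro sum.cong) auto
    then show ?thesis by simp
  qed
  also have "\<dots> = (\<Sum>a\<in>UNIV. \<integral>\<omega>. u (H n \<omega>) a * of_bool (fst (\<omega> n) = a) \<partial>law)"
    by (rule Bochner_Integration.integral_sum) (rule i)
  also have "\<dots> = (\<Sum>a\<in>UNIV. \<integral>\<omega>. u (H n \<omega>) a * pmf (\<pi> (H n \<omega>)) a \<partial>law)"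
    by (intro sum.cong refl expectation_one_step_aux[OF u K])
  also have "\<dots> = (\<integral>\<omega>. (\<Sum>a\<in>UNIV. u (H n \<omega>) a * pmf (\<pi> (H n \<omega>)) a) \<partial>law)"
    by (rule Bochner_Integration.integral_sum[symmetric]) (rule j)
  finally show ?thesis by (simp add: mult.commute)
qed

lemma AE_observation:
  assumes meas: "\<And>a. Measurable.pred borel (\<lambda>x. Q a (obs a x))"
    and ae: "\<And>a. AE x in signal. Q a (obs a x)"
  shows "AE \<omega> in law. \<forall>n. Q (fst (\<omega> n)) (obs (fst (\<omega> n)) (snd (\<omega> n)))"
proof -
  define \<phi> where "\<phi> a y = (if Q a y then 0 else 1 :: ennreal)" for a y
  have \<phi>: "(\<lambda>x. \<phi> a (obs a x)) \<in> borel_measurable borel" for a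
    unfolding \<phi>_def using meas[of a] by measurable
  have z: "(\<integral>\<^sup>+x. \<phi> a (obs a x) \<partial>signal) = 0" for a
    using ae[of a] \<phi>[of a] by (subst nn_integral_0_iff_AE) (auto simp: \<phi>_def elim!: eventually_mono)
  have "AE \<omega> in law. Q (fst (\<omega> n)) (obs (fst (\<omega> n)) (snd (\<omega> n)))" for n
  proof -
    have "(\<integral>\<^sup>+\<omega>. 1 * \<phi> (fst (\<omega> n)) (obs (fst (\<omega> n)) (snd (\<omega> n))) \<partial>law) = 0"
      by (subst one_step[where G="\<lambda>_. 1"]) (use \<phi> z in \<open>simp_all add: adapted_def\<close>)
    moreover have "(\<lambda>\<omega>. 1 * \<phi> (fst (\<omega> n)) (obs (fst (\<omega> n)) (snd (\<omega> n)))) \<in> borel_measurable law"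
      using adapted_law[OF adapted_obs[where n=n and \<phi>=\<phi>, OF \<phi>]] by simp
    ultimately have "AE \<omega> in law. 1 * \<phi> (fst (\<omega> n)) (obs (fst (\<omega> n)) (snd (\<omega> n))) = 0"
      by (subst (asm) nn_integral_0_iff_AE)
    then show ?thesis by eventually_elim (auto simp: \<phi>_def split: if_splits)
  qed
  then show ?thesis by (intro AE_all_countable[THEN iffD2] allI)
qed

end

section \<open>Drift of the CuSum statistics without a change\<close>

definition likelihood_ratio :: "(nat \<Rightarrow> 'a \<Rightarrow> 'y \<Rightarrow> real) \<Rightarrow> nat \<Rightarrow> 'a \<Rightarrow> 'y \<Rightarrow> real" where
  "likelihood_ratio f m a y = f m a y / f 0 a y"

text \<open>
  This is \<open>exp (S / 2)\<close> for the CuSum statistic \<open>S\<close>, in a form that stays real. The two agree unless the density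
  \<open>f 0\<close> vanishes at some observation, which has probability \<open>0\<close>.
\<close>

fun sqrt_cusum :: "(nat \<Rightarrow> 'a \<Rightarrow> 'y \<Rightarrow> real) \<Rightarrow> nat \<Rightarrow> ('a, 'y) history \<Rightarrow> real" where
  "sqrt_cusum f m [] = 1"
| "sqrt_cusum f m ((a, y) # h) = max 1 (sqrt_cusum f m h * sqrt (likelihood_ratio f m a y))"

lemma sqrt_cusum_ge_1: "1 \<le> sqrt_cusum f m h"
  by (cases "(f, m, h)" rule: sqrt_cusum.cases) auto

lemma cusum_eq_ln:
  assumes "\<forall>(a, y)\<in>set h. f 0 a y > 0" "\<And>a y. f m a y \<ge> 0"
  shows "cusum f m h = ereal (2 * ln (sqrt_cusum f m h))"
  using assms(1)
proof (induction h)
  case (Cons z h)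
  obtain a y where z: "z = (a, y)" by fastforce
  have IH: "cusum f m h = ereal (2 * ln (sqrt_cusum f m h))" and pos: "f 0 a y > 0"
    using Cons z by auto
  have w: "1 \<le> sqrt_cusum f m h" by (rule sqrt_cusum_ge_1)
  show ?case
  proof (cases "f m a y = 0")
    case True
    then show ?thesis by (simp add: z llr_def IH likelihood_ratio_def)
  next
    case False
    then have likelihood_ratio: "likelihood_ratio f m a y > 0" using assms(2)[of a y] pos by (simp add: likelihood_ratio_def less_le)
    have "2 * ln (sqrt_cusum f m h) + ln (likelihood_ratio f m a y) = 2 * ln (sqrt_cusum f m h * sqrt (likelihood_ratio f m a y))"
      using w likelihood_ratio by (simp add: ln_mult ln_sqrt)
    moreover have "max 0 (2 * ln x) = 2 * ln (max 1 x)" if "x > 0" for x :: real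
      using that by (auto simp: max_def ln_ge_zero_iff)
    ultimately have "max 0 (2 * ln (sqrt_cusum f m h) + ln (likelihood_ratio f m a y))
        = 2 * ln (max 1 (sqrt_cusum f m h * sqrt (likelihood_ratio f m a y)))"
      using w likelihood_ratio by simp
    then show ?thesis using False pos
      by (simp add: z llr_def IH likelihood_ratio_def max_def zero_ereal_def split: if_splits)
  qed
qed (simp add: zero_ereal_def)

locale cusum_model =
  fixes M :: nat and p :: "nat \<Rightarrow> real^'n \<Rightarrow> real" and obs :: "'a::finite \<Rightarrow> real^'n \<Rightarrow> 'y"
    and \<nu> :: "'a \<Rightarrow> 'y measure" and f :: "nat \<Rightarrow> 'a \<Rightarrow> 'y \<Rightarrow> real"
  assumes model: "signal_model M p obs \<nu> f"
begin

abbreviation noise :: "(real^'n) measure" where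
  "noise \<equiv> density lborel (p 0)"

lemma noise_pdf: "is_pdf lborel (p 0)"
  using model unfolding signal_model_def by blast

lemma obs_measurable: "obs a \<in> borel \<rightarrow>\<^sub>M \<nu> a"
  using model by (simp add: signal_model_def)

lemma f_pdf: "m \<le> M \<Longrightarrow> is_pdf (\<nu> a) (f m a)"
  using model by (simp add: signal_model_def)

lemma f_nonneg: "m \<le> M \<Longrightarrow> f m a y \<ge> 0"
  using f_pdf[of m a] by (simp add: is_pdf_def)

lemma f_measurable: "m \<le> M \<Longrightarrow> f m a \<in> borel_measurable (\<nu> a)"
  using f_pdf[of m a] by (simp add: is_pdf_def)

lemma likelihood_ratio_measurable: "m \<le> M \<Longrightarrow> likelihood_ratio f m a \<in> borel_measurable (\<nu> a)"
  unfolding likelihood_ratio_def[abs_def] by (intro borel_measurable_divide f_measurable) auto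

lemma likelihood_ratio_obs_measurable: "m \<le> M \<Longrightarrow> (\<lambda>x. likelihood_ratio f m a (obs a x)) \<in> borel_measurable borel"
  by (rule measurable_compose[OF obs_measurable likelihood_ratio_measurable])

lemma likelihood_ratio_nonneg: "m \<le> M \<Longrightarrow> likelihood_ratio f m a y \<ge> 0"
  by (simp add: likelihood_ratio_def f_nonneg)

lemma distr_obs: "distr noise (\<nu> a) (obs a) = density (\<nu> a) (f 0 a)"
  using model by (simp add: signal_model_def)

lemma obs_noise_measurable: "obs a \<in> noise \<rightarrow>\<^sub>M \<nu> a"
  using obs_measurable by simp

lemma nn_integral_obs:
  "g \<in> borel_measurable (\<nu> a) \<Longrightarrow> (\<integral>\<^sup>+x. g (obs a x) \<partial>noise) = (\<integral>\<^sup>+y. g y \<partial>density (\<nu> a) (f 0 a))"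
  unfolding distr_obs[symmetric] by (rule nn_integral_distr[OF obs_noise_measurable, symmetric]) simp

lemma AE_obs:
  "Measurable.pred (\<nu> a) Q \<Longrightarrow> (AE x in noise. Q (obs a x)) \<longleftrightarrow> (AE y in density (\<nu> a) (f 0 a). Q y)"
  unfolding distr_obs[symmetric] by (rule AE_distr_iff[OF obs_noise_measurable, symmetric]) (simp add: pred_def)

lemma nn_integral_likelihood_ratio_le_1:
  assumes "m \<le> M" shows "(\<integral>\<^sup>+y. likelihood_ratio f m a y \<partial>density (\<nu> a) (f 0 a)) \<le> 1"
proof -
  have "(\<integral>\<^sup>+y. likelihood_ratio f m a y \<partial>density (\<nu> a) (f 0 a)) = (\<integral>\<^sup>+y. ennreal (f 0 a y) * ennreal (likelihood_ratio f m a y) \<partial>\<nu> a)"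
    by (rule nn_integral_density)
      (use f_measurable[of 0 a] likelihood_ratio_measurable[OF assms, of a] in auto)
  also have "\<dots> \<le> (\<integral>\<^sup>+y. ennreal (f m a y) \<partial>\<nu> a)"
    by (intro nn_integral_mono)
      (use assms f_nonneg[of 0 a] in \<open>auto simp: likelihood_ratio_def f_nonneg ennreal_mult''[symmetric]\<close>)
  also have "\<dots> = 1"
    using f_pdf[OF assms, of a] f_measurable[OF assms, of a] prob_space.emeasure_space_1[of "density (\<nu> a) (f m a)"]
    by (simp add: is_pdf_def emeasure_density cong: nn_integral_cong)
  finally show ?thesis .
qed

lemma AE_f0_pos: "AE x in noise. f 0 a (obs a x) > 0"
proof (subst AE_obs[where Q="\<lambda>y. f 0 a y > 0"])
  show "Measurable.pred (\<nu> a) (\<lambda>y. 0 < f 0 a y)" using f_measurable[of 0 a] by measurable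
  show "AE y in density (\<nu> a) (f 0 a). 0 < f 0 a y"
    by (subst AE_density) (use f_measurable[of 0 a] in auto)
qed

text \<open>
  Up to a factor, this is the squared Hellinger distance between the distributions of the observation under
  \<open>m\<close> and under \<open>0\<close>.
\<close>

definition hellinger :: "nat \<Rightarrow> 'a \<Rightarrow> real" where
  "hellinger m a = 1 - enn2real (\<integral>\<^sup>+x. sqrt (likelihood_ratio f m a (obs a x)) \<partial>noise)"

lemma sqrt_likelihood_ratio_facts:
  assumes "m \<le> M"
  shows nn_integral_sqrt_likelihood_ratio: "(\<integral>\<^sup>+x. sqrt (likelihood_ratio f m a (obs a x)) \<partial>noise) = ennreal (1 - hellinger m a)"
    and hellinger_nonneg: "0 \<le> hellinger m a" and hellinger_le_1: "hellinger m a \<le> 1"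
    and AE_likelihood_ratio_1: "hellinger m a = 0 \<Longrightarrow> AE x in noise. likelihood_ratio f m a (obs a x) = 1"
    and hellinger_pos: "density (\<nu> a) (f m a) \<noteq> density (\<nu> a) (f 0 a) \<Longrightarrow> 0 < hellinger m a"
proof -
  let ?P = "density (\<nu> a) (f 0 a)"
  have P: "prob_space ?P" using f_pdf[of 0 a] by (simp add: is_pdf_def)
  have m0 [measurable]: "likelihood_ratio f m a \<in> borel_measurable (\<nu> a)" by (rule likelihood_ratio_measurable[OF assms])
  have m: "likelihood_ratio f m a \<in> borel_measurable ?P" by simp
  note sq = sqrt_moment[OF P m likelihood_ratio_nonneg[OF assms] nn_integral_likelihood_ratio_le_1[OF assms]]
  have eq: "(\<integral>\<^sup>+x. sqrt (likelihood_ratio f m a (obs a x)) \<partial>noise) = (\<integral>\<^sup>+y. sqrt (likelihood_ratio f m a y) \<partial>?P)"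
    by (rule nn_integral_obs) measurable
  show l: "(\<integral>\<^sup>+x. sqrt (likelihood_ratio f m a (obs a x)) \<partial>noise) = ennreal (1 - hellinger m a)"
    using le_less_trans[OF sq(1) ennreal_one_less_top] unfolding hellinger_def eq by simp
  have "enn2real (\<integral>\<^sup>+x. sqrt (likelihood_ratio f m a (obs a x)) \<partial>noise) \<le> 1"
    unfolding eq by (rule enn2real_leI) (use sq(1) in simp_all)
  then show "0 \<le> hellinger m a" by (simp add: hellinger_def)
  show "hellinger m a \<le> 1" by (simp add: hellinger_def)
  have ae: "AE y in ?P. likelihood_ratio f m a y = 1" if "hellinger m a = 0"
    using l that eq by (intro sq(2)) simp
  show "AE x in noise. likelihood_ratio f m a (obs a x) = 1" if "hellinger m a = 0"
  proof (rule AE_obs[where Q="\<lambda>y. likelihood_ratio f m a y = 1", THEN iffD2, OF _ ae[OF that]])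
    show "Measurable.pred (\<nu> a) (\<lambda>y. likelihood_ratio f m a y = 1)"
      using likelihood_ratio_measurable[OF assms, of a] by measurable
  qed
  show "0 < hellinger m a" if "density (\<nu> a) (f m a) \<noteq> density (\<nu> a) (f 0 a)"
  proof (rule ccontr)
    assume "\<not> 0 < hellinger m a"
    with \<open>0 \<le> hellinger m a\<close> have "hellinger m a = 0" by simp
    from density_eq_of_AE_ratio[OF f_pdf[OF assms] f_pdf[of 0]] ae[OF this] that show False
      by (simp add: likelihood_ratio_def)
  qed
qed

lemma hellinger_pos_of_max_KL:
  assumes m: "m \<in> {1..M}" and max: "is_arg_max (KL_action \<nu> f m) (\<lambda>a. True) a"
  shows "0 < hellinger m a"
proof (rule hellinger_pos)
  show "m \<le> M" using m by simp
  obtain a' where a': "density (\<nu> a') (f m a') \<noteq> density (\<nu> a') (f 0 a')"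
    using model m unfolding signal_model_def by blast
  have pr: "prob_space (density (\<nu> a) (f k a))" if "k \<le> M" for k a
    using f_pdf[OF that, of a] by (simp add: is_pdf_def)
  have "KL_action \<nu> f m a' > 0"
    unfolding KL_action_def by (rule KL_pos) (use a' m pr in auto)
  then have "KL_action \<nu> f m a > 0"
    using max unfolding is_arg_max_linorder by (blast intro: less_le_trans)
  then show "density (\<nu> a) (f m a) \<noteq> density (\<nu> a) (f 0 a)"
    using KL_self[OF pr[of 0 a]] by (auto simp: KL_action_def)
qed

text \<open>
  There are finitely many actions and hypotheses, hence a positive lower bound for all distances that do
  not vanish.
\<close>

lemma hellinger_gap:
  obtains \<Delta> where "\<Delta> > 0" "\<And>m a. m \<in> {1..M} \<Longrightarrow> hellinger m a > 0 \<Longrightarrow> hellinger m a \<ge> \<Delta>"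
proof -
  define B where "B = insert 1 ((\<lambda>(m, a). hellinger m a) ` {z \<in> {1..M} \<times> UNIV. hellinger (fst z) (snd z) > 0})"
  have fin: "finite B" "B \<noteq> {}" unfolding B_def by auto
  show thesis
  proof
    show "Min B > 0" using fin by (subst Min_gr_iff) (auto simp: B_def)
    show "Min B \<le> hellinger m a" if "m \<in> {1..M}" "hellinger m a > 0" for m a
    proof -
      have "(m, a) \<in> {z \<in> {1..M} \<times> UNIV. hellinger (fst z) (snd z) > 0}" using that by simp
      then have "hellinger m a \<in> B" unfolding B_def by force
      then show ?thesis by (rule Min_le[OF fin(1)])
    qed
  qed
qed

end

locale cusum_process = cusum_model M p obs \<nu> f
  for M :: nat and p :: "nat \<Rightarrow> real^'n \<Rightarrow> real" and obs :: "'a::finite \<Rightarrow> real^'n \<Rightarrow> 'y"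
    and \<nu> :: "'a \<Rightarrow> 'y measure" and f :: "nat \<Rightarrow> 'a \<Rightarrow> 'y \<Rightarrow> real" +
  fixes \<pi> :: "('a, 'y) policy"
  assumes ionescu: "Ionescu_Tulcea (step_kernel (p 0) obs \<pi>) step_space"
begin

sublocale controlled_process "p 0" obs \<pi>
  by (rule controlled_process.intro[OF noise_pdf ionescu])

lemma adapted_sqrt_cusum: "m \<le> M \<Longrightarrow> adapted n borel (sqrt_cusum f m)"
proof (induction n)
  case 0
  show ?case by (simp add: adapted_def)
next
  case (Suc n)
  have "adapted (Suc n) borel (\<lambda>h. likelihood_ratio f m (fst (hd h)) (snd (hd h)))"
    by (rule adapted_obs[where \<phi>="likelihood_ratio f m"]) (rule likelihood_ratio_obs_measurable[OF Suc.prems])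
  moreover have "adapted (Suc n) borel (\<lambda>h. sqrt_cusum f m (tl h))"
    by (rule adapted_Suc[OF Suc.IH[OF Suc.prems]])
  ultimately show ?case unfolding adapted_def by simp
qed

definition mean_sqrt_cusum :: "nat \<Rightarrow> nat \<Rightarrow> ennreal" where
  "mean_sqrt_cusum m n = (\<integral>\<^sup>+\<omega>. sqrt_cusum f m (H n \<omega>) \<partial>law)"

text \<open>
  The expected decrease of \<open>sqrt_cusum\<close> that the action chosen after \<open>n\<close> observations causes, were there no
  reflection.
\<close>

definition mean_decrease :: "nat \<Rightarrow> nat \<Rightarrow> ennreal" where
  "mean_decrease m n = (\<integral>\<^sup>+\<omega>. ennreal (sqrt_cusum f m (H n \<omega>)) * ennreal (hellinger m (fst (\<omega> n))) \<partial>law)"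

lemma adapted_ennreal: "adapted n borel g \<Longrightarrow> adapted n borel (\<lambda>h. ennreal (g h))"
  unfolding adapted_def by (rule measurable_compose[OF _ measurable_ennreal])

text \<open>
  The weight \<open>c\<close> is \<open>1\<close> for the drift, and the distance itself in the bound for upward jumps.
\<close>

lemma weighted_step:
  assumes m: "m \<le> M" and c: "\<And>a. c a \<ge> 0"
  shows "(\<integral>\<^sup>+\<omega>. ennreal (sqrt_cusum f m (H n \<omega>)) *
      ennreal (c (fst (\<omega> n)) * sqrt (likelihood_ratio f m (fst (\<omega> n)) (obs (fst (\<omega> n)) (snd (\<omega> n))))) \<partial>law)
    = (\<integral>\<^sup>+\<omega>. ennreal (sqrt_cusum f m (H n \<omega>)) * ennreal (c (fst (\<omega> n)) * (1 - hellinger m (fst (\<omega> n)))) \<partial>law)"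
proof -
  interpret X: prob_space signal by (rule prob_space_signal)
  note G = adapted_ennreal[OF adapted_sqrt_cusum[OF m, of n]]
  have "(\<integral>\<^sup>+x. ennreal (c a * sqrt (likelihood_ratio f m a (obs a x))) \<partial>signal) = ennreal (c a * (1 - hellinger m a))" for a
  proof -
    have "(\<integral>\<^sup>+x. ennreal (c a * sqrt (likelihood_ratio f m a (obs a x))) \<partial>signal)
        = (\<integral>\<^sup>+x. ennreal (c a) * ennreal (sqrt (likelihood_ratio f m a (obs a x))) \<partial>signal)"
      by (simp add: ennreal_mult c likelihood_ratio_nonneg[OF m])
    also have "\<dots> = ennreal (c a) * ennreal (1 - hellinger m a)"
      unfolding nn_integral_sqrt_likelihood_ratio[OF m, symmetric]
      by (rule nn_integral_cmult) (use likelihood_ratio_obs_measurable[OF m, of a] in measurable)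
    finally show ?thesis using hellinger_le_1[OF m, of a] c by (simp add: ennreal_mult)
  qed
  moreover have "(\<integral>\<^sup>+x. ennreal (c a * (1 - hellinger m a)) \<partial>signal) = ennreal (c a * (1 - hellinger m a))" for a
    using X.emeasure_space_1 by simp
  moreover have "(\<lambda>x. ennreal (c a * sqrt (likelihood_ratio f m a (obs a x)))) \<in> borel_measurable borel" for a
    using likelihood_ratio_obs_measurable[OF m, of a] by measurable
  ultimately show ?thesis
    using one_step[OF G, of "\<lambda>a y. ennreal (c a * sqrt (likelihood_ratio f m a y))"]
      one_step[OF G, of "\<lambda>a y. ennreal (c a * (1 - hellinger m a))"] by simp
qed

text \<open>
  The reflection \<open>max 1 x \<le> 1 + x\<close> costs at most \<open>1\<close>; the rest is the mean of the square root of the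
  likelihood ratio.
\<close>

lemma drift:
  assumes m: "m \<le> M"
  shows "mean_sqrt_cusum m (Suc n) + mean_decrease m n \<le> 1 + mean_sqrt_cusum m n"
proof -
  interpret prob_space law by (rule prob_space_law)
  let ?w = "\<lambda>\<omega>. sqrt_cusum f m (H n \<omega>)" and ?a = "\<lambda>\<omega>. fst (\<omega> n)"
  let ?s = "\<lambda>\<omega>. sqrt (likelihood_ratio f m (?a \<omega>) (obs (?a \<omega>) (snd (\<omega> n))))"
  have mw: "(\<lambda>\<omega>. ennreal (?w \<omega>)) \<in> borel_measurable law"
    by (rule adapted_law[OF adapted_ennreal[OF adapted_sqrt_cusum[OF m]]])
  have ma: "(\<lambda>\<omega>. ennreal (u (?a \<omega>))) \<in> borel_measurable law" for u
    by (rule measurable_compose[OF measurable_act]) simp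
  have ms: "(\<lambda>\<omega>. ennreal (?s \<omega>)) \<in> borel_measurable law"
  proof -
    have "(\<lambda>x. ennreal (sqrt (likelihood_ratio f m a (obs a x)))) \<in> borel_measurable borel" for a
      using likelihood_ratio_obs_measurable[OF m, of a] by measurable
    from adapted_law[OF adapted_obs[where n=n and \<phi>="\<lambda>a y. ennreal (sqrt (likelihood_ratio f m a y))", OF this]]
    show ?thesis by simp
  qed
  have w1: "?w \<omega> \<ge> 0" for \<omega> using sqrt_cusum_ge_1[of f m "H n \<omega>"] by simp
  have "mean_sqrt_cusum m (Suc n) \<le> (\<integral>\<^sup>+\<omega>. 1 + ennreal (?w \<omega>) * ennreal (1 * ?s \<omega>) \<partial>law)"
    unfolding mean_sqrt_cusum_def
  proof (rule nn_integral_mono)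
    fix \<omega>
    have "0 \<le> ?w \<omega> * ?s \<omega>" using w1 likelihood_ratio_nonneg[OF m] by (intro mult_nonneg_nonneg) auto
    then have "ennreal (sqrt_cusum f m (H (Suc n) \<omega>)) \<le> ennreal (1 + ?w \<omega> * ?s \<omega>)"
      by (intro ennreal_leI) simp
    also have "\<dots> = 1 + ennreal (?w \<omega>) * ennreal (1 * ?s \<omega>)"
      using w1 likelihood_ratio_nonneg[OF m] by (simp add: ennreal_mult)
    finally show "ennreal (sqrt_cusum f m (H (Suc n) \<omega>)) \<le> \<dots>" .
  qed
  also have "\<dots> = 1 + (\<integral>\<^sup>+\<omega>. ennreal (?w \<omega>) * ennreal (1 * ?s \<omega>) \<partial>law)"
    using mw ms by (subst nn_integral_add) (auto simp: emeasure_space_1)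
  also have "(\<integral>\<^sup>+\<omega>. ennreal (?w \<omega>) * ennreal (1 * ?s \<omega>) \<partial>law)
      = (\<integral>\<^sup>+\<omega>. ennreal (?w \<omega>) * ennreal (1 * (1 - hellinger m (?a \<omega>))) \<partial>law)"
    by (rule weighted_step[OF m]) simp
  finally have "mean_sqrt_cusum m (Suc n) + mean_decrease m n
      \<le> 1 + ((\<integral>\<^sup>+\<omega>. ennreal (?w \<omega>) * ennreal (1 - hellinger m (?a \<omega>)) \<partial>law) + mean_decrease m n)"
    by (simp add: add_right_mono flip: add.assoc)
  also have "(\<integral>\<^sup>+\<omega>. ennreal (?w \<omega>) * ennreal (1 - hellinger m (?a \<omega>)) \<partial>law) + mean_decrease m n = mean_sqrt_cusum m n"
  proof -
    have "ennreal (?w \<omega>) * ennreal (1 - hellinger m (?a \<omega>)) + ennreal (?w \<omega>) * ennreal (hellinger m (?a \<omega>)) = ennreal (?w \<omega>)" for \<omega>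
    proof -
      have "ennreal (1 - hellinger m (?a \<omega>)) + ennreal (hellinger m (?a \<omega>)) = 1"
        using hellinger_nonneg[OF m, of "?a \<omega>"] hellinger_le_1[OF m, of "?a \<omega>"]
        by (subst ennreal_plus[symmetric]) auto
      then show ?thesis by (simp only: distrib_left[symmetric] mult_1_right)
    qed
    then show ?thesis
      unfolding mean_sqrt_cusum_def mean_decrease_def
      by (subst nn_integral_add[symmetric])
        (simp_all add: borel_measurable_times_ennreal[OF mw ma[of "\<lambda>a. 1 - hellinger m a"]]
          borel_measurable_times_ennreal[OF mw ma])
  qed
  finally show ?thesis .
qed

lemma sum_mean_decrease:
  assumes m: "m \<le> M"
  shows "mean_sqrt_cusum m n + (\<Sum>k<n. mean_decrease m k) \<le> of_nat (Suc n)"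
proof (induction n)
  case 0
  interpret prob_space law by (rule prob_space_law)
  show ?case by (simp add: mean_sqrt_cusum_def emeasure_space_1)
next
  case (Suc n)
  have "mean_sqrt_cusum m (Suc n) + (\<Sum>k<Suc n. mean_decrease m k) = (mean_sqrt_cusum m (Suc n) + mean_decrease m n) + (\<Sum>k<n. mean_decrease m k)"
    by (simp add: ac_simps)
  also have "\<dots> \<le> (1 + mean_sqrt_cusum m n) + (\<Sum>k<n. mean_decrease m k)"
    by (intro add_right_mono drift[OF m])
  also have "\<dots> = 1 + (mean_sqrt_cusum m n + (\<Sum>k<n. mean_decrease m k))" by (simp add: ac_simps)
  also have "\<dots> \<le> 1 + of_nat (Suc n)" by (intro add_left_mono Suc)
  finally show ?case by simp
qed

section \<open>The fraction of time above the lower threshold\<close>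

definition mean_hellinger :: "nat \<Rightarrow> ('a, 'y) history \<Rightarrow> real" where
  "mean_hellinger m h = (\<Sum>a\<in>UNIV. pmf (\<pi> h) a * hellinger m a)"

lemma mean_hellinger_nonneg: "m \<le> M \<Longrightarrow> 0 \<le> mean_hellinger m h"
  unfolding mean_hellinger_def by (intro sum_nonneg mult_nonneg_nonneg hellinger_nonneg) auto

lemma adapted_mean_hellinger: "adapted n borel (mean_hellinger m)"
  unfolding adapted_def mean_hellinger_def
  by (intro borel_measurable_sum borel_measurable_times adapted_pmf[unfolded adapted_def] borel_measurable_const)

lemma mean_decrease_eq:
  assumes m: "m \<le> M"
  shows "mean_decrease m n = (\<integral>\<^sup>+\<omega>. ennreal (sqrt_cusum f m (H n \<omega>)) * ennreal (mean_hellinger m (H n \<omega>)) \<partial>law)"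
proof -
  interpret X: prob_space signal by (rule prob_space_signal)
  have "(\<integral>\<^sup>+x. ennreal (hellinger m a) \<partial>signal) = ennreal (hellinger m a)" for a
    using X.emeasure_space_1 by simp
  moreover have "(\<Sum>a\<in>UNIV. ennreal (pmf (\<pi> h) a) * ennreal (hellinger m a)) = ennreal (mean_hellinger m h)" for h
    unfolding mean_hellinger_def
    by (subst sum_ennreal[symmetric]) (auto simp: hellinger_nonneg[OF m] ennreal_mult)
  ultimately show ?thesis
    unfolding mean_decrease_def
    using one_step[OF adapted_ennreal[OF adapted_sqrt_cusum[OF m, of n]], where \<phi>="\<lambda>a y. ennreal (hellinger m a)"] by simp
qed

lemma AE_good_observations:
  "AE \<omega> in law. \<forall>n. f 0 (fst (\<omega> n)) (obs (fst (\<omega> n)) (snd (\<omega> n))) > 0 \<and>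
     (\<forall>m\<in>{1..M}. hellinger m (fst (\<omega> n)) = 0 \<longrightarrow> likelihood_ratio f m (fst (\<omega> n)) (obs (fst (\<omega> n)) (snd (\<omega> n))) = 1)"
proof (rule AE_observation[where Q="\<lambda>a y. f 0 a y > 0 \<and> (\<forall>m\<in>{1..M}. hellinger m a = 0 \<longrightarrow> likelihood_ratio f m a y = 1)"])
  fix a
  have f0: "(\<lambda>x. f 0 a (obs a x)) \<in> borel_measurable borel"
    by (rule measurable_compose[OF obs_measurable f_measurable]) simp
  have l: "Measurable.pred borel (\<lambda>x. hellinger m a = 0 \<longrightarrow> likelihood_ratio f m a (obs a x) = 1)" if "m \<in> {1..M}" for m
  proof -
    have [measurable]: "(\<lambda>x. likelihood_ratio f m a (obs a x)) \<in> borel_measurable borel"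
      by (rule likelihood_ratio_obs_measurable) (use that in simp)
    show ?thesis by measurable
  qed
  show "Measurable.pred borel (\<lambda>x. 0 < f 0 a (obs a x) \<and> (\<forall>m\<in>{1..M}. hellinger m a = 0 \<longrightarrow> likelihood_ratio f m a (obs a x) = 1))"
  proof (rule pred_intros_logic(3))
    show "Measurable.pred borel (\<lambda>x. 0 < f 0 a (obs a x))"
      unfolding pred_def by (rule borel_measurable_less[OF borel_measurable_const f0])
    show "Measurable.pred borel (\<lambda>x. \<forall>m\<in>{1..M}. hellinger m a = 0 \<longrightarrow> likelihood_ratio f m a (obs a x) = 1)"
      by (rule pred_intros_finite(3)[OF finite_atLeastAtMost l])
  qed
  show "AE x in signal. 0 < f 0 a (obs a x) \<and> (\<forall>m\<in>{1..M}. hellinger m a = 0 \<longrightarrow> likelihood_ratio f m a (obs a x) = 1)"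
  proof -
    have "AE x in signal. \<forall>m\<in>{1..M}. hellinger m a = 0 \<longrightarrow> likelihood_ratio f m a (obs a x) = 1"
    proof (rule AE_finite_allI)
      show "AE x in signal. hellinger m a = 0 \<longrightarrow> likelihood_ratio f m a (obs a x) = 1" if "m \<in> {1..M}" for m
        using AE_likelihood_ratio_1[of m a] that by (cases "hellinger m a = 0") auto
    qed simp
    with AE_f0_pos show ?thesis by eventually_elim blast
  qed
qed

lemma M_pos: "M \<ge> 1"
  using model by (simp add: signal_model_def)

lemma max_cusum_gr_iff: "max_cusum M f h > x \<longleftrightarrow> (\<exists>m\<in>{1..M}. cusum f m h > x)"
  unfolding max_cusum_def using M_pos by (subst Max_gr_iff) auto

lemma adapted_max_cusum: "adapted n borel (max_cusum M f)"
  unfolding adapted_def by (rule measurable_max_cusum[OF model order_refl])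

definition prob_high :: "real \<Rightarrow> nat \<Rightarrow> real" where
  "prob_high \<kappa> n = measure law {\<omega> \<in> space law. max_cusum M f (H n \<omega>) > ereal \<kappa>}"

text \<open>
  Let \<open>K = exp (\<kappa> / 2)\<close> and suppose that some \<open>W m = exp (S m / 2)\<close> exceeds \<open>K\<close> after step \<open>n = k + 1\<close>.
  If the last action was informative about \<open>m\<close>, Markov's inequality bounds the probability of reaching \<open>K\<close>
  by a multiple of the mean decrease at time \<open>k\<close>. Otherwise \<open>W m\<close> has not moved, so the maximal statistic was
  above \<open>\<kappa>\<close> already. Then consider the leading statistic \<open>m'\<close> at time \<open>k\<close>: either the last action was informative
  about it, and there was a large decrease at time \<open>k\<close>, or \<open>m'\<close> has not moved either, and the next action
  is informative about it by the assumption on the policy, which gives a large decrease at time \<open>n\<close>. The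
  policy is required to react to the leader of the preceding time only, which may differ from the present one.
\<close>

lemma prob_high_le:
  assumes \<Delta>: "\<Delta> > 0" and gap: "\<And>m a. m \<in> {1..M} \<Longrightarrow> hellinger m a > 0 \<Longrightarrow> hellinger m a \<ge> \<Delta>"
    and \<delta>: "0 < \<delta>"
    and reacts: "\<And>h. n = length h \<Longrightarrow> max_cusum M f h > ereal \<kappa> \<Longrightarrow> max_cusum M f (tl h) > ereal \<kappa> \<Longrightarrow>
      \<exists>m\<in>{1..M}. mean_hellinger m h \<ge> \<delta> \<and> (\<forall>m'\<in>{1..M}. cusum f m' (tl h) \<le> cusum f m (tl h))"
    and n: "n = Suc k"
  shows "ennreal (prob_high \<kappa> n) \<le> (\<Sum>m\<in>{1..M}. ennreal (2 / (\<Delta> * exp (\<kappa> / 2))) * mean_decrease m k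
     + ennreal (1 / (\<delta> * exp (\<kappa> / 2))) * mean_decrease m n)"
proof -
  interpret prob_space law by (rule prob_space_law)
  let ?K = "exp (\<kappa> / 2)"
  define c where "c = 1 / (\<Delta> * ?K)"
  define c' where "c' = 1 / (\<delta> * ?K)"
  have c: "c > 0" "c' > 0" using \<Delta> \<delta> by (auto simp: c_def c'_def)
  let ?a = "\<lambda>\<omega>. fst (\<omega> k)"
  let ?s = "\<lambda>m \<omega>. sqrt (likelihood_ratio f m (?a \<omega>) (obs (?a \<omega>) (snd (\<omega> k))))"
  let ?w = "\<lambda>m n \<omega>. sqrt_cusum f m (H n \<omega>)"
  \<comment> \<open>The three summands dominate the indicators of the three events: a jump above \<open>K\<close> by an informative
    action, an informative action taken above \<open>K\<close>, and a statistic above \<open>K\<close> that the policy reacts to.\<close>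
  define T where "T m \<omega> = c * (?w m k \<omega> * (hellinger m (?a \<omega>) * ?s m \<omega>)) + c * (?w m k \<omega> * hellinger m (?a \<omega>))
     + c' * (?w m n \<omega> * mean_hellinger m (H n \<omega>))" for m \<omega>
  have w1: "?w m j \<omega> \<ge> 1" for m j \<omega> by (rule sqrt_cusum_ge_1)
  have w0: "?w m j \<omega> \<ge> 0" for m j \<omega> using w1[of m \<omega> j] by linarith
  have nn: "c * (?w m k \<omega> * (hellinger m (?a \<omega>) * ?s m \<omega>)) \<ge> 0" "c * (?w m k \<omega> * hellinger m (?a \<omega>)) \<ge> 0"
    "c' * (?w m n \<omega> * mean_hellinger m (H n \<omega>)) \<ge> 0" if "m \<in> {1..M}" for m \<omega>
    using that c w0 hellinger_nonneg[of m] likelihood_ratio_nonneg[of m] mean_hellinger_nonneg[of m]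
    by (auto intro!: mult_nonneg_nonneg)
  have T0: "T m \<omega> \<ge> 0" if "m \<in> {1..M}" for m \<omega> unfolding T_def using nn[OF that] by (intro add_nonneg_nonneg)
  have Tbig: "T m \<omega> \<ge> 1" if m: "m \<in> {1..M}" and
    "(hellinger m (?a \<omega>) > 0 \<and> ?w m n \<omega> > ?K) \<or> (hellinger m (?a \<omega>) > 0 \<and> ?w m k \<omega> > ?K)
      \<or> (?w m n \<omega> > ?K \<and> mean_hellinger m (H n \<omega>) \<ge> \<delta>)" for m \<omega>
    using that(2)
  proof (elim disjE conjE)
    assume l: "hellinger m (?a \<omega>) > 0" and w: "?w m n \<omega> > ?K"
    show ?thesis
    proof (cases "?w m k \<omega> * ?s m \<omega> > ?K")
      case True
      have "c * (\<Delta> * ?K) \<le> c * (hellinger m (?a \<omega>) * (?w m k \<omega> * ?s m \<omega>))"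
        using gap[OF m l] True c \<Delta> by (intro mult_left_mono mult_mono) auto
      then have "1 \<le> c * (?w m k \<omega> * (hellinger m (?a \<omega>) * ?s m \<omega>))"
        using \<Delta> by (simp add: c_def mult_ac)
      then show ?thesis using nn[OF m, of \<omega>] unfolding T_def by linarith
    next
      case False
      have "?w m n \<omega> = max 1 (?w m k \<omega> * ?s m \<omega>)" by (simp add: n)
      \<comment> \<open>The statistic can exceed \<open>K\<close> by reflection only if \<open>K < 1\<close>; then it was above \<open>K\<close> before.\<close>
      from w[unfolded this less_max_iff_disj] False have "?K < 1" by blast
      from less_imp_le[OF less_le_trans[OF this w1[of m \<omega> k]]] have "c * (\<Delta> * ?K) \<le> c * (hellinger m (?a \<omega>) * ?w m k \<omega>)"
        using gap[OF m l] c \<Delta> by (intro mult_left_mono mult_mono) auto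
      then have "1 \<le> c * (?w m k \<omega> * hellinger m (?a \<omega>))"
        using \<Delta> by (simp add: c_def mult_ac)
      then show ?thesis using nn[OF m, of \<omega>] unfolding T_def by linarith
    qed
  next
    assume l: "hellinger m (?a \<omega>) > 0" and w: "?w m k \<omega> > ?K"
    have "c * (\<Delta> * ?K) \<le> c * (hellinger m (?a \<omega>) * ?w m k \<omega>)"
      using gap[OF m l] w c \<Delta> by (intro mult_left_mono mult_mono) auto
    then have "1 \<le> c * (?w m k \<omega> * hellinger m (?a \<omega>))"
      using \<Delta> by (simp add: c_def mult_ac)
    then show ?thesis using nn[OF m, of \<omega>] unfolding T_def by linarith
  next
    assume w: "?w m n \<omega> > ?K" and r: "mean_hellinger m (H n \<omega>) \<ge> \<delta>"
    have "c' * (\<delta> * ?K) \<le> c' * (mean_hellinger m (H n \<omega>) * ?w m n \<omega>)"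
      using r w c \<delta> by (intro mult_left_mono mult_mono) auto
    then have "1 \<le> c' * (?w m n \<omega> * mean_hellinger m (H n \<omega>))"
      using \<delta> by (simp add: c'_def mult_ac)
    then show ?thesis using nn[OF m, of \<omega>] unfolding T_def by linarith
  qed
  have key: "AE \<omega> in law. max_cusum M f (H n \<omega>) > ereal \<kappa> \<longrightarrow> (\<exists>m\<in>{1..M}. T m \<omega> \<ge> 1)"
    using AE_good_observations
  proof eventually_elim
    fix \<omega> :: "nat \<Rightarrow> 'a \<times> (real^'n)"
    assume good: "\<forall>n. f 0 (fst (\<omega> n)) (obs (fst (\<omega> n)) (snd (\<omega> n))) > 0 \<and>
     (\<forall>m\<in>{1..M}. hellinger m (fst (\<omega> n)) = 0 \<longrightarrow> likelihood_ratio f m (fst (\<omega> n)) (obs (fst (\<omega> n)) (snd (\<omega> n))) = 1)"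
    have pos: "\<forall>(a, y)\<in>set (H j \<omega>). f 0 a y > 0" for j
      using good by (induction j) auto
    have cw: "cusum f m (H j \<omega>) > ereal \<kappa> \<longleftrightarrow> ?w m j \<omega> > ?K" if "m \<in> {1..M}" for m j
    proof -
      have "cusum f m (H j \<omega>) = ereal (2 * ln (?w m j \<omega>))"
        by (rule cusum_eq_ln) (use pos[of j] that f_nonneg in auto)
      moreover have "?K < ?w m j \<omega> \<longleftrightarrow> \<kappa> / 2 < ln (?w m j \<omega>)"
      proof -
        have "exp (ln (?w m j \<omega>)) = ?w m j \<omega>"
          using w1[of m \<omega> j] by (intro exp_ln) linarith
        then show ?thesis using exp_less_cancel_iff[of "\<kappa> / 2" "ln (?w m j \<omega>)"] by (simp only:)
      qed
      ultimately show ?thesis by auto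
    qed
    have same: "?w m n \<omega> = ?w m k \<omega>" if "m \<in> {1..M}" "hellinger m (?a \<omega>) = 0" for m
      using good that w1[of m \<omega> k] by (simp add: n)
    show "max_cusum M f (H n \<omega>) > ereal \<kappa> \<longrightarrow> (\<exists>m\<in>{1..M}. T m \<omega> \<ge> 1)"
    proof
      assume S: "max_cusum M f (H n \<omega>) > ereal \<kappa>"
      then obtain m where m: "m \<in> {1..M}" "?w m n \<omega> > ?K" using max_cusum_gr_iff cw by blast
      show "\<exists>m\<in>{1..M}. T m \<omega> \<ge> 1"
      proof (cases "hellinger m (?a \<omega>) > 0")
        case True
        with m show ?thesis using Tbig[of m \<omega>] by blast
      next
        case False
        with hellinger_nonneg[of m "?a \<omega>"] m have "hellinger m (?a \<omega>) = 0" by auto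
        with same m have "?w m k \<omega> > ?K" by simp
        then have S': "max_cusum M f (H k \<omega>) > ereal \<kappa>" using max_cusum_gr_iff cw m by blast
        obtain m' where m': "m' \<in> {1..M}" "mean_hellinger m' (H n \<omega>) \<ge> \<delta>"
          "\<forall>m\<in>{1..M}. cusum f m (H k \<omega>) \<le> cusum f m' (H k \<omega>)"
          using reacts[of "H n \<omega>"] S S' by (auto simp: n length_hist)
        have "cusum f m' (H k \<omega>) > ereal \<kappa>"
          using S' m' unfolding max_cusum_gr_iff by (blast intro: less_le_trans)
        then have w': "?w m' k \<omega> > ?K" using cw m' by blast
        show ?thesis
        proof (cases "hellinger m' (?a \<omega>) > 0")
          case True
          with m' w' show ?thesis using Tbig[of m' \<omega>] by blast
        next
          case False
          with hellinger_nonneg[of m' "?a \<omega>"] m' have "hellinger m' (?a \<omega>) = 0" by auto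
          with same m' w' have "?w m' n \<omega> > ?K" by simp
          with m' show ?thesis using Tbig[of m' \<omega>] by blast
        qed
      qed
    qed
  qed
  have mS: "{\<omega> \<in> space law. max_cusum M f (H n \<omega>) > ereal \<kappa>} \<in> sets law"
    by (rule borel_measurable_less[OF borel_measurable_const adapted_law[OF adapted_max_cusum]])
  have mw: "(\<lambda>\<omega>. ennreal (?w m j \<omega>)) \<in> borel_measurable law" if "m \<in> {1..M}" for m j
    by (rule adapted_law[OF adapted_ennreal[OF adapted_sqrt_cusum]]) (use that in simp)
  have ma: "(\<lambda>\<omega>. ennreal (u (?a \<omega>))) \<in> borel_measurable law" for u
    by (rule measurable_compose[OF measurable_act]) simp
  have mr: "(\<lambda>\<omega>. ennreal (mean_hellinger m (H n \<omega>))) \<in> borel_measurable law" for m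
    by (rule adapted_law[OF adapted_ennreal[OF adapted_mean_hellinger]])
  have ms: "(\<lambda>\<omega>. ennreal (hellinger m (?a \<omega>) * ?s m \<omega>)) \<in> borel_measurable law" if "m \<in> {1..M}" for m
  proof -
    have [measurable]: "(\<lambda>x. likelihood_ratio f m a (obs a x)) \<in> borel_measurable borel" for a
      by (rule likelihood_ratio_obs_measurable) (use that in simp)
    have "(\<lambda>x. ennreal (hellinger m a * sqrt (likelihood_ratio f m a (obs a x)))) \<in> borel_measurable borel" for a
      by measurable
    from adapted_law[OF adapted_obs[where n=k and \<phi>="\<lambda>a y. ennreal (hellinger m a * sqrt (likelihood_ratio f m a y))", OF this]]
    show ?thesis by simp
  qed
  define T1 where "T1 m \<omega> = ennreal (?w m k \<omega>) * ennreal (hellinger m (?a \<omega>) * ?s m \<omega>)" for m \<omega>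
  define T2 where "T2 m \<omega> = ennreal (?w m k \<omega>) * ennreal (hellinger m (?a \<omega>))" for m \<omega>
  define T3 where "T3 m \<omega> = ennreal (?w m n \<omega>) * ennreal (mean_hellinger m (H n \<omega>))" for m \<omega>
  have mT: "T1 m \<in> borel_measurable law" "T2 m \<in> borel_measurable law" "T3 m \<in> borel_measurable law"
    if "m \<in> {1..M}" for m
    unfolding T1_def T2_def T3_def
    by (rule borel_measurable_times_ennreal[OF mw[OF that] ms[OF that]]
        borel_measurable_times_ennreal[OF mw[OF that] ma]
        borel_measurable_times_ennreal[OF mw[OF that] mr])+
  have Teq: "ennreal (T m \<omega>) = ennreal c * T1 m \<omega> + ennreal c * T2 m \<omega> + ennreal c' * T3 m \<omega>"
    if "m \<in> {1..M}" for m \<omega>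
    unfolding T_def T1_def T2_def T3_def
    using nn[OF that, of \<omega>] c w0 hellinger_nonneg[of m] likelihood_ratio_nonneg[of m] mean_hellinger_nonneg[of m] that
    by (simp add: ennreal_plus ennreal_mult)
  have "ennreal (prob_high \<kappa> n) = (\<integral>\<^sup>+\<omega>. indicator {\<omega> \<in> space law. max_cusum M f (H n \<omega>) > ereal \<kappa>} \<omega> \<partial>law)"
    using mS by (simp add: prob_high_def emeasure_eq_measure)
  also have "\<dots> \<le> (\<integral>\<^sup>+\<omega>. (\<Sum>m\<in>{1..M}. ennreal (T m \<omega>)) \<partial>law)"
  proof (rule nn_integral_mono_AE)
    show "AE \<omega> in law. indicator {\<omega> \<in> space law. max_cusum M f (H n \<omega>) > ereal \<kappa>} \<omega>
        \<le> (\<Sum>m\<in>{1..M}. ennreal (T m \<omega>))"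
      using key
    proof eventually_elim
      fix \<omega> :: "nat \<Rightarrow> 'a \<times> (real^'n)"
      assume k: "max_cusum M f (H n \<omega>) > ereal \<kappa> \<longrightarrow> (\<exists>m\<in>{1..M}. T m \<omega> \<ge> 1)"
      show "indicator {\<omega> \<in> space law. max_cusum M f (H n \<omega>) > ereal \<kappa>} \<omega> \<le> (\<Sum>m\<in>{1..M}. ennreal (T m \<omega>))"
      proof (cases "max_cusum M f (H n \<omega>) > ereal \<kappa>")
        case True
        with k obtain m where m: "m \<in> {1..M}" "T m \<omega> \<ge> 1" by blast
        have "1 \<le> ennreal (T m \<omega>)" using ennreal_leI[OF m(2)] by simp
        also have "\<dots> \<le> (\<Sum>m\<in>{1..M}. ennreal (T m \<omega>))" using m by (intro member_le_sum) auto
        finally show ?thesis by (auto simp: indicator_def)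
      qed auto
    qed
  qed
  also have "\<dots> = (\<integral>\<^sup>+\<omega>. (\<Sum>m\<in>{1..M}. ennreal c * T1 m \<omega> + ennreal c * T2 m \<omega> + ennreal c' * T3 m \<omega>) \<partial>law)"
    by (intro nn_integral_cong sum.cong refl Teq)
  also have "\<dots> = (\<Sum>m\<in>{1..M}. \<integral>\<^sup>+\<omega>. ennreal c * T1 m \<omega> + ennreal c * T2 m \<omega> + ennreal c' * T3 m \<omega> \<partial>law)"
    by (rule nn_integral_sum)
      (intro borel_measurable_add borel_measurable_times_ennreal borel_measurable_const mT)
  also have "\<dots> \<le> (\<Sum>m\<in>{1..M}. ennreal (2 * c) * mean_decrease m k + ennreal c' * mean_decrease m n)"
  proof (rule sum_mono)
    fix m assume m: "m \<in> {1..M}"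
    then have mM: "m \<le> M" by simp
    have "(\<integral>\<^sup>+\<omega>. ennreal c * T1 m \<omega> + ennreal c * T2 m \<omega> + ennreal c' * T3 m \<omega> \<partial>law)
      = ennreal c * (\<integral>\<^sup>+\<omega>. T1 m \<omega> \<partial>law) + ennreal c * (\<integral>\<^sup>+\<omega>. T2 m \<omega> \<partial>law) + ennreal c' * (\<integral>\<^sup>+\<omega>. T3 m \<omega> \<partial>law)"
      using mT[OF m] by (simp add: nn_integral_add nn_integral_cmult)
    also have "(\<integral>\<^sup>+\<omega>. T2 m \<omega> \<partial>law) = mean_decrease m k" by (simp add: T2_def mean_decrease_def)
    also have "(\<integral>\<^sup>+\<omega>. T3 m \<omega> \<partial>law) = mean_decrease m n" by (simp add: T3_def mean_decrease_eq[OF mM])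
    also have "(\<integral>\<^sup>+\<omega>. T1 m \<omega> \<partial>law) = (\<integral>\<^sup>+\<omega>. ennreal (?w m k \<omega>) * ennreal (hellinger m (?a \<omega>) * (1 - hellinger m (?a \<omega>))) \<partial>law)"
      unfolding T1_def by (rule weighted_step[OF mM hellinger_nonneg[OF mM]])
    also have "ennreal c * \<dots> + ennreal c * mean_decrease m k + ennreal c' * mean_decrease m n
        \<le> ennreal c * mean_decrease m k + ennreal c * mean_decrease m k + ennreal c' * mean_decrease m n"
    proof -
      have "hellinger m a * (1 - hellinger m a) \<le> hellinger m a" for a
        using hellinger_nonneg[OF mM, of a] by (simp add: mult_left_le)
      then show ?thesis
        unfolding mean_decrease_def
        by (intro add_right_mono mult_left_mono nn_integral_mono ennreal_leI) auto
    qed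
    also have "\<dots> = ennreal (2 * c) * mean_decrease m k + ennreal c' * mean_decrease m n"
    proof -
      have "ennreal (2 * c) = ennreal c + ennreal c"
        using c by (subst ennreal_plus[symmetric]) auto
      then show ?thesis by (simp only: distrib_right)
    qed
    finally show "(\<integral>\<^sup>+\<omega>. ennreal c * T1 m \<omega> + ennreal c * T2 m \<omega> + ennreal c' * T3 m \<omega> \<partial>law)
      \<le> ennreal (2 * c) * mean_decrease m k + ennreal c' * mean_decrease m n" .
  qed
  finally show ?thesis by (simp add: c_def c'_def)
qed

lemma prob_high_nonneg: "0 \<le> prob_high \<kappa> n" by (simp add: prob_high_def)

lemma prob_high_le_1: "prob_high \<kappa> n \<le> 1"
  unfolding prob_high_def using prob_space.prob_le_1[OF prob_space_law] .

text \<open>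
  The first two times are bounded trivially, since the policy reacts to the statistics from time \<open>2\<close> on.
\<close>

lemma sum_prob_high_le:
  assumes \<Delta>: "\<Delta> > 0" and gap: "\<And>m a. m \<in> {1..M} \<Longrightarrow> hellinger m a > 0 \<Longrightarrow> hellinger m a \<ge> \<Delta>"
    and \<delta>: "0 < \<delta>"
    and reacts: "\<And>h. 2 \<le> length h \<Longrightarrow> max_cusum M f h > ereal \<kappa> \<Longrightarrow>
      \<exists>m\<in>{1..M}. mean_hellinger m h \<ge> \<delta> \<and> (\<forall>m'\<in>{1..M}. cusum f m' (tl h) \<le> cusum f m (tl h))"
  shows "(\<Sum>k<N. prob_high \<kappa> k) \<le> 2 + real M * ((2 / \<Delta> + 1 / \<delta>) / exp (\<kappa> / 2)) * (real N + 1)"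
proof -
  let ?K = "exp (\<kappa> / 2)"
  define c where "c = 2 / (\<Delta> * ?K)"
  define c' where "c' = 1 / (\<delta> * ?K)"
  have c: "c \<ge> 0" "c' \<ge> 0" using \<Delta> \<delta> by (auto simp: c_def c'_def)
  have total: "(\<Sum>k<N. mean_decrease m k) \<le> ennreal (real N + 1)" if "m \<in> {1..M}" for m
  proof -
    have "(\<Sum>k<N. mean_decrease m k) \<le> mean_sqrt_cusum m N + (\<Sum>k<N. mean_decrease m k)" by simp
    also have "\<dots> \<le> of_nat (Suc N)" by (rule sum_mean_decrease) (use that in simp)
    also have "\<dots> = ennreal (real N + 1)" by (simp add: ennreal_of_nat_eq_real_of_nat add.commute)
    finally show ?thesis .
  qed
  have "ennreal (\<Sum>k\<in>{2..<N}. prob_high \<kappa> k) = (\<Sum>k\<in>{2..<N}. ennreal (prob_high \<kappa> k))"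
    by (simp add: sum_ennreal prob_high_nonneg)
  also have "\<dots> \<le> (\<Sum>k\<in>{2..<N}. \<Sum>m\<in>{1..M}. ennreal c * mean_decrease m (k - 1) + ennreal c' * mean_decrease m k)"
    unfolding c_def c'_def
  proof (rule sum_mono)
    fix k assume "k \<in> {2..<N}"
    then show "ennreal (prob_high \<kappa> k) \<le> (\<Sum>m\<in>{1..M}. ennreal (2 / (\<Delta> * ?K)) * mean_decrease m (k - 1)
        + ennreal (1 / (\<delta> * ?K)) * mean_decrease m k)"
      by (intro prob_high_le[OF \<Delta> gap \<delta>] reacts) auto
  qed
  also have "\<dots> = (\<Sum>m\<in>{1..M}. \<Sum>k\<in>{2..<N}. ennreal c * mean_decrease m (k - 1) + ennreal c' * mean_decrease m k)"
    by (rule sum.swap)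
  also have "\<dots> \<le> (\<Sum>m\<in>{1..M}. ennreal ((c + c') * (real N + 1)))"
  proof (rule sum_mono)
    fix m assume m: "m \<in> {1..M}"
    have "(\<Sum>k\<in>{2..<N}. mean_decrease m (k - 1)) = (\<Sum>k\<in>(\<lambda>k. k - 1) ` {2..<N}. mean_decrease m k)"
      by (subst sum.reindex) (auto simp: inj_on_def)
    also have "\<dots> \<le> (\<Sum>k<N. mean_decrease m k)" by (rule sum_mono2) auto
    finally have 1: "(\<Sum>k\<in>{2..<N}. mean_decrease m (k - 1)) \<le> ennreal (real N + 1)"
      using total[OF m] by (rule order_trans)
    have "(\<Sum>k\<in>{2..<N}. mean_decrease m k) \<le> (\<Sum>k<N. mean_decrease m k)" by (rule sum_mono2) auto
    then have 2: "(\<Sum>k\<in>{2..<N}. mean_decrease m k) \<le> ennreal (real N + 1)"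
      using total[OF m] by (rule order_trans)
    have "(\<Sum>k\<in>{2..<N}. ennreal c * mean_decrease m (k - 1) + ennreal c' * mean_decrease m k)
        = ennreal c * (\<Sum>k\<in>{2..<N}. mean_decrease m (k - 1)) + ennreal c' * (\<Sum>k\<in>{2..<N}. mean_decrease m k)"
      by (simp add: sum.distrib sum_distrib_left)
    also have "\<dots> \<le> ennreal c * ennreal (real N + 1) + ennreal c' * ennreal (real N + 1)"
      by (intro add_mono mult_left_mono 1 2) auto
    also have "\<dots> = ennreal ((c + c') * (real N + 1))"
      using c by (simp add: distrib_right ennreal_plus ennreal_mult)
    finally show "(\<Sum>k\<in>{2..<N}. ennreal c * mean_decrease m (k - 1) + ennreal c' * mean_decrease m k)
        \<le> ennreal ((c + c') * (real N + 1))" .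
  qed
  also have "\<dots> = ennreal (real M * ((c + c') * (real N + 1)))"
    using c by (simp add: ennreal_mult ennreal_of_nat_eq_real_of_nat)
  finally have tail: "(\<Sum>k\<in>{2..<N}. prob_high \<kappa> k) \<le> real M * ((c + c') * (real N + 1))"
    using c by (subst (asm) ennreal_le_iff) auto
  have "(\<Sum>k<N. prob_high \<kappa> k) \<le> (\<Sum>k\<in>{0, 1} \<union> {2..<N}. prob_high \<kappa> k)"
    by (rule sum_mono2) (auto simp: prob_high_nonneg)
  also have "\<dots> = prob_high \<kappa> 0 + prob_high \<kappa> 1 + (\<Sum>k\<in>{2..<N}. prob_high \<kappa> k)"
    by (subst sum.union_disjoint) auto
  also have "\<dots> \<le> 2 + real M * ((c + c') * (real N + 1))"
    using tail prob_high_le_1[of \<kappa> 0] prob_high_le_1[of \<kappa> 1] by linarith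
  also have "c + c' = (2 / \<Delta> + 1 / \<delta>) / ?K"
    by (simp add: c_def c'_def add_divide_distrib)
  finally show ?thesis by (simp add: mult.assoc)
qed

end

section \<open>Long-run cost of a feasible open-loop policy\<close>

lemma pmf_draw_first_second:
  fixes \<pi> :: "'a::finite open_loop"
  shows "pmf (draw_first \<pi>) a * pmf (draw_second \<pi> a) b = pmf (fst \<pi>) (a, b)"
proof (cases "pmf (draw_first \<pi>) a = 0")
  case True
  have "pmf (fst \<pi>) (a, b) \<le> pmf (draw_first \<pi>) a"
    unfolding draw_first_def pmf_map by (auto simp flip: measure_pmf_single intro!: measure_pmf.finite_measure_mono)
  with True show ?thesis by (simp add: order_antisym)
next
  case False
  have m: "pmf (draw_first \<pi>) a = measure_pmf.prob (fst \<pi>) {\<alpha>. fst \<alpha> = a}"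
    by (simp add: draw_first_def pmf_map vimage_def)
  with False have ne: "set_pmf (fst \<pi>) \<inter> {\<alpha>. fst \<alpha> = a} \<noteq> {}"
    by (metis measure_pmf_zero_iff)
  have "pmf (draw_second \<pi> a) b = measure_pmf.prob (cond_pmf (fst \<pi>) {\<alpha>. fst \<alpha> = a}) (snd -` {b})"
    by (simp add: draw_second_def pmf_map)
  also have "\<dots> = measure_pmf.prob (cond_pmf (fst \<pi>) {\<alpha>. fst \<alpha> = a}) {(a, b)}"
    by (rule measure_prob_cong_0) (auto simp: pmf_cond[OF ne])
  also have "\<dots> = pmf (fst \<pi>) (a, b) / pmf (draw_first \<pi>) a"
    by (simp add: measure_pmf_single pmf_cond[OF ne] m)
  finally show ?thesis using False by simp
qed

lemma sum_draw_next:
  fixes \<pi> :: "'a::finite open_loop"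
  assumes "is_open_loop \<pi>"
  shows "(\<Sum>b\<in>UNIV. pmf (draw_next \<pi> \<alpha>) b * f (snd \<alpha>, b)) = step_mean (snd \<pi>) f \<alpha>"
proof -
  have pm: "pmf (draw_next \<pi> \<alpha>) b = pmf (snd \<pi> \<alpha>) (snd \<alpha>, b)" for b
  proof -
    have "pmf (draw_next \<pi> \<alpha>) b = measure_pmf.prob (snd \<pi> \<alpha>) (snd -` {b})"
      by (simp add: draw_next_def pmf_map)
    also have "\<dots> = measure_pmf.prob (snd \<pi> \<alpha>) {(snd \<alpha>, b)}"
    proof (rule measure_prob_cong_0)
      fix x assume x: "x \<in> snd -` {b} - {(snd \<alpha>, b)}"
      have "x \<notin> set_pmf (snd \<pi> \<alpha>)"
      proof
        assume "x \<in> set_pmf (snd \<pi> \<alpha>)"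
        then have "fst x = snd \<alpha>" using assms unfolding is_open_loop_def by blast
        with x show False by (cases x) auto
      qed
      then show "pmf (snd \<pi> \<alpha>) x = 0" by (simp add: set_pmf_iff)
    qed auto
    finally show ?thesis by (simp add: measure_pmf_single)
  qed
  have "step_mean (snd \<pi>) f \<alpha> = (\<Sum>a\<in>UNIV. \<Sum>b\<in>UNIV. pmf (snd \<pi> \<alpha>) (a, b) * f (a, b))"
    unfolding step_mean_def UNIV_Times_UNIV[symmetric] by (simp add: sum.cartesian_product)
  also have "\<dots> = (\<Sum>a\<in>UNIV. if a = snd \<alpha> then (\<Sum>b\<in>UNIV. pmf (snd \<pi> \<alpha>) (a, b) * f (a, b)) else 0)"
  proof (intro sum.cong refl)
    fix a
    have "pmf (snd \<pi> \<alpha>) (a, b) = 0" if "a \<noteq> snd \<alpha>" for b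
    proof (rule ccontr)
      assume "pmf (snd \<pi> \<alpha>) (a, b) \<noteq> 0"
      then have "(a, b) \<in> set_pmf (snd \<pi> \<alpha>)" by (simp add: set_pmf_iff)
      then have "fst (a, b) = snd \<alpha>" using assms unfolding is_open_loop_def by blast
      with that show False by simp
    qed
    then show "(\<Sum>b\<in>UNIV. pmf (snd \<pi> \<alpha>) (a, b) * f (a, b))
        = (if a = snd \<alpha> then (\<Sum>b\<in>UNIV. pmf (snd \<pi> \<alpha>) (a, b) * f (a, b)) else 0)" by simp
  qed
  also have "\<dots> = (\<Sum>b\<in>UNIV. pmf (draw_next \<pi> \<alpha>) b * f (snd \<alpha>, b))"
    by (simp add: pm)
  finally show ?thesis by simp
qed

definition visited :: "'a open_loop \<Rightarrow> ('a \<times> 'a) set" where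
  "visited \<pi> = {\<beta>. \<exists>\<alpha>\<in>set_pmf (fst \<pi>). reachable (snd \<pi>) \<alpha> \<beta>}"

lemma initial_visited: "\<alpha> \<in> set_pmf (fst \<pi>) \<Longrightarrow> \<alpha> \<in> visited \<pi>"
  unfolding visited_def reachable_def by blast

context controlled_process begin

definition pair_at :: "nat \<Rightarrow> (nat \<Rightarrow> 'a \<times> (real^'n)) \<Rightarrow> 'a \<times> 'a" where
  "pair_at n \<omega> = (fst (\<omega> n), fst (\<omega> (Suc n)))"

lemma measurable_pair_at: "(\<lambda>\<omega>. u (pair_at n \<omega>)) \<in> borel_measurable law" for u :: "'a \<times> 'a \<Rightarrow> real"
proof -
  have "(\<lambda>\<omega>. (\<Sum>a\<in>UNIV. \<Sum>b\<in>UNIV. u (a, b) * (of_bool (fst (\<omega> n) = a) * of_bool (fst (\<omega> (Suc n)) = b)))) \<in> borel_measurable law"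
    by (intro borel_measurable_sum borel_measurable_times borel_measurable_const
        measurable_act_real[of "\<lambda>x. of_bool (x = _)"])
  moreover have "(\<Sum>a\<in>UNIV. \<Sum>b\<in>UNIV. u (a, b) * (of_bool (x = a) * of_bool (y = b))) = u (x, y)" for x y
  proof -
    have "(\<Sum>a\<in>UNIV. \<Sum>b\<in>UNIV. u (a, b) * (of_bool (x = a) * of_bool (y = b)))
       = (\<Sum>a\<in>UNIV. if x = a then (\<Sum>b\<in>UNIV. if y = b then u (a, b) else 0) else 0)"
      by (intro sum.cong refl) (auto intro!: sum.cong)
    then show ?thesis by simp
  qed
  ultimately show ?thesis by (simp add: pair_at_def)
qed

lemma integrable_pair_at: "integrable law (\<lambda>\<omega>. u (pair_at n \<omega>))" for u :: "'a \<times> 'a \<Rightarrow> real"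
proof -
  obtain K where "\<And>x. \<bar>u x\<bar> \<le> K" using finite_bound[of u] by blast
  then show ?thesis by (intro integrable_bounded_law[of _ K] measurable_pair_at)
qed

lemma AOSC_eq: "AOSC p0 obs C \<pi> = limsup (\<lambda>N. ereal (1 / real N * (\<Sum>n<N. \<integral>\<omega>. C (fst (pair_at n \<omega>)) (snd (pair_at n \<omega>)) \<partial>law)))"
proof -
  have "(\<integral>\<omega>. (\<Sum>t = 2..N + 1. C (act \<omega> (t - 1)) (act \<omega> t)) \<partial>law)
      = (\<Sum>n<N. \<integral>\<omega>. C (fst (pair_at n \<omega>)) (snd (pair_at n \<omega>)) \<partial>law)" for N
  proof -
    have "(\<Sum>t = 2..N + 1. C (act \<omega> (t - 1)) (act \<omega> t)) = (\<Sum>n<N. C (fst (pair_at n \<omega>)) (snd (pair_at n \<omega>)))"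
      for \<omega> :: "nat \<Rightarrow> 'a \<times> (real^'n)"
      by (rule sum.reindex_bij_witness[of _ "\<lambda>n. n + 2" "\<lambda>t. t - 2"])
        (auto simp: pair_at_def act_def Suc_diff_Suc numeral_2_eq_2 Suc_diff_le le_Suc_eq)
    then show ?thesis
      using integrable_pair_at[of "\<lambda>z. C (fst z) (snd z)"] by (simp add: Bochner_Integration.integral_sum)
  qed
  then show ?thesis by (simp add: AOSC_def)
qed

end

locale open_loop_process = controlled_process p0 obs "open_loop_policy \<pi>\<^sub>d"
  for p0 :: "real^'n \<Rightarrow> real" and obs :: "'a::finite \<Rightarrow> real^'n \<Rightarrow> 'y" and \<pi>\<^sub>d :: "'a open_loop" +
  assumes open_loop: "is_open_loop \<pi>\<^sub>d"
begin

definition init_mean :: "('a \<times> 'a \<Rightarrow> real) \<Rightarrow> real" where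
  "init_mean u = (\<Sum>\<alpha>\<in>UNIV. pmf (fst \<pi>\<^sub>d) \<alpha> * u \<alpha>)"

lemma expectation_pair_0: "(\<integral>\<omega>. u (pair_at 0 \<omega>) \<partial>law) = init_mean u"
proof -
  interpret L: prob_space law by (rule prob_space_law)
  obtain K where K: "\<And>x. \<bar>u x\<bar> \<le> K" using finite_bound[of u] by blast
  define v where "v a = (\<Sum>b\<in>UNIV. pmf (draw_second \<pi>\<^sub>d a) b * u (a, b))" for a
  obtain K' where K': "\<And>x. \<bar>v x\<bar> \<le> K'" using finite_bound[of v] by blast
  have m: "adapted (Suc 0) borel (\<lambda>h. u (fst (hd h), b))" for b
    using adapted_hd[of 0] unfolding adapted_def by (rule measurable_compose) simp
  have "(\<integral>\<omega>. u (pair_at 0 \<omega>) \<partial>law) = (\<integral>\<omega>. v (fst (\<omega> 0)) \<partial>law)"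
    using expectation_one_step[of "Suc 0" "\<lambda>h b. u (fst (hd h), b)", OF m K]
    by (simp add: pair_at_def v_def)
  also have "\<dots> = (\<integral>\<omega>. (\<Sum>a\<in>UNIV. pmf (draw_first \<pi>\<^sub>d) a * v a) \<partial>law)"
    using expectation_one_step[of 0 "\<lambda>h. v" K'] K' by (simp add: adapted_def)
  also have "\<dots> = (\<Sum>a\<in>UNIV. pmf (draw_first \<pi>\<^sub>d) a * v a)" using L.prob_space by simp
  also have "\<dots> = (\<Sum>a\<in>UNIV. \<Sum>b\<in>UNIV. pmf (fst \<pi>\<^sub>d) (a, b) * u (a, b))"
    by (simp add: v_def sum_distrib_left pmf_draw_first_second flip: mult.assoc)
  also have "\<dots> = init_mean u"
    unfolding init_mean_def UNIV_Times_UNIV[symmetric] by (simp add: sum.cartesian_product)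
  finally show ?thesis .
qed

lemma expectation_pair_Suc: "(\<integral>\<omega>. u (pair_at (Suc n) \<omega>) \<partial>law) = (\<integral>\<omega>. step_mean (snd \<pi>\<^sub>d) u (pair_at n \<omega>) \<partial>law)"
proof -
  obtain K where K: "\<And>x. \<bar>u x\<bar> \<le> K" using finite_bound[of u] by blast
  have m: "adapted (Suc (Suc n)) borel (\<lambda>h. u (fst (hd h), b))" for b
    using adapted_hd[of "Suc n"] unfolding adapted_def by (rule measurable_compose) simp
  show ?thesis
    using expectation_one_step[of "Suc (Suc n)" "\<lambda>h b. u (fst (hd h), b)", OF m K]
    by (simp add: pair_at_def flip: sum_draw_next[OF open_loop])
qed

lemma expectation_harmonic:
  assumes "harmonic (snd \<pi>\<^sub>d) g" shows "(\<integral>\<omega>. g (pair_at n \<omega>) \<partial>law) = init_mean g"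
proof (induction n)
  case (Suc n)
  have "step_mean (snd \<pi>\<^sub>d) g = g" using assms by (auto simp: harmonic_def)
  with Suc show ?case by (simp add: expectation_pair_Suc)
qed (rule expectation_pair_0)

text \<open>
  In the Poisson equation, \<open>g\<close> contributes its initial mean at each time, and \<open>h\<close> telescopes.
\<close>

lemma cesaro_limit:
  assumes g: "harmonic (snd \<pi>\<^sub>d) g" and f: "\<And>x. f x = g x + h x - step_mean (snd \<pi>\<^sub>d) h x"
  shows "(\<lambda>N. 1 / real N * (\<Sum>n<N. \<integral>\<omega>. f (pair_at n \<omega>) \<partial>law)) \<longlonglongrightarrow> init_mean g"
proof -
  interpret L: prob_space law by (rule prob_space_law)
  define e where "e n = (\<integral>\<omega>. h (pair_at n \<omega>) \<partial>law)" for n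
  obtain K where K: "0 \<le> K" "\<And>x. \<bar>h x\<bar> \<le> K" using finite_bound[of h] by blast
  have eK: "\<bar>e n\<bar> \<le> K" for n
  proof -
    have "\<bar>e n\<bar> \<le> (\<integral>\<omega>. \<bar>h (pair_at n \<omega>)\<bar> \<partial>law)" unfolding e_def by (rule integral_abs_bound)
    also have "\<dots> \<le> (\<integral>\<omega>. K \<partial>law)"
      by (rule integral_mono) (use K integrable_pair_at[of "\<lambda>x. \<bar>h x\<bar>"] in auto)
    finally show ?thesis using L.prob_space by simp
  qed
  have one: "(\<integral>\<omega>. f (pair_at n \<omega>) \<partial>law) = init_mean g + e n - e (Suc n)" for n
    unfolding f e_def expectation_pair_Suc
    using expectation_harmonic[OF g, of n] integrable_pair_at[of _ n] by simp
  have sum: "(\<Sum>n<N. \<integral>\<omega>. f (pair_at n \<omega>) \<partial>law) = real N * init_mean g + (e 0 - e N)" for N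
    unfolding one by (induction N) (simp_all add: algebra_simps)
  have "(\<lambda>N. (e 0 - e N) / real N) \<longlonglongrightarrow> 0"
  proof (rule Lim_null_comparison)
    show "\<forall>\<^sub>F N in sequentially. norm ((e 0 - e N) / real N) \<le> 2 * K / real N"
    proof (intro always_eventually allI)
      fix N
      have "\<bar>e 0 - e N\<bar> \<le> 2 * K" using eK[of 0] eK[of N] by linarith
      then show "norm ((e 0 - e N) / real N) \<le> 2 * K / real N" by (simp add: divide_right_mono)
    qed
    show "(\<lambda>N. 2 * K / real N) \<longlonglongrightarrow> 0" by (rule lim_const_over_n)
  qed
  then have "(\<lambda>N. init_mean g + (e 0 - e N) / real N) \<longlonglongrightarrow> init_mean g + 0"
    by (intro tendsto_intros)
  moreover have "\<forall>\<^sub>F N in sequentially. init_mean g + (e 0 - e N) / real N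
      = 1 / real N * (\<Sum>n<N. \<integral>\<omega>. f (pair_at n \<omega>) \<partial>law)"
    using eventually_gt_at_top[of 0]
    by eventually_elim (simp add: sum field_simps)
  ultimately show ?thesis by (simp add: Lim_transform_eventually)
qed

lemma qbar_eq:
  assumes "harmonic (snd \<pi>\<^sub>d) g" "\<And>x. indicator {\<alpha>} x = g x + h x - step_mean (snd \<pi>\<^sub>d) h x"
  shows "qbar p0 obs \<pi>\<^sub>d \<alpha> = init_mean g"
proof -
  have eq: "(\<integral>\<omega>. 1 / real t * (\<Sum>j = 1..t. indicator {\<alpha>} (act \<omega> j, act \<omega> (j + 1))) \<partial>law)
     = 1 / real t * (\<Sum>n<t. \<integral>\<omega>. indicator {\<alpha>} (pair_at n \<omega>) \<partial>law)" for t
  proof -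
    have "(\<Sum>j = 1..t. indicator {\<alpha>} (act \<omega> j, act \<omega> (j + 1))) = (\<Sum>n<t. indicator {\<alpha>} (pair_at n \<omega>) :: real)"
      for \<omega> :: "nat \<Rightarrow> 'a \<times> (real^'n)"
      by (rule sum.reindex_bij_witness[of _ "\<lambda>n. n + 1" "\<lambda>t. t - 1"]) (auto simp: pair_at_def act_def)
    then show ?thesis
      using integrable_pair_at[of "indicator {\<alpha>}"] by (simp add: Bochner_Integration.integral_sum)
  qed
  show ?thesis
    unfolding qbar_def eq by (rule limI[OF cesaro_limit[OF assms]])
qed

lemma init_mean_eq_0:
  assumes "init_mean g = 0" "\<And>x. g x \<ge> 0" "\<alpha> \<in> set_pmf (fst \<pi>\<^sub>d)"
  shows "g \<alpha> = 0"
proof -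
  have "\<forall>x\<in>UNIV. pmf (fst \<pi>\<^sub>d) x * g x = 0"
    by (rule iffD1[OF sum_nonneg_eq_0_iff]) (use assms(1,2) in \<open>auto simp: init_mean_def\<close>)
  then have "pmf (fst \<pi>\<^sub>d) \<alpha> * g \<alpha> = 0" by blast
  with assms(3) show ?thesis by (simp add: set_pmf_iff)
qed

text \<open>
  Let \<open>G\<close> be the harmonic part of the indicator of the complement of \<open>R\<close>. Its initial mean is the long-run
  fraction of time outside of \<open>R\<close>, which is \<open>0\<close>; so the nonnegative \<open>G\<close> vanishes on all visited states. On
  \<open>R\<close>, the harmonic part \<open>g\<close> of the cost is a constant \<open>g r\<close>, so that \<open>\<bar>g - g r\<bar>\<close> is at most a multiple of that
  indicator; passing to harmonic parts, it is at most the same multiple of \<open>G\<close>. Hence \<open>g = g r\<close> on all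
  visited states, transient ones included, and this constant is the long-run cost.
\<close>

lemma feasible_poisson:
  assumes feas: "feasible p0 obs C \<alpha> \<pi>\<^sub>d"
  obtains g h where "\<And>x. C (fst x) (snd x) = g x + h x - step_mean (snd \<pi>\<^sub>d) h x"
    "\<And>x. x \<in> visited \<pi>\<^sub>d \<Longrightarrow> g x \<le> \<alpha>"
proof -
  let ?T = "snd \<pi>\<^sub>d"
  obtain R where R: "recurrence_class ?T R" "\<And>\<beta>. qbar p0 obs \<pi>\<^sub>d \<beta> \<noteq> 0 \<Longrightarrow> \<beta> \<in> R"
    using feas unfolding feasible_def by auto
  obtain r where r: "r \<in> R" using R(1) unfolding recurrence_class_def reachable_def by blast
  obtain g h where g: "harmonic ?T g" and gh: "\<And>x. C (fst x) (snd x) = g x + h x - step_mean ?T h x"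
    using poisson_equation[of ?T "\<lambda>x. C (fst x) (snd x)"] by blast
  obtain G Hh where G: "harmonic ?T G" and GH: "\<And>x. indicator (- R) x = G x + Hh x - step_mean ?T Hh x"
    using poisson_equation[of ?T "indicator (- R)"] by blast
  have G0: "G x \<ge> 0" for x
    by (rule poisson_nonneg[OF GH G]) simp
  have "init_mean G = 0"
  proof -
    have "(\<lambda>N. 1 / real N * (\<Sum>n<N. \<integral>\<omega>. indicator {\<beta>} (pair_at n \<omega>) \<partial>law)) \<longlonglongrightarrow> 0" if "\<beta> \<notin> R" for \<beta>
    proof -
      obtain g' h' where g': "harmonic ?T g'" "\<And>x. indicator {\<beta>} x = g' x + h' x - step_mean ?T h' x"
        using poisson_equation[of ?T "indicator {\<beta>}"] by blast
      have "init_mean g' = 0" using qbar_eq[OF g'] R(2)[of \<beta>] that by auto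
      with cesaro_limit[OF g'] show ?thesis by (simp only:)
    qed
    then have "(\<lambda>N. \<Sum>\<beta>\<in>-R. 1 / real N * (\<Sum>n<N. \<integral>\<omega>. indicator {\<beta>} (pair_at n \<omega>) \<partial>law)) \<longlonglongrightarrow> (\<Sum>\<beta>\<in>-R. 0)"
      by (intro tendsto_sum) auto
    moreover have "(\<Sum>\<beta>\<in>-R. 1 / real N * (\<Sum>n<N. \<integral>\<omega>. indicator {\<beta>} (pair_at n \<omega>) \<partial>law))
       = 1 / real N * (\<Sum>n<N. \<integral>\<omega>. indicator (- R) (pair_at n \<omega>) \<partial>law)" for N
    proof -
      have "(\<integral>\<omega>. indicator (- R) (pair_at n \<omega>) \<partial>law) = (\<Sum>\<beta>\<in>-R. \<integral>\<omega>. indicator {\<beta>} (pair_at n \<omega>) \<partial>law :: real)" for n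
      proof -
        have "(indicator (- R) x :: real) = (\<Sum>\<beta>\<in>-R. indicator {\<beta>} x)" for x
          by (simp add: indicator_def of_bool_def sum.delta')
        then show ?thesis
          using integrable_pair_at[of "indicator {_}"] by (simp add: Bochner_Integration.integral_sum)
      qed
      then show ?thesis by (simp add: sum_distrib_left sum.swap[of _ "-R"])
    qed
    ultimately have "(\<lambda>N. 1 / real N * (\<Sum>n<N. \<integral>\<omega>. indicator (- R) (pair_at n \<omega>) \<partial>law)) \<longlonglongrightarrow> 0" by simp
    with cesaro_limit[OF G GH] show ?thesis by (rule LIMSEQ_unique)
  qed
  then have G_visited: "G x = 0" if "x \<in> visited \<pi>\<^sub>d" for x
    using that init_mean_eq_0[of G] G0 harmonic_zero_reachable[OF G G0]
    unfolding visited_def reachable_def by blast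
  have const: "g x = g r" if "x \<in> visited \<pi>\<^sub>d" for x
  proof -
    obtain B where B: "0 \<le> B" "\<And>x. \<bar>g x - g r\<bar> \<le> B" using finite_bound[of "\<lambda>x. g x - g r"] by blast
    have bd: "\<bar>g x - g r\<bar> \<le> B * indicator (- R) x" for x
      using B(2)[of x] harmonic_constant_on_class[OF R(1) g _ r, of x] by (cases "x \<in> R") auto
    have "B * G x + s * (g x - g r) \<ge> 0" if s: "s = 1 \<or> s = -1" for s
    proof (rule poisson_nonneg[where f="\<lambda>x. B * indicator (- R) x + s * (g x - g r)"
          and g="\<lambda>x. B * G x + s * (g x - g r)" and h="\<lambda>x. B * Hh x" and T="?T"])
      show "harmonic ?T (\<lambda>x. B * G x + s * (g x - g r))"
        using g G unfolding harmonic_def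
        by (simp add: step_mean_add step_mean_cmult step_mean_diff step_mean_const)
      show "B * indicator (- R) x + s * (g x - g r) = B * G x + s * (g x - g r) + B * Hh x - step_mean ?T (\<lambda>x. B * Hh x) x" for x
        unfolding GH step_mean_cmult by (simp add: algebra_simps)
      show "0 \<le> B * indicator (- R) x + s * (g x - g r)" for x
        using bd[of x] s by auto
    qed
    from this[of 1] this[of "-1"] show ?thesis using G_visited[OF that] by simp
  qed
  have "init_mean g = g r"
  proof -
    have "init_mean g = (\<Sum>x\<in>UNIV. pmf (fst \<pi>\<^sub>d) x * g r)"
      unfolding init_mean_def
    proof (intro sum.cong refl)
      fix x
      show "pmf (fst \<pi>\<^sub>d) x * g x = pmf (fst \<pi>\<^sub>d) x * g r"
        using const[OF initial_visited, of x] by (cases "pmf (fst \<pi>\<^sub>d) x = 0") (auto simp: set_pmf_iff)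
    qed
    then show ?thesis by (simp add: sum_pmf_UNIV flip: sum_distrib_right)
  qed
  with cesaro_limit[OF g gh]
  have "(\<lambda>N. ereal (1 / real N * (\<Sum>n<N. \<integral>\<omega>. C (fst (pair_at n \<omega>)) (snd (pair_at n \<omega>)) \<partial>law))) \<longlonglongrightarrow> ereal (g r)"
    by simp
  then have "AOSC p0 obs C (open_loop_policy \<pi>\<^sub>d) = ereal (g r)"
    unfolding AOSC_eq by (intro lim_imp_Limsup) auto
  then have "g r \<le> \<alpha>" using feas by (simp add: feasible_def)
  with const have "\<And>x. x \<in> visited \<pi>\<^sub>d \<Longrightarrow> g x \<le> \<alpha>" by simp
  with gh show thesis by (rule that)
qed

end

section \<open>Long-run cost of the two-threshold policy\<close>

locale two_threshold = cusum_model M p obs \<nu> f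
  for M :: nat and p :: "nat \<Rightarrow> real^'n \<Rightarrow> real" and obs :: "'a::finite \<Rightarrow> real^'n \<Rightarrow> 'y"
    and \<nu> :: "'a \<Rightarrow> 'y measure" and f :: "nat \<Rightarrow> 'a \<Rightarrow> 'y \<Rightarrow> real" +
  fixes Astar :: "nat \<Rightarrow> 'a" and tie :: "nat set \<Rightarrow> nat" and \<pi>\<^sub>d :: "'a open_loop" and \<kappa> b :: real
  assumes Astar: "\<And>m. m \<in> {1..M} \<Longrightarrow> is_arg_max (KL_action \<nu> f m) (\<lambda>a. True) (Astar m)"
    and tie: "\<And>B. B \<subseteq> {1..M} \<Longrightarrow> B \<noteq> {} \<Longrightarrow> tie B \<in> B"
    and open_loop: "is_open_loop \<pi>\<^sub>d"
    and \<kappa>_nonneg: "0 \<le> \<kappa>"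
begin

abbreviation policy :: "('a, 'y) policy" where
  "policy \<equiv> two_threshold_policy M f Astar tie \<pi>\<^sub>d \<kappa> b"

sublocale cusum_process M p obs \<nu> f policy
  by (rule cusum_process.intro[OF cusum_model_axioms])
    (rule cusum_process_axioms.intro, rule Ionescu_Tulcea_two_threshold[OF model])

abbreviation S :: "('a, 'y) history \<Rightarrow> ereal" where
  "S \<equiv> max_cusum M f"

lemma S_Nil: "S [] \<le> ereal \<kappa>"
  using max_cusum_gr_iff[of "ereal \<kappa>" "[]"] \<kappa>_nonneg by (auto simp: not_less[symmetric])

text \<open>
  Above \<open>\<kappa>\<close>, the next action is either preferred against the leading statistic of the preceding time or
  uniform on all actions, so that the preferred action has probability at least \<open>1 / CARD('a)\<close> in both cases.
\<close>

lemma reacts_to_leader: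
  assumes gap: "\<And>m a. m \<in> {1..M} \<Longrightarrow> hellinger m a > 0 \<Longrightarrow> hellinger m a \<ge> \<Delta>" and \<Delta>: "\<Delta> > 0"
    and h: "2 \<le> length h" and S: "S h > ereal \<kappa>"
  shows "\<exists>m\<in>{1..M}. mean_hellinger m h \<ge> \<Delta> / CARD('a) \<and> (\<forall>m'\<in>{1..M}. cusum f m' (tl h) \<le> cusum f m (tl h))"
proof -
  obtain a y a' y' h' where hh: "h = (a, y) # (a', y') # h'"
    using h by (metis (no_types, opaque_lifting) Suc_le_length_iff numeral_2_eq_2 surj_pair)
  define B where "B = {m. is_arg_max (\<lambda>m. cusum f m (tl h)) (\<lambda>m. m \<in> {1..M}) m}"
  have B_iff: "m \<in> B \<longleftrightarrow> m \<in> {1..M} \<and> (\<forall>m'\<in>{1..M}. cusum f m' (tl h) \<le> cusum f m (tl h))" for m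
    unfolding B_def is_arg_max_linorder by auto
  have "Max ((\<lambda>m. cusum f m (tl h)) ` {1..M}) \<in> (\<lambda>m. cusum f m (tl h)) ` {1..M}"
    using M_pos by (intro Max_in) auto
  then obtain m0 where "m0 \<in> {1..M}" "cusum f m0 (tl h) = Max ((\<lambda>m. cusum f m (tl h)) ` {1..M})" by auto
  then have m0: "m0 \<in> B" unfolding B_iff by auto
  have mB: "tie B \<in> B"
  proof (rule tie)
    show "B \<subseteq> {1..M}" using B_iff by blast
    show "B \<noteq> {}" using m0 by blast
  qed
  define m where "m = tie B"
  have m: "m \<in> {1..M}" "\<forall>m'\<in>{1..M}. cusum f m' (tl h) \<le> cusum f m (tl h)"
    using mB unfolding m_def B_iff by auto
  have l: "hellinger m (Astar m) \<ge> \<Delta>"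
    by (rule gap[OF m(1) hellinger_pos_of_max_KL[OF m(1) Astar[OF m(1)]]])
  have "policy h = pmf_of_set UNIV \<or> policy h = return_pmf (Astar m)"
    using S unfolding hh m_def B_def by (auto simp: Let_def)
  then have "mean_hellinger m h \<ge> \<Delta> / CARD('a)"
  proof
    assume p: "policy h = pmf_of_set UNIV"
    have "\<Delta> / CARD('a) \<le> pmf (policy h) (Astar m) * hellinger m (Astar m)"
      using l by (simp add: p divide_right_mono)
    also have "\<dots> \<le> mean_hellinger m h"
      unfolding mean_hellinger_def using hellinger_nonneg[of m] m(1)
      by (intro member_le_sum[where f="\<lambda>a. pmf (policy h) a * hellinger m a"]) auto
    finally show ?thesis .
  next
    assume p: "policy h = return_pmf (Astar m)"
    have "\<Delta> / CARD('a) \<le> \<Delta> / 1"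
      using \<Delta> by (intro divide_left_mono) (auto simp: Suc_le_eq)
    also have "\<dots> \<le> hellinger m (Astar m)" using l by simp
    also have "\<dots> = pmf (policy h) (Astar m) * hellinger m (Astar m)" by (simp add: p)
    also have "\<dots> \<le> mean_hellinger m h"
      unfolding mean_hellinger_def using hellinger_nonneg[of m] m(1)
      by (intro member_le_sum[where f="\<lambda>a. pmf (policy h) a * hellinger m a"]) auto
    finally show ?thesis .
  qed
  with m show ?thesis by blast
qed

lemma policy_low:
  assumes "S (H (Suc (Suc k)) \<omega>) \<le> ereal \<kappa>"
  shows "policy (H (Suc (Suc k)) \<omega>) =
    (if S (H (Suc k) \<omega>) > ereal \<kappa> then draw_first \<pi>\<^sub>d
     else if S (H k \<omega>) > ereal \<kappa> then draw_second \<pi>\<^sub>d (fst (\<omega> (Suc k)))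
     else draw_next \<pi>\<^sub>d (pair_at k \<omega>))"
  using assms by (simp add: pair_at_def)

lemma draw_second_visited:
  assumes "a \<in> set_pmf (draw_first \<pi>\<^sub>d)" "a' \<in> set_pmf (draw_second \<pi>\<^sub>d a)"
  shows "(a, a') \<in> visited \<pi>\<^sub>d"
proof (rule initial_visited)
  have "pmf (draw_first \<pi>\<^sub>d) a * pmf (draw_second \<pi>\<^sub>d a) a' \<noteq> 0"
    using assms by (simp add: set_pmf_iff)
  then show "(a, a') \<in> set_pmf (fst \<pi>\<^sub>d)"
    unfolding pmf_draw_first_second by (simp add: set_pmf_iff)
qed

lemma draw_next_visited:
  assumes "\<alpha> \<in> visited \<pi>\<^sub>d" "a' \<in> set_pmf (draw_next \<pi>\<^sub>d \<alpha>)"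
  shows "(snd \<alpha>, a') \<in> visited \<pi>\<^sub>d"
proof -
  obtain \<beta> where \<beta>: "\<beta> \<in> set_pmf (snd \<pi>\<^sub>d \<alpha>)" "snd \<beta> = a'"
    using assms(2) by (auto simp: draw_next_def)
  have "fst \<beta> = snd \<alpha>" using open_loop \<beta>(1) unfolding is_open_loop_def by blast
  then have "\<beta> = (snd \<alpha>, a')" using \<beta>(2) by (simp add: prod_eq_iff)
  then show ?thesis
    using assms(1) \<beta>(1) unfolding visited_def reachable_def by (blast intro: rtranclp.rtrancl_into_rtrancl)
qed

text \<open>
  If two successive actions were both chosen below \<open>\<kappa>\<close>, then they were drawn in the same run of the open-loop
  policy: the second action was not the start of a new run, because the statistic had not been above
  \<open>\<kappa>\<close> just before.
\<close>

lemma pair_visited: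
  assumes supp: "\<forall>n. fst (\<omega> n) \<in> set_pmf (policy (H n \<omega>))"
    and "S (H (Suc n) \<omega>) \<le> ereal \<kappa>" "S (H n \<omega>) \<le> ereal \<kappa>"
  shows "pair_at n \<omega> \<in> visited \<pi>\<^sub>d"
  using assms(2,3)
proof (induction n)
  case 0
  have "fst (\<omega> 0) \<in> set_pmf (draw_first \<pi>\<^sub>d)" "fst (\<omega> (Suc 0)) \<in> set_pmf (draw_second \<pi>\<^sub>d (fst (\<omega> 0)))"
    using supp[rule_format, of 0] supp[rule_format, of "Suc 0"] by simp_all
  then show ?case unfolding pair_at_def by (rule draw_second_visited)
next
  case (Suc k)
  have next_act: "fst (\<omega> (Suc (Suc k))) \<in> set_pmf (policy (H (Suc (Suc k)) \<omega>))"
    using supp by blast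
  have pol: "policy (H (Suc (Suc k)) \<omega>) =
    (if S (H k \<omega>) > ereal \<kappa> then draw_second \<pi>\<^sub>d (fst (\<omega> (Suc k))) else draw_next \<pi>\<^sub>d (pair_at k \<omega>))"
    using policy_low[OF Suc.prems(1)] Suc.prems(2) by (simp only: not_less[symmetric] if_False)
  show ?case
  proof (cases "S (H k \<omega>) > ereal \<kappa>")
    case True
    obtain j where k: "k = Suc j"
      using True S_Nil by (cases k) auto
    have "fst (\<omega> (Suc k)) \<in> set_pmf (policy (H (Suc k) \<omega>))" using supp by blast
    also have "policy (H (Suc k) \<omega>) = draw_first \<pi>\<^sub>d"
      using policy_low[where k=j and \<omega>=\<omega>] Suc.prems(2) True unfolding k by (simp only: if_True)
    finally show ?thesis
      using next_act True unfolding pol pair_at_def by (intro draw_second_visited) (simp_all only: if_True)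
  next
    case False
    then have "pair_at k \<omega> \<in> visited \<pi>\<^sub>d" by (intro Suc.IH Suc.prems) simp
    from draw_next_visited[OF this] next_act False show ?thesis
      unfolding pol pair_at_def by (simp only: if_False snd_conv)
  qed
qed

text \<open>
  The last two actions were drawn in the same run of the open-loop policy, which continues with the next
  action.
\<close>

definition calm :: "('a, 'y) history \<Rightarrow> bool" where
  "calm h \<longleftrightarrow> S h \<le> ereal \<kappa> \<and> S (tl h) \<le> ereal \<kappa> \<and> S (tl (tl h)) \<le> ereal \<kappa>"

text \<open>
  On calm histories the next action follows the open-loop chain from a visited state, where the Poisson
  equation and \<open>g \<le> \<alpha>\<close> bound the cost; on the others all terms are bounded by constants.
\<close>

lemma cost_step:
  assumes poisson: "\<And>x. c x = g x + h x - step_mean (snd \<pi>\<^sub>d) h x"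
    and g: "\<And>x. x \<in> visited \<pi>\<^sub>d \<Longrightarrow> g x \<le> \<alpha>"
    and c: "\<And>x. \<bar>c x\<bar> \<le> Kc" and h: "\<And>x. \<bar>h x\<bar> \<le> Kh"
  shows "(\<integral>\<omega>. c (pair_at n \<omega>) \<partial>law) \<le> \<alpha> + (\<integral>\<omega>. h (pair_at n \<omega>) \<partial>law) - (\<integral>\<omega>. h (pair_at (Suc n) \<omega>) \<partial>law)
     + (Kc + 2 * Kh + \<bar>\<alpha>\<bar>) * (prob_high \<kappa> n + prob_high \<kappa> (Suc n) + prob_high \<kappa> (Suc (Suc n)))"
proof -
  interpret prob_space law by (rule prob_space_law)
  let ?T = "snd \<pi>\<^sub>d" and ?N = "Suc (Suc n)"
  define B where "B = Kc + 2 * Kh + \<bar>\<alpha>\<bar>"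
  have B0: "B \<ge> 0" unfolding B_def using c[of undefined] h[of undefined] by linarith
  define V :: "(nat \<Rightarrow> 'a \<times> (real^'n)) \<Rightarrow> real" where "V \<omega> = of_bool (calm (H ?N \<omega>))" for \<omega>
  have hS: "adapted ?N borel S" "adapted ?N borel (\<lambda>h. S (tl h))" "adapted ?N borel (\<lambda>h. S (tl (tl h)))"
    by (rule adapted_max_cusum adapted_Suc[OF adapted_max_cusum] adapted_Suc[OF adapted_Suc[OF adapted_max_cusum]])+
  have mcalm: "adapted ?N (count_space UNIV) calm"
    unfolding adapted_def calm_def
    by (intro pred_intros_logic(3); unfold pred_def;
        rule borel_measurable_le[OF hS(1)[unfolded adapted_def] borel_measurable_const]
          borel_measurable_le[OF hS(2)[unfolded adapted_def] borel_measurable_const]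
          borel_measurable_le[OF hS(3)[unfolded adapted_def] borel_measurable_const])
  have mcalm': "adapted ?N borel (\<lambda>h. of_bool (calm h) :: real)"
    using mcalm unfolding adapted_def by (rule measurable_compose) simp
  have mV: "V \<in> borel_measurable law"
    unfolding V_def by (rule adapted_law[OF mcalm'])
  have iV: "integrable law (\<lambda>\<omega>. V \<omega> * u (pair_at k \<omega>))" for u :: "'a \<times> 'a \<Rightarrow> real" and k
  proof -
    obtain K where K: "0 \<le> K" "\<And>x. \<bar>u x\<bar> \<le> K" using finite_bound[of u] by blast
    show ?thesis
    proof (rule integrable_bounded_law[of _ K])
      show "(\<lambda>\<omega>. V \<omega> * u (pair_at k \<omega>)) \<in> borel_measurable law"
        by (rule borel_measurable_times[OF mV measurable_pair_at])
      show "\<bar>V \<omega> * u (pair_at k \<omega>)\<bar> \<le> K" for \<omega>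
        using K(1) K(2)[of "pair_at k \<omega>"] unfolding V_def by simp
    qed
  qed
  have iV1: "integrable law V" using iV[of "\<lambda>_. 1"] by simp
  have step: "(\<integral>\<omega>. V \<omega> * h (pair_at (Suc n) \<omega>) \<partial>law) = (\<integral>\<omega>. V \<omega> * step_mean ?T h (pair_at n \<omega>) \<partial>law)"
  proof -
    have m: "adapted ?N borel (\<lambda>k. of_bool (calm k) * h (fst (hd k), a))" for a
    proof -
      have "adapted ?N borel (\<lambda>k. h (fst (hd k), a))"
        using adapted_hd[of "Suc n"] unfolding adapted_def by (rule measurable_compose) simp
      with mcalm' show ?thesis unfolding adapted_def by (rule borel_measurable_times)
    qed
    have b: "\<bar>of_bool (calm k) * h (fst (hd k), a)\<bar> \<le> Kh" for k a
      using h[of "(fst (hd k), a)"] by auto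
    have "(\<integral>\<omega>. V \<omega> * h (pair_at (Suc n) \<omega>) \<partial>law)
      = (\<integral>\<omega>. of_bool (calm (H ?N \<omega>)) * h (fst (hd (H ?N \<omega>)), fst (\<omega> ?N)) \<partial>law)"
      by (simp add: V_def pair_at_def)
    also have "\<dots> = (\<integral>\<omega>. (\<Sum>a\<in>UNIV. pmf (policy (H ?N \<omega>)) a * (of_bool (calm (H ?N \<omega>)) * h (fst (hd (H ?N \<omega>)), a))) \<partial>law)"
      by (rule expectation_one_step[OF m b])
    also have "\<dots> = (\<integral>\<omega>. V \<omega> * step_mean ?T h (pair_at n \<omega>) \<partial>law)"
    proof (rule Bochner_Integration.integral_cong[OF refl])
      fix \<omega>
      show "(\<Sum>a\<in>UNIV. pmf (policy (H ?N \<omega>)) a * (of_bool (calm (H ?N \<omega>)) * h (fst (hd (H ?N \<omega>)), a)))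
         = V \<omega> * step_mean ?T h (pair_at n \<omega>)"
      proof (cases "calm (H ?N \<omega>)")
        case True
        then have le: "S (H ?N \<omega>) \<le> ereal \<kappa>" "\<not> S (H (Suc n) \<omega>) > ereal \<kappa>" "\<not> S (H n \<omega>) > ereal \<kappa>"
          unfolding calm_def by (simp_all add: not_less)
        have "policy (H ?N \<omega>) = draw_next \<pi>\<^sub>d (pair_at n \<omega>)"
          using policy_low[OF le(1)] le(2,3) by (simp only: if_False)
        then show ?thesis
          using True sum_draw_next[OF open_loop, of "pair_at n \<omega>" h] by (simp add: V_def pair_at_def del: two_threshold_policy.simps)
      qed (simp add: V_def)
    qed
    finally show ?thesis .
  qed
  have ih: "integrable law (\<lambda>\<omega>. u (pair_at k \<omega>))" for u :: "'a \<times> 'a \<Rightarrow> real" and k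
    by (rule integrable_pair_at)
  have "(\<integral>\<omega>. c (pair_at n \<omega>) \<partial>law) - \<alpha> + (\<integral>\<omega>. h (pair_at (Suc n) \<omega>) \<partial>law) - (\<integral>\<omega>. h (pair_at n \<omega>) \<partial>law)
    = (\<integral>\<omega>. c (pair_at n \<omega>) - \<alpha> + h (pair_at (Suc n) \<omega>) - h (pair_at n \<omega>) \<partial>law)"
    using ih[of c n] ih[of h n] ih[of h "Suc n"] by (simp add: prob_space)
  also have "\<dots> \<le> (\<integral>\<omega>. V \<omega> * c (pair_at n \<omega>) - V \<omega> * \<alpha> + V \<omega> * h (pair_at (Suc n) \<omega>) - V \<omega> * h (pair_at n \<omega>) + B * (1 - V \<omega>) \<partial>law)"
  proof (rule integral_mono)
    show "integrable law (\<lambda>\<omega>. c (pair_at n \<omega>) - \<alpha> + h (pair_at (Suc n) \<omega>) - h (pair_at n \<omega>))"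
      using ih[of c n] ih[of h n] ih[of h "Suc n"] by simp
    show "integrable law (\<lambda>\<omega>. V \<omega> * c (pair_at n \<omega>) - V \<omega> * \<alpha> + V \<omega> * h (pair_at (Suc n) \<omega>) - V \<omega> * h (pair_at n \<omega>) + B * (1 - V \<omega>))"
      using iV[of c n] iV[of h n] iV[of h "Suc n"] iV1 by simp
    fix \<omega>
    have "c (pair_at n \<omega>) - \<alpha> + h (pair_at (Suc n) \<omega>) - h (pair_at n \<omega>) \<le> B"
      unfolding B_def using c[of "pair_at n \<omega>"] h[of "pair_at n \<omega>"] h[of "pair_at (Suc n) \<omega>"] by linarith
    then show "c (pair_at n \<omega>) - \<alpha> + h (pair_at (Suc n) \<omega>) - h (pair_at n \<omega>)
      \<le> V \<omega> * c (pair_at n \<omega>) - V \<omega> * \<alpha> + V \<omega> * h (pair_at (Suc n) \<omega>) - V \<omega> * h (pair_at n \<omega>) + B * (1 - V \<omega>)"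
      by (simp add: V_def)
  qed
  also have "\<dots> = (\<integral>\<omega>. V \<omega> * (c (pair_at n \<omega>) - \<alpha> + step_mean ?T h (pair_at n \<omega>) - h (pair_at n \<omega>)) + B * (1 - V \<omega>) \<partial>law)"
    using iV[of c n] iV[of h n] iV[of h "Suc n"] iV[of "step_mean ?T h" n] iV1 step
    by (simp add: right_diff_distrib distrib_left)
  also have "\<dots> \<le> (\<integral>\<omega>. B * (1 - V \<omega>) \<partial>law)"
  proof (rule integral_mono_AE)
    show "integrable law (\<lambda>\<omega>. V \<omega> * (c (pair_at n \<omega>) - \<alpha> + step_mean ?T h (pair_at n \<omega>) - h (pair_at n \<omega>)) + B * (1 - V \<omega>))"
      using iV[of c n] iV[of h n] iV[of "step_mean ?T h" n] iV1 by (simp add: right_diff_distrib distrib_left)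
    show "integrable law (\<lambda>\<omega>. B * (1 - V \<omega>))" using iV1 by simp
    show "AE \<omega> in law. V \<omega> * (c (pair_at n \<omega>) - \<alpha> + step_mean ?T h (pair_at n \<omega>) - h (pair_at n \<omega>)) + B * (1 - V \<omega>) \<le> B * (1 - V \<omega>)"
      using AE_action_in_support
    proof eventually_elim
      case (elim \<omega>)
      show ?case
      proof (cases "calm (H ?N \<omega>)")
        case True
        then have "pair_at n \<omega> \<in> visited \<pi>\<^sub>d"
          by (intro pair_visited[OF elim]) (simp_all add: calm_def)
        from g[OF this] poisson[of "pair_at n \<omega>"] show ?thesis by (simp add: V_def)
      qed (simp add: V_def)
    qed
  qed
  also have "\<dots> \<le> B * (prob_high \<kappa> n + prob_high \<kappa> (Suc n) + prob_high \<kappa> ?N)"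
  proof -
    define A where "A k = {\<omega> \<in> space law. S (H k \<omega>) > ereal \<kappa>}" for k
    have mA: "A k \<in> sets law" for k
      unfolding A_def by (rule borel_measurable_less[OF borel_measurable_const adapted_law[OF adapted_max_cusum]])
    have iA: "integrable law (indicator (A k) :: _ \<Rightarrow> real)" for k
      using mA[of k] by (simp add: emeasure_eq_measure)
    have "(\<integral>\<omega>. 1 - V \<omega> \<partial>law) \<le> (\<integral>\<omega>. indicator (A n) \<omega> + indicator (A (Suc n)) \<omega> + indicator (A ?N) \<omega> \<partial>law)"
    proof (rule integral_mono)
      fix \<omega> assume "\<omega> \<in> space law"
      then show "1 - V \<omega> \<le> indicator (A n) \<omega> + indicator (A (Suc n)) \<omega> + indicator (A ?N) \<omega>"
        unfolding V_def A_def calm_def by (auto simp: indicator_def not_le)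
    qed (use iV1 iA in auto)
    also have "\<dots> = prob_high \<kappa> n + prob_high \<kappa> (Suc n) + prob_high \<kappa> ?N"
    proof -
      have "prob_high \<kappa> k = measure law (A k)" for k by (simp only: prob_high_def A_def)
      then show ?thesis using iA mA by simp
    qed
    finally show ?thesis using B0 by (simp add: mult_left_mono)
  qed
  finally show ?thesis unfolding B_def by linarith
qed

lemma AOSC_two_threshold_le:
  assumes poisson: "\<And>x. C (fst x) (snd x) = g x + h x - step_mean (snd \<pi>\<^sub>d) h x"
    and g: "\<And>x. x \<in> visited \<pi>\<^sub>d \<Longrightarrow> g x \<le> \<alpha>"
    and c: "\<And>x. \<bar>C (fst x) (snd x)\<bar> \<le> Kc" and h: "\<And>x. \<bar>h x\<bar> \<le> Kh"
    and \<Delta>: "\<Delta> > 0" and gap: "\<And>m a. m \<in> {1..M} \<Longrightarrow> hellinger m a > 0 \<Longrightarrow> hellinger m a \<ge> \<Delta>"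
    and \<theta>: "\<theta> > 0"
    and \<kappa>: "3 * (Kc + 2 * Kh + \<bar>\<alpha>\<bar>) * (real M * ((2 / \<Delta> + 1 / (\<Delta> / CARD('a))) / exp (\<kappa> / 2))) \<le> \<theta> / 2"
  shows "AOSC (p 0) obs C policy \<le> ereal (\<alpha> + \<theta>)"
proof -
  interpret prob_space law by (rule prob_space_law)
  define B where "B = Kc + 2 * Kh + \<bar>\<alpha>\<bar>"
  define r where "r = real M * ((2 / \<Delta> + 1 / (\<Delta> / CARD('a))) / exp (\<kappa> / 2))"
  have B0: "B \<ge> 0" unfolding B_def using c[of undefined] h[of undefined] by linarith
  have r0: "r \<ge> 0" unfolding r_def using \<Delta> by simp
  define e where "e n = (\<integral>\<omega>. h (pair_at n \<omega>) \<partial>law)" for n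
  define cc where "cc n = (\<integral>\<omega>. C (fst (pair_at n \<omega>)) (snd (pair_at n \<omega>)) \<partial>law)" for n
  have eK: "\<bar>e n\<bar> \<le> Kh" for n
  proof -
    have "\<bar>e n\<bar> \<le> (\<integral>\<omega>. \<bar>h (pair_at n \<omega>)\<bar> \<partial>law)" unfolding e_def by (rule integral_abs_bound)
    also have "\<dots> \<le> (\<integral>\<omega>. Kh \<partial>law)"
      by (rule integral_mono) (use h integrable_pair_at[of "\<lambda>x. \<bar>h x\<bar>"] in auto)
    finally show ?thesis using prob_space by simp
  qed
  have step: "cc n \<le> \<alpha> + e n - e (Suc n) + B * (prob_high \<kappa> n + prob_high \<kappa> (Suc n) + prob_high \<kappa> (Suc (Suc n)))" for n
    unfolding cc_def e_def B_def by (rule cost_step[OF poisson g c h])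
  have sum_step: "(\<Sum>n<N. cc n) \<le> \<alpha> * real N + e 0 - e N
      + B * ((\<Sum>n<N. prob_high \<kappa> n) + (\<Sum>n<N. prob_high \<kappa> (Suc n)) + (\<Sum>n<N. prob_high \<kappa> (Suc (Suc n))))" for N
  proof (induction N)
    case (Suc N)
    then show ?case using step[of N] by (simp add: algebra_simps)
  qed simp
  have up: "(\<Sum>k<n. prob_high \<kappa> k) \<le> 2 + r * (real n + 1)" for n
    unfolding r_def
  proof (rule sum_prob_high_le[OF \<Delta> gap])
    show "0 < \<Delta> / CARD('a)" using \<Delta> by simp
    fix h assume "2 \<le> length h" "S h > ereal \<kappa>"
    from reacts_to_leader[OF gap \<Delta> this]
    show "\<exists>m\<in>{1..M}. \<Delta> / CARD('a) \<le> mean_hellinger m h \<and> (\<forall>m'\<in>{1..M}. cusum f m' (tl h) \<le> cusum f m (tl h))" .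
  qed
  have bound: "(\<Sum>n<N. cc n) \<le> (\<alpha> + \<theta> / 2) * real N + (2 * Kh + B * (6 + 9 * r))" for N
  proof -
    have "(\<Sum>n<N. prob_high \<kappa> (Suc n)) \<le> (\<Sum>k<Suc N. prob_high \<kappa> k)"
      unfolding sum.lessThan_Suc_shift using prob_high_nonneg by simp
    moreover have "(\<Sum>n<N. prob_high \<kappa> (Suc (Suc n))) \<le> (\<Sum>k<Suc (Suc N). prob_high \<kappa> k)"
      unfolding sum.lessThan_Suc_shift using prob_high_nonneg by simp
    ultimately have "(\<Sum>n<N. prob_high \<kappa> n) + (\<Sum>n<N. prob_high \<kappa> (Suc n)) + (\<Sum>n<N. prob_high \<kappa> (Suc (Suc n)))
        \<le> 6 + r * (real N + 1) + r * (real (Suc N) + 1) + r * (real (Suc (Suc N)) + 1)"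
      using up[of N] up[of "Suc N"] up[of "Suc (Suc N)"] by linarith
    also have "\<dots> = 3 * r * real N + (6 + 6 * r)" by (simp add: algebra_simps)
    also have "\<dots> \<le> 3 * r * real N + (6 + 9 * r)" using r0 by simp
    finally have "B * ((\<Sum>n<N. prob_high \<kappa> n) + (\<Sum>n<N. prob_high \<kappa> (Suc n)) + (\<Sum>n<N. prob_high \<kappa> (Suc (Suc n))))
        \<le> B * (3 * r * real N + (6 + 9 * r))"
      using B0 by (rule mult_left_mono)
    also have "\<dots> = (3 * B * r) * real N + B * (6 + 9 * r)" by (simp add: algebra_simps)
    also have "\<dots> \<le> (\<theta> / 2) * real N + B * (6 + 9 * r)"
      using \<kappa> unfolding B_def[symmetric] r_def[symmetric] by (intro add_right_mono mult_right_mono) auto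
    finally have "(\<Sum>n<N. cc n) \<le> \<alpha> * real N + e 0 - e N + ((\<theta> / 2) * real N + B * (6 + 9 * r))"
      using sum_step[of N] by linarith
    then show ?thesis using eK[of 0] eK[of N] by (simp add: algebra_simps abs_le_iff)
  qed
  define D where "D = 2 * Kh + B * (6 + 9 * r)"
  have "\<forall>\<^sub>F N in sequentially. ereal (1 / real N * (\<Sum>n<N. cc n)) \<le> ereal (\<alpha> + \<theta>)"
  proof -
    have "\<forall>\<^sub>F N in sequentially. D / real N < \<theta> / 2"
      using lim_const_over_n[of D] \<theta> by (intro order_tendstoD(2)[of _ 0]) auto
    with eventually_gt_at_top[of 0] show ?thesis
    proof eventually_elim
      case (elim N)
      have "1 / real N * (\<Sum>n<N. cc n) \<le> 1 / real N * ((\<alpha> + \<theta> / 2) * real N + D)"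
        using bound[of N] unfolding D_def by (intro mult_left_mono) auto
      also have "\<dots> = \<alpha> + \<theta> / 2 + D / real N" using elim by (simp add: field_simps)
      also have "\<dots> \<le> \<alpha> + \<theta>" using elim by linarith
      finally show ?case by simp
    qed
  qed
  then show ?thesis
    unfolding AOSC_eq cc_def[symmetric] by (rule Limsup_bounded)
qed

end

theorem proposition6:
  fixes p :: "nat \<Rightarrow> real^'n \<Rightarrow> real"
    and obs :: "'a::finite \<Rightarrow> real^'n \<Rightarrow> 'y"
    and \<nu> :: "'a \<Rightarrow> 'y measure"
    and f :: "nat \<Rightarrow> 'a \<Rightarrow> 'y \<Rightarrow> real"
    and M :: nat
    and C :: "'a \<Rightarrow> 'a \<Rightarrow> real"
    and \<alpha> \<theta> :: real
    and \<pi>\<^sub>d :: "'a open_loop"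
    and Astar :: "nat \<Rightarrow> 'a"
    and tie :: "nat set \<Rightarrow> nat"
  assumes model: "signal_model M p obs \<nu> f"
    and "\<alpha> > 0"
    and optimal: "is_arg_min (objective M (p 0) obs \<nu> f) (feasible (p 0) obs C \<alpha>) \<pi>\<^sub>d"
    and positive: "objective M (p 0) obs \<nu> f \<pi>\<^sub>d > 0"
    and Astar: "\<And>m. m \<in> {1..M} \<Longrightarrow> is_arg_max (KL_action \<nu> f m) (\<lambda>a. True) (Astar m)"
    and tie: "\<And>B. B \<subseteq> {1..M} \<Longrightarrow> B \<noteq> {} \<Longrightarrow> tie B \<in> B"
    and "\<theta> > 0"
  shows "\<exists>\<kappa>>0. \<forall>\<gamma>>\<kappa>. \<forall>b>1.
    AOSC (p 0) obs C (fst (two_threshold_test M f Astar tie \<pi>\<^sub>d \<kappa> \<gamma> b)) \<le> ereal (\<alpha> + \<theta>)"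
proof -
  interpret cusum_model M p obs \<nu> f by standard (rule model)
  have feas: "feasible (p 0) obs C \<alpha> \<pi>\<^sub>d" using optimal by (simp add: is_arg_min_def)
  then have ol: "is_open_loop \<pi>\<^sub>d" by (simp add: feasible_def)
  interpret O: open_loop_process "p 0" obs \<pi>\<^sub>d
    by (intro open_loop_process.intro controlled_process.intro open_loop_process_axioms.intro
        noise_pdf Ionescu_Tulcea_open_loop ol)
  obtain g h where gh: "\<And>x. C (fst x) (snd x) = g x + h x - step_mean (snd \<pi>\<^sub>d) h x"
    and g: "\<And>x. x \<in> visited \<pi>\<^sub>d \<Longrightarrow> g x \<le> \<alpha>"
    using O.feasible_poisson[OF feas] by blast
  obtain Kc where Kc: "0 \<le> Kc" "\<And>x. \<bar>C (fst x) (snd x)\<bar> \<le> Kc" using finite_bound[of "\<lambda>x. C (fst x) (snd x)"] by blast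
  obtain Kh where Kh: "0 \<le> Kh" "\<And>x. \<bar>h x\<bar> \<le> Kh" using finite_bound[of h] by blast
  obtain \<Delta> where \<Delta>: "\<Delta> > 0" "\<And>m a. m \<in> {1..M} \<Longrightarrow> hellinger m a > 0 \<Longrightarrow> hellinger m a \<ge> \<Delta>" using hellinger_gap by blast
  define Q where "Q = 3 * (Kc + 2 * Kh + \<bar>\<alpha>\<bar>) * (real M * (2 / \<Delta> + 1 / (\<Delta> / CARD('a))))"
  have Q0: "Q \<ge> 0" unfolding Q_def using Kc(1) Kh(1) \<Delta>(1) by simp
  \<comment> \<open>Chosen such that \<open>exp (\<kappa> / 2) = 2 * Q / \<theta> + 2\<close>; the summand \<open>2\<close> makes \<open>\<kappa>\<close> positive.\<close>
  define \<kappa> where "\<kappa> = 2 * ln (2 * Q / \<theta> + 2)"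
  have "2 * Q / \<theta> \<ge> 0" using Q0 \<open>\<theta> > 0\<close> by simp
  then have pos: "2 * Q / \<theta> + 2 > 1" by linarith
  have \<kappa>: "\<kappa> > 0" "Q / exp (\<kappa> / 2) \<le> \<theta> / 2"
  proof -
    show "\<kappa> > 0" unfolding \<kappa>_def using pos by simp
    have "Q / exp (\<kappa> / 2) = Q / (2 * Q / \<theta> + 2)" unfolding \<kappa>_def using pos by simp
    also have "\<dots> \<le> \<theta> / 2" using pos Q0 \<open>\<theta> > 0\<close> by (simp add: field_simps)
    finally show "Q / exp (\<kappa> / 2) \<le> \<theta> / 2" .
  qed
  show ?thesis
  proof (intro exI[of _ \<kappa>] conjI allI impI \<kappa>(1))
    fix \<gamma> b :: real
    interpret two_threshold M p obs \<nu> f Astar tie \<pi>\<^sub>d \<kappa> b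
      by (intro two_threshold.intro two_threshold_axioms.intro cusum_model_axioms Astar tie ol) (use \<kappa> in auto)
    have "AOSC (p 0) obs C policy \<le> ereal (\<alpha> + \<theta>)"
      by (rule AOSC_two_threshold_le[OF gh g Kc(2) Kh(2) \<Delta> \<open>\<theta> > 0\<close>]) (use \<kappa>(2) in \<open>auto simp: Q_def\<close>)
    then show "AOSC (p 0) obs C (fst (two_threshold_test M f Astar tie \<pi>\<^sub>d \<kappa> \<gamma> b)) \<le> ereal (\<alpha> + \<theta>)"
      by (simp add: two_threshold_test_def)
  qed
qed

end
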